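(* Let $\theta,\alpha$ be inner functions such that $\alpha$ divides $\theta$ (i.e. $\theta\bar\alpha\in H^\infty$). (1) If $\varphi$ is an invertible element of $L^\infty$ and there exist $h_{1+},h_{2+},\overline{h_{2-}}\in H^\infty$ satisfying $$\begin{bmatrix}h_{1+}\\ h_{2+}\end{bmatrix}\in CP^+,\qquad \begin{bmatrix}\bar\alpha h_{1+}\\ h_{2-}\end{bmatrix}\in CP^-\qquad\text{and}\qquad \varphi(h_{2-}+\theta h_{2+})=h_{1+},$$ then $\ker D_\varphi^{\theta,\alpha}=\{0\}$. (2) If, in addition to the hypotheses of (1), $\theta\bar\alpha$ is a finite Blaschke product of degree $k$, then $D_\varphi^{\theta,\alpha}$ is injective, and it is invertible if and only if $\alpha=c\theta$ with $c\in\mathbb C$, $|c|=1$; in particular (the case $\alpha=\theta$), $D_\varphi^{\theta}=D_\varphi^{\theta,\theta}$ is then invertible.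
   Context: $L^2=L^2(\mathbb T)$, $L^\infty=L^\infty(\mathbb T)$, $\mathbb T$ the unit circle; $H^2$, $H^\infty$ are the Hardy spaces of the unit disk $\mathbb D$, viewed also as spaces of boundary functions on $\mathbb T$. For an inner function $\theta$, $K_\theta=H^2\ominus\theta H^2$, $(K_\theta)^\perp=L^2\ominus K_\theta$, and $Q_\theta$ is the orthogonal projection of $L^2$ onto $(K_\theta)^\perp$. For $\varphi\in L^\infty$ and inner $\alpha,\theta$, $D_\varphi^{\theta,\alpha}\colon (K_\theta)^\perp\to(K_\alpha)^\perp$ is defined by $D_\varphi^{\theta,\alpha}f=Q_\alpha(\varphi f)$. Corona pairs: $\mathbb D^+=\mathbb D$, $\mathbb D^-=\mathbb C\setminus(\mathbb D\cup\mathbb T)$. $CP^+$ is the set of $\begin{bmatrix}h_1\\ h_2\end{bmatrix}\in H^\infty\oplus H^\infty$ with $\inf_{z\in\mathbb D^+}(|h_1(z)|+|h_2(z)|)>0$; $CP^-$ is the set of $\begin{bmatrix}h_1\\ h_2\end{bmatrix}\in\overline{H^\infty}\oplus\overline{H^\infty}$ with $\inf_{z\in\mathbb D^-}(|h_1(z)|+|h_2(z)|)>0$, where functions in $\overline{H^\infty}$ (complex conjugates on $\mathbb T$ of $H^\infty$ functions) are extended to bounded analytic functions in $\mathbb D^-$. Equivalently, $\mathfrak h\in CP^-$ iff $\overline{\mathfrak h}\in CP^+$. *)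

theory Defs
  imports "HOL-Analysis.Analysis"
begin

section \<open>Lebesgue spaces on the unit circle\<close>

text \<open>Normalised arc length on the unit circle.\<close>

definition circ :: "complex measure" where
  "circ = distr (uniform_measure lborel {0..2 * pi}) (restrict_space borel (sphere 0 1)) cis"

text \<open>
  Elements of the Lebesgue spaces are represented by functions of type
  \<open>complex \<Rightarrow> complex\<close>, of which only the values on the circle matter. Equality of
  elements is equality almost everywhere on the circle.
\<close>

abbreviation ae_eq :: "(complex \<Rightarrow> complex) \<Rightarrow> (complex \<Rightarrow> complex) \<Rightarrow> bool"  (infix "\<doteq>" 50) where
  "f \<doteq> g \<equiv> (AE z in circ. f z = g z)"

definition L2 :: "(complex \<Rightarrow> complex) set" where
  "L2 = {f \<in> borel_measurable circ. integrable circ (\<lambda>z. (cmod (f z))\<^sup>2)}"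

definition Linf :: "(complex \<Rightarrow> complex) set" where
  "Linf = {f \<in> borel_measurable circ. \<exists>C. AE z in circ. cmod (f z) \<le> C}"

definition invertible_Linf :: "(complex \<Rightarrow> complex) \<Rightarrow> bool" where
  "invertible_Linf f \<longleftrightarrow> f \<in> Linf \<and> (\<exists>g\<in>Linf. (\<lambda>z. f z * g z) \<doteq> (\<lambda>z. 1))"

definition L2_inner :: "(complex \<Rightarrow> complex) \<Rightarrow> (complex \<Rightarrow> complex) \<Rightarrow> complex" where
  "L2_inner f g = (LINT z|circ. f z * cnj (g z))"

definition L2_norm :: "(complex \<Rightarrow> complex) \<Rightarrow> real" where
  "L2_norm f = sqrt (LINT z|circ. (cmod (f z))\<^sup>2)"

text \<open>The representatives of the zero element.\<close>

definition L2_zero :: "(complex \<Rightarrow> complex) set" where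
  "L2_zero = {f \<in> L2. f \<doteq> (\<lambda>z. 0)}"


section \<open>Hardy spaces\<close>

text \<open>
  \<open>F\<close> is the function in the disk (resp. in the exterior of the closed disk) and \<open>f\<close> its
  boundary function, obtained as the radial limit almost everywhere. A bounded analytic function
  in the exterior has a removable singularity at infinity, so nothing is required there.
\<close>

definition bdry_int :: "(complex \<Rightarrow> complex) \<Rightarrow> (complex \<Rightarrow> complex) \<Rightarrow> bool" where
  "bdry_int F f \<longleftrightarrow> (AE z in circ. ((\<lambda>r::real. F (of_real r * z)) \<longlongrightarrow> f z) (at_left 1))"

definition bdry_ext :: "(complex \<Rightarrow> complex) \<Rightarrow> (complex \<Rightarrow> complex) \<Rightarrow> bool" where
  "bdry_ext F f \<longleftrightarrow> (AE z in circ. ((\<lambda>r::real. F (of_real r * z)) \<longlongrightarrow> f z) (at_right 1))"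

definition H2 :: "(complex \<Rightarrow> complex) set" where
  "H2 = {f \<in> L2. \<exists>F. F holomorphic_on ball 0 1 \<and>
           bdd_above ((\<lambda>r::real. LINT z|circ. (cmod (F (of_real r * z)))\<^sup>2) ` {0<..<1}) \<and>
           bdry_int F f}"

definition Hinf_extension :: "(complex \<Rightarrow> complex) \<Rightarrow> (complex \<Rightarrow> complex) \<Rightarrow> bool" where
  "Hinf_extension F f \<longleftrightarrow> F holomorphic_on ball 0 1 \<and> bounded (F ` ball 0 1) \<and> bdry_int F f"

definition Hinf :: "(complex \<Rightarrow> complex) set" where
  "Hinf = {f \<in> Linf. \<exists>F. Hinf_extension F f}"

definition cnj_Hinf :: "(complex \<Rightarrow> complex) set" where
  "cnj_Hinf = {f. (\<lambda>z. cnj (f z)) \<in> Hinf}"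

definition cnj_Hinf_extension :: "(complex \<Rightarrow> complex) \<Rightarrow> (complex \<Rightarrow> complex) \<Rightarrow> bool" where
  "cnj_Hinf_extension F f \<longleftrightarrow>
     F holomorphic_on (- cball 0 1) \<and> bounded (F ` (- cball 0 1)) \<and> bdry_ext F f"

text \<open>Unimodular constants count as inner functions.\<close>

definition inner_fun :: "(complex \<Rightarrow> complex) \<Rightarrow> bool" where
  "inner_fun \<theta> \<longleftrightarrow> \<theta> \<in> Hinf \<and> (AE z in circ. cmod (\<theta> z) = 1)"

definition inner_divides :: "(complex \<Rightarrow> complex) \<Rightarrow> (complex \<Rightarrow> complex) \<Rightarrow> bool" where
  "inner_divides \<alpha> \<theta> \<longleftrightarrow> (\<lambda>z. \<theta> z * cnj (\<alpha> z)) \<in> Hinf"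

text \<open>
  The zeros \<open>a j\<close> are listed with multiplicity; a product of degree \<open>0\<close> is a unimodular constant.
\<close>

definition finite_blaschke :: "nat \<Rightarrow> (complex \<Rightarrow> complex) \<Rightarrow> bool" where
  "finite_blaschke k f \<longleftrightarrow> (\<exists>c a. cmod c = 1 \<and> (\<forall>j<k. a j \<in> ball 0 1) \<and>
     f \<doteq> (\<lambda>z. c * (\<Prod>j<k. (z - a j) / (1 - cnj (a j) * z))))"


section \<open>Corona pairs\<close>

definition CP_plus :: "((complex \<Rightarrow> complex) \<times> (complex \<Rightarrow> complex)) set" where
  "CP_plus = {(h1, h2). h1 \<in> Hinf \<and> h2 \<in> Hinf \<and>
     (\<exists>H1 H2. Hinf_extension H1 h1 \<and> Hinf_extension H2 h2 \<and>
        0 < (INF z\<in>ball 0 1. cmod (H1 z) + cmod (H2 z)))}"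

definition CP_minus :: "((complex \<Rightarrow> complex) \<times> (complex \<Rightarrow> complex)) set" where
  "CP_minus = {(h1, h2). h1 \<in> cnj_Hinf \<and> h2 \<in> cnj_Hinf \<and>
     (\<exists>H1 H2. cnj_Hinf_extension H1 h1 \<and> cnj_Hinf_extension H2 h2 \<and>
        0 < (INF z\<in>- cball 0 1. cmod (H1 z) + cmod (H2 z)))}"


section \<open>Model spaces and dual truncated Toeplitz operators\<close>

definition model_space :: "(complex \<Rightarrow> complex) \<Rightarrow> (complex \<Rightarrow> complex) set" where
  "model_space \<theta> = {f \<in> H2. \<forall>g\<in>H2. L2_inner f (\<lambda>z. \<theta> z * g z) = 0}"

definition model_perp :: "(complex \<Rightarrow> complex) \<Rightarrow> (complex \<Rightarrow> complex) set" where
  "model_perp \<theta> = {f \<in> L2. \<forall>g\<in>model_space \<theta>. L2_inner f g = 0}"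

text \<open>
  Orthogonal projection of \<open>f \<in> L2\<close> onto a closed subspace \<open>X\<close>: the element of \<open>X\<close>, unique
  up to equality almost everywhere, whose difference from \<open>f\<close> is orthogonal to \<open>X\<close>.
\<close>

definition L2_proj :: "(complex \<Rightarrow> complex) set \<Rightarrow> (complex \<Rightarrow> complex) \<Rightarrow> complex \<Rightarrow> complex" where
  "L2_proj X f = (SOME g. g \<in> X \<and> (\<forall>h\<in>X. L2_inner (\<lambda>z. f z - g z) h = 0))"

definition dual_toeplitz ::
    "(complex \<Rightarrow> complex) \<Rightarrow> (complex \<Rightarrow> complex) \<Rightarrow> (complex \<Rightarrow> complex)
      \<Rightarrow> (complex \<Rightarrow> complex) \<Rightarrow> complex \<Rightarrow> complex" where
  "dual_toeplitz \<theta> \<alpha> \<phi> f = L2_proj (model_perp \<alpha>) (\<lambda>z. \<phi> z * f z)"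


section \<open>Operators between subspaces of the square integrable functions\<close>

definition op_ker ::
    "((complex \<Rightarrow> complex) \<Rightarrow> complex \<Rightarrow> complex)
      \<Rightarrow> (complex \<Rightarrow> complex) set \<Rightarrow> (complex \<Rightarrow> complex) set" where
  "op_ker T X = {f \<in> X. T f \<doteq> (\<lambda>z. 0)}"

definition op_injective ::
    "((complex \<Rightarrow> complex) \<Rightarrow> complex \<Rightarrow> complex)
      \<Rightarrow> (complex \<Rightarrow> complex) set \<Rightarrow> bool" where
  "op_injective T X \<longleftrightarrow> (\<forall>f\<in>X. \<forall>g\<in>X. T f \<doteq> T g \<longrightarrow> f \<doteq> g)"

definition bounded_op ::
    "((complex \<Rightarrow> complex) \<Rightarrow> complex \<Rightarrow> complex)
      \<Rightarrow> (complex \<Rightarrow> complex) set \<Rightarrow> (complex \<Rightarrow> complex) set \<Rightarrow> bool" where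
  "bounded_op T X Y \<longleftrightarrow>
     (\<forall>f\<in>X. T f \<in> Y) \<and>
     (\<forall>f\<in>X. \<forall>g\<in>X. T (\<lambda>z. f z + g z) \<doteq> (\<lambda>z. T f z + T g z)) \<and>
     (\<forall>c. \<forall>f\<in>X. T (\<lambda>z. c * f z) \<doteq> (\<lambda>z. c * T f z)) \<and>
     (\<exists>C. \<forall>f\<in>X. L2_norm (T f) \<le> C * L2_norm f)"

definition op_invertible ::
    "((complex \<Rightarrow> complex) \<Rightarrow> complex \<Rightarrow> complex)
      \<Rightarrow> (complex \<Rightarrow> complex) set \<Rightarrow> (complex \<Rightarrow> complex) set \<Rightarrow> bool" where
  "op_invertible T X Y \<longleftrightarrow> bounded_op T X Y \<and>
     (\<exists>S. bounded_op S Y X \<and> (\<forall>f\<in>X. S (T f) \<doteq> f) \<and> (\<forall>g\<in>Y. T (S g) \<doteq> g))"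

end

theory Submission
  imports Defs "HOL-Complex_Analysis.Complex_Analysis"
begin

text \<open>
  The orthogonal complement of the model space of \<open>\<theta>\<close> is \<open>HM + \<theta> HP\<close>, where \<open>HP\<close> is the Hardy space
  and \<open>HM\<close> its complement. If \<open>\<phi> f = g + k\<close> with \<open>f = m + \<theta> u\<close> and \<open>k\<close> in the model space of \<open>\<alpha>\<close>, then
  multiplication by \<open>cnj \<alpha> h1\<close> and the relation between \<open>\<phi>\<close> and the corona pairs decouple the equation
  into \<open>(cnj \<alpha> h1) m - hm (cnj \<alpha> k)\<close> in \<open>HM\<close> and \<open>\<theta> cnj \<alpha> (h1 u - h2 k)\<close> in \<open>HP\<close>. For \<open>g = 0\<close> both vanish and
  division by the corona pairs gives \<open>f = 0\<close>. For \<open>\<alpha> = c \<theta>\<close> the two halves can be solved separately and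
  glued along the circle, which gives a bounded inverse. If \<open>\<theta> cnj \<alpha>\<close> is a Blaschke product with a zero \<open>a\<close>,
  then the reproducing kernel at \<open>a\<close> produces an element orthogonal to the range.

  The sup-norm corona theorem is not needed: it is enough to solve \<open>h1 x + h2 y = R\<close> inside the Hardy
  space. By duality this is a lower bound for the adjoint operator, which on dilated data follows
  from Wolff's argument, that is, Green's formula with weight \<open>log (1 / |z|)\<close> and a Carleson estimate.
\<close>

section \<open>Semi-inner products and the Riesz representation\<close>

text \<open>Model spaces are defined by radial limits, while the orthogonality arguments take place
  among Fourier coefficients. The two are linked by \<open>H2 \<subseteq> HP\<close> and by bounded
  functions whose radial limits can be verified directly, such as powers of z and backward shifts of
  \<theta>.

  Green's formula requires smoothness across the circle. Dilation makes the corona pair holomorphic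
  on a larger disk, and for a polynomial p the splitting of \<open>h * cnj p\<close> is explicit.
  The dilation can be undone because the constant depends only on the bounds \<epsilon> and M of the
  pair.

  Solutions of the corona equation in the Hardy space need not be bounded, so a quotient formed with
  them is at first only integrable; the lower bound of the pair on the circle makes it square
  integrable again. Each solution comes with a norm bound, since an inverse has to be a bounded
  operator.

  Functions are never identified modulo null sets. Forms are therefore only semidefinite, operators
  are linear almost everywhere, and the linearity of the inverse is deduced from
  injectivity.\<close>

lemma discriminant_nonpos:
  fixes a b c :: real
  assumes a: "0 \<le> a" and c: "0 \<le> c" and nn: "\<And>t. 0 \<le> c + 2 * t * b + t\<^sup>2 * a"
  shows "b\<^sup>2 \<le> a * c"
proof (cases "a = 0")
  case True
  have "b = 0"
  proof (rule ccontr)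
    assume "b \<noteq> 0"
    \<comment> \<open>At this t the affine function takes the value -1.\<close>
    then show False using nn[of "- (c + 1) / (2 * b)"] True by (simp add: field_simps)
  qed
  then show ?thesis using a c by simp
next
  case False
  then have "a > 0" using a by simp
  have "c + 2 * (- b / a) * b + (- b / a)\<^sup>2 * a = c - b\<^sup>2 / a"
    using \<open>a > 0\<close> by (simp add: field_simps power2_eq_square)
  with nn[of "- b / a"] have "b\<^sup>2 / a \<le> c" by simp
  then show ?thesis using \<open>a > 0\<close> by (simp add: field_simps)
qed

text \<open>The form may be degenerate, because functions that agree almost everywhere remain
  distinct. It is instantiated by \<open>L2_inner\<close> on \<open>L2\<close> and on subspaces, and
  later on \<open>HP\<close> by the form that belongs to the adjoint of the corona map.\<close>

locale semi_inner =
  fixes V :: "(complex \<Rightarrow> complex) set" and b :: "(complex \<Rightarrow> complex) \<Rightarrow> (complex \<Rightarrow> complex) \<Rightarrow> complex"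
  assumes zero_mem: "(\<lambda>z. 0) \<in> V"
    and add_mem: "f \<in> V \<Longrightarrow> g \<in> V \<Longrightarrow> (\<lambda>z. f z + g z) \<in> V"
    and scale_mem: "f \<in> V \<Longrightarrow> (\<lambda>z. c * f z) \<in> V"
    and form_add: "f \<in> V \<Longrightarrow> g \<in> V \<Longrightarrow> h \<in> V \<Longrightarrow> b (\<lambda>z. f z + g z) h = b f h + b g h"
    and form_scale: "f \<in> V \<Longrightarrow> g \<in> V \<Longrightarrow> b (\<lambda>z. c * f z) g = c * b f g"
    and form_cnj: "f \<in> V \<Longrightarrow> g \<in> V \<Longrightarrow> b g f = cnj (b f g)"
    and form_nonneg: "f \<in> V \<Longrightarrow> 0 \<le> Re (b f f)"
begin

definition nrm :: "(complex \<Rightarrow> complex) \<Rightarrow> real" where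
  "nrm f = sqrt (Re (b f f))"

lemma minus_mem: "f \<in> V \<Longrightarrow> (\<lambda>z. - f z) \<in> V"
  using scale_mem[of f "-1"] by simp

lemma diff_mem: "f \<in> V \<Longrightarrow> g \<in> V \<Longrightarrow> (\<lambda>z. f z - g z) \<in> V"
  using add_mem[OF _ minus_mem, of f g] by simp

lemma form_minus: "f \<in> V \<Longrightarrow> g \<in> V \<Longrightarrow> b (\<lambda>z. - f z) g = - b f g"
  using form_scale[of f g "-1"] by simp

lemma form_diff: "f \<in> V \<Longrightarrow> g \<in> V \<Longrightarrow> h \<in> V \<Longrightarrow> b (\<lambda>z. f z - g z) h = b f h - b g h"
  using form_add[OF _ minus_mem, of f g h] by (simp add: form_minus)

lemma form_add_right: "f \<in> V \<Longrightarrow> g \<in> V \<Longrightarrow> h \<in> V \<Longrightarrow> b h (\<lambda>z. f z + g z) = b h f + b h g"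
  by (subst (1 2 3) form_cnj) (auto simp: form_add add_mem)

lemma form_scale_right: "f \<in> V \<Longrightarrow> g \<in> V \<Longrightarrow> b g (\<lambda>z. c * f z) = cnj c * b g f"
  by (subst (1 2) form_cnj) (auto simp: form_scale scale_mem)

lemma form_diff_right: "f \<in> V \<Longrightarrow> g \<in> V \<Longrightarrow> h \<in> V \<Longrightarrow> b h (\<lambda>z. f z - g z) = b h f - b h g"
  by (subst (1 2 3) form_cnj) (auto simp: form_diff diff_mem)

lemma nrm_nonneg: "f \<in> V \<Longrightarrow> 0 \<le> nrm f"
  by (simp add: nrm_def form_nonneg)

lemma nrm_square: "f \<in> V \<Longrightarrow> (nrm f)\<^sup>2 = Re (b f f)"
  by (simp add: nrm_def form_nonneg)

lemma form_self_real: "f \<in> V \<Longrightarrow> b f f = of_real ((nrm f)\<^sup>2)"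
  using form_cnj[of f f] by (simp add: nrm_square complex_eq_iff)

lemma nrm_square_add_scale:
  assumes "f \<in> V" "g \<in> V"
  shows "(nrm (\<lambda>z. f z + c * g z))\<^sup>2 = (nrm f)\<^sup>2 + 2 * Re (cnj c * b f g) + (cmod c)\<^sup>2 * (nrm g)\<^sup>2"
proof -
  have "b g f = cnj (b f g)" using assms form_cnj by blast
  moreover have "b g g = of_real ((nrm g)\<^sup>2)" using assms form_self_real by blast
  ultimately have "b (\<lambda>z. f z + c * g z) (\<lambda>z. f z + c * g z) =
     b f f + cnj c * b f g + cnj (cnj c * b f g) + of_real ((cmod c)\<^sup>2 * (nrm g)\<^sup>2)"
    using assms by (simp add: form_add form_add_right form_scale form_scale_right scale_mem add_mem
        complex_norm_square[symmetric] algebra_simps del: of_real_power)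
  then show ?thesis
    using assms by (simp add: nrm_square add_mem scale_mem)
qed

lemma form_bound:
  assumes f: "f \<in> V" and g: "g \<in> V"
  shows "cmod (b f g) \<le> nrm f * nrm g"
proof -
  have "(cmod (b f g))\<^sup>2 \<le> (nrm g)\<^sup>2 * (nrm f)\<^sup>2"
  proof (rule discriminant_nonpos)
    fix t :: real
    \<comment> \<open>The phase of \<open>b f g\<close>: rotating by it makes the mixed term of the
      expansion real and equal to the modulus.\<close>
    define s where "s = (if b f g = 0 then 1 else b f g / cmod (b f g))"
    have s1: "cmod s = 1" by (simp add: s_def norm_divide)
    have s2: "cnj s * b f g = of_real (cmod (b f g))"
      using complex_norm_square[of "b f g"]
      by (auto simp: s_def power2_eq_square mult.commute divide_simps)
    have "Re (cnj (of_real t * s) * b f g) = t * cmod (b f g)"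
      using s2 by (simp add: mult.assoc)
    then have "(nrm (\<lambda>z. f z + (of_real t * s) * g z))\<^sup>2
        = (nrm f)\<^sup>2 + 2 * t * cmod (b f g) + t\<^sup>2 * (nrm g)\<^sup>2"
      using nrm_square_add_scale[OF f g, of "of_real t * s"] s1 by (simp add: norm_mult)
    then show "0 \<le> (nrm f)\<^sup>2 + 2 * t * cmod (b f g) + t\<^sup>2 * (nrm g)\<^sup>2"
      using zero_le_power2 by metis
  qed auto
  then have "(cmod (b f g))\<^sup>2 \<le> (nrm f * nrm g)\<^sup>2" by (simp add: power_mult_distrib mult.commute)
  then show ?thesis using nrm_nonneg f g by (meson mult_nonneg_nonneg power2_le_imp_le)
qed

lemma nrm_add:
  assumes f: "f \<in> V" and g: "g \<in> V"
  shows "nrm (\<lambda>z. f z + g z) \<le> nrm f + nrm g"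
proof -
  have "(nrm (\<lambda>z. f z + g z))\<^sup>2 = (nrm f)\<^sup>2 + 2 * Re (b f g) + (nrm g)\<^sup>2"
    using nrm_square_add_scale[OF f g, of 1] by simp
  also have "\<dots> \<le> (nrm f)\<^sup>2 + 2 * (nrm f * nrm g) + (nrm g)\<^sup>2"
    using form_bound[OF f g] complex_Re_le_cmod[of "b f g"] by simp
  also have "\<dots> = (nrm f + nrm g)\<^sup>2" by (simp add: power2_sum)
  finally show ?thesis using nrm_nonneg f g by (meson add_nonneg_nonneg power2_le_imp_le)
qed

text \<open>With the zero function as first summand, only the quadratic term survives in the
  expansion of the square.\<close>

lemma nrm_scale: "f \<in> V \<Longrightarrow> nrm (\<lambda>z. c * f z) = cmod c * nrm f"
  using nrm_square_add_scale[of "\<lambda>z. 0 * f z" f c] form_scale[of f "\<lambda>z. 0" 0] form_scale[of "\<lambda>z. 0" f 0]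
    form_scale[of "\<lambda>z. 0" "\<lambda>z. 0" 0]
    zero_mem nrm_nonneg[of f] nrm_nonneg[OF scale_mem, of f c]
  by (simp add: nrm_def power_mult_distrib[symmetric] del: power_mult_distrib real_sqrt_eq_iff)

text \<open>The representing element minimises the functional J, squared norm minus twice the real
  part of \<open>l\<close>. At an almost minimal point the first variation is small, which makes a
  minimising sequence Cauchy. Completeness is a hypothesis because each form has its own reason for
  it.\<close>

lemma riesz_representation:
  assumes complete: "\<And>X. (\<And>n. X n \<in> V) \<Longrightarrow>
        (\<And>e. 0 < e \<Longrightarrow> \<exists>N. \<forall>m\<ge>N. \<forall>n\<ge>N. nrm (\<lambda>z. X m z - X n z) < e) \<Longrightarrow>
        \<exists>l\<in>V. (\<lambda>n. nrm (\<lambda>z. X n z - l z)) \<longlonglongrightarrow> 0"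
    and l_add: "\<And>f g. f \<in> V \<Longrightarrow> g \<in> V \<Longrightarrow> l (\<lambda>z. f z + g z) = l f + l g"
    and l_scale: "\<And>f c. f \<in> V \<Longrightarrow> l (\<lambda>z. c * f z) = c * l f"
    and l_bound: "\<And>f. f \<in> V \<Longrightarrow> cmod (l f) \<le> C * nrm f"
  shows "\<exists>p\<in>V. \<forall>q\<in>V. l q = b q p"
proof -
  define J where "J p = (nrm p)\<^sup>2 - 2 * Re (l p)" for p
  have J_lower: "- C\<^sup>2 \<le> J p" if "p \<in> V" for p
  proof -
    have "Re (l p) \<le> C * nrm p" using l_bound[OF that] complex_Re_le_cmod[of "l p"] by linarith
    moreover have "0 \<le> (nrm p - C)\<^sup>2" by simp
    ultimately show ?thesis by (simp add: J_def power2_diff algebra_simps)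
  qed
  define m where "m = Inf (J ` V)"
  have bdd: "bdd_below (J ` V)" using J_lower by (auto intro!: bdd_belowI)
  have m_le: "m \<le> J p" if "p \<in> V" for p
    unfolding m_def using bdd that by (auto intro!: cInf_lower)
  have "\<exists>p\<in>V. J p < m + 1 / real (Suc n)" for n
  proof -
    have "\<exists>y\<in>J ` V. y < m + 1 / real (Suc n)"
      unfolding m_def using zero_mem by (subst cInf_less_iff[symmetric]) (auto simp: bdd)
    then show ?thesis by blast
  qed
  then obtain P where P: "\<And>n. P n \<in> V" "\<And>n. J (P n) < m + 1 / real (Suc n)" by metis
  \<comment> \<open>Half the derivative of J at \<open>P n\<close> in the direction q. Near the
    infimum the quadratic \<open>J (P n + t q) - m\<close> is nonnegative with small constant term,
    so its linear coefficient is small.\<close>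
  define d where "d n q = Re (b (P n) q) - Re (l q)" for n q
  have d_bound: "\<bar>d n q\<bar> \<le> nrm q * sqrt (1 / real (Suc n))" if q: "q \<in> V" for n q
  proof -
    have "(d n q)\<^sup>2 \<le> (nrm q)\<^sup>2 * (1 / real (Suc n))"
    proof (rule discriminant_nonpos)
      fix t :: real
      have "m \<le> J (\<lambda>z. P n z + of_real t * q z)"
        using P q by (auto intro!: m_le add_mem scale_mem)
      also have "\<dots> = J (P n) + 2 * t * d n q + t\<^sup>2 * (nrm q)\<^sup>2"
        using nrm_square_add_scale[OF P(1) q, of n "of_real t"] P(1) q
        by (simp add: J_def d_def l_add l_scale scale_mem algebra_simps)
      finally show "0 \<le> 1 / real (Suc n) + 2 * t * d n q + t\<^sup>2 * (nrm q)\<^sup>2"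
        using P(2)[of n] by linarith
    qed auto
    then have "sqrt ((d n q)\<^sup>2) \<le> sqrt ((nrm q)\<^sup>2 * (1 / real (Suc n)))" by (rule real_sqrt_le_mono)
    then show ?thesis using nrm_nonneg[OF q] by (simp only: real_sqrt_mult real_sqrt_abs abs_of_nonneg)
  qed
  have null: "(\<lambda>n. sqrt (1 / real (Suc n))) \<longlonglongrightarrow> 0"
    using tendsto_real_sqrt[OF LIMSEQ_inverse_real_of_nat] by (simp add: inverse_eq_divide)
  \<comment> \<open>Tested on the difference of two members, the difference of the two first
    variations is the square of its norm; the functional \<open>l\<close> cancels.\<close>
  have close: "nrm (\<lambda>z. P n z - P k z) \<le> sqrt (1 / real (Suc n)) + sqrt (1 / real (Suc k))" for n k
  proof -
    let ?q = "\<lambda>z. P n z - P k z"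
    have q: "?q \<in> V" using P by (simp add: diff_mem)
    have "nrm ?q * nrm ?q = d n ?q - d k ?q"
      using nrm_square[OF q] q P(1) form_diff[of "P n" "P k" ?q] by (simp add: d_def power2_eq_square)
    also have "\<dots> \<le> nrm ?q * (sqrt (1 / real (Suc n)) + sqrt (1 / real (Suc k)))"
      using d_bound[OF q, of n] d_bound[OF q, of k] by (simp add: distrib_left)
    finally show ?thesis using nrm_nonneg[OF q]
      by (smt (verit) mult_left_less_imp_less real_sqrt_ge_zero divide_nonneg_nonneg of_nat_0_le_iff mult_less_cancel_left)
  qed
  have "\<exists>p\<in>V. (\<lambda>n. nrm (\<lambda>z. P n z - p z)) \<longlonglongrightarrow> 0"
  proof (rule complete)
    fix e :: real assume "0 < e"
    then have "eventually (\<lambda>n. sqrt (1 / real (Suc n)) < e / 2) sequentially"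
      using null by (intro order_tendstoD) auto
    then obtain N where N: "\<And>n. N \<le> n \<Longrightarrow> sqrt (1 / real (Suc n)) < e / 2"
      by (auto simp: eventually_sequentially)
    have "nrm (\<lambda>z. P n z - P k z) < e" if "N \<le> n" "N \<le> k" for n k
      using close[of n k] N[OF that(1)] N[OF that(2)] by linarith
    then show "\<exists>N. \<forall>m\<ge>N. \<forall>n\<ge>N. nrm (\<lambda>z. P m z - P n z) < e" by blast
  qed (rule P)
  then obtain p where p: "p \<in> V" and lim: "(\<lambda>n. nrm (\<lambda>z. P n z - p z)) \<longlonglongrightarrow> 0" by blast
  have re: "Re (b p q) = Re (l q)" if q: "q \<in> V" for q
  proof -
    have "\<bar>Re (b p q) - Re (l q)\<bar> \<le> nrm (\<lambda>z. P n z - p z) * nrm q + nrm q * sqrt (1 / real (Suc n))" for n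
    proof -
      have "b (\<lambda>z. P n z - p z) q = b (P n) q - b p q"
        using P(1) p q by (simp add: form_diff)
      moreover have "cmod (b (\<lambda>z. P n z - p z) q) \<le> nrm (\<lambda>z. P n z - p z) * nrm q"
        using P(1) p q by (intro form_bound diff_mem)
      ultimately have "\<bar>Re (b (P n) q) - Re (b p q)\<bar> \<le> nrm (\<lambda>z. P n z - p z) * nrm q"
        using abs_Re_le_cmod[of "b (P n) q - b p q"] by simp
      then show ?thesis using d_bound[OF q, of n] by (simp add: d_def)
    qed
    moreover have "(\<lambda>n. nrm (\<lambda>z. P n z - p z) * nrm q + nrm q * sqrt (1 / real (Suc n)))
        \<longlonglongrightarrow> 0 * nrm q + nrm q * 0"
      by (intro tendsto_intros lim null)
    ultimately have "\<bar>Re (b p q) - Re (l q)\<bar> \<le> 0"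
      by (intro LIMSEQ_le_const[of _ 0]) auto
    then show ?thesis by simp
  qed
  have "l q = b q p" if q: "q \<in> V" for q
  proof -
    \<comment> \<open>J sees only real parts; the imaginary part is obtained from the direction
      \<open>\<i> * q\<close>.\<close>
    have "Re (b p (\<lambda>z. \<i> * q z)) = Re (l (\<lambda>z. \<i> * q z))" using q by (intro re scale_mem)
    then have "Im (b p q) = - Im (l q)" using q p by (simp add: l_scale form_scale_right)
    with re[OF q] have "b p q = cnj (l q)" by (simp add: complex_eq_iff)
    then show ?thesis using form_cnj[OF p q] by simp
  qed
  with p show ?thesis by blast
qed

end

section \<open>The space of square integrable functions on the circle\<close>

lemma cis_measurable_circle:
  "cis \<in> measurable (uniform_measure lborel {0..2 * pi}) (restrict_space borel (sphere 0 1))"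
proof -
  have "cis \<in> borel_measurable borel"
    by (intro borel_measurable_continuous_onI continuous_intros continuous_on_cis)
  then have "cis \<in> measurable borel (restrict_space borel (sphere 0 1))"
    by (intro measurable_restrict_space2) auto
  then show ?thesis
    by (simp cong: measurable_cong_sets)
qed

lemma space_circ [simp]: "space circ = sphere 0 1"
  by (simp add: circ_def space_restrict_space)

lemma sets_circ [measurable_cong]: "sets circ = sets (restrict_space borel (sphere 0 1))"
  by (simp add: circ_def)

lemma emeasure_circ_space: "emeasure circ (sphere 0 1) = 1"
proof -
  let ?M = "uniform_measure lborel {0..2 * pi}"
  have "sphere 0 1 \<in> sets (restrict_space borel (sphere 0 1) :: complex measure)"
    using sets.top[of "restrict_space borel (sphere 0 1) :: complex measure"]
    by (simp add: space_restrict_space)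
  then have "emeasure circ (sphere 0 1) = emeasure ?M (cis -` sphere 0 1 \<inter> space ?M)"
    unfolding circ_def by (rule emeasure_distr[OF cis_measurable_circle])
  also have "cis -` sphere 0 1 \<inter> space ?M = space ?M" by auto
  also have "emeasure ?M (space ?M) = 1"
    by (simp add: ennreal_divide_self)
  finally show ?thesis .
qed

interpretation circ: finite_measure circ
  by standard (simp add: emeasure_circ_space)

lemma measure_circ_space [simp]: "measure circ (sphere 0 1) = 1"
  by (simp add: measure_def emeasure_circ_space)

lemma circ_measurable_borel [measurable (raw)]:
  "f \<in> borel_measurable borel \<Longrightarrow> f \<in> borel_measurable circ"
  unfolding measurable_cong_sets[OF sets_circ refl] by (rule measurable_restrict_space1)

lemma circ_measurable_continuous:
  "continuous_on (sphere 0 1) f \<Longrightarrow> f \<in> borel_measurable circ"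
  unfolding measurable_cong_sets[OF sets_circ refl]
  by (rule borel_measurable_continuous_on_restrict)

lemma AE_circ_norm: "AE z in circ. cmod z = 1"
  by (rule AE_I2) simp

lemma integrable_circ_bounded:
  fixes f :: "complex \<Rightarrow> 'b :: {banach, second_countable_topology}"
  assumes "f \<in> borel_measurable circ" "AE z in circ. norm (f z) \<le> C"
  shows "integrable circ f"
  using assms by (intro circ.integrable_const_bound[where B = C])

lemma L2_measurable: "f \<in> L2 \<Longrightarrow> f \<in> borel_measurable circ"
  by (simp add: L2_def)

lemma L2_square_integrable: "f \<in> L2 \<Longrightarrow> integrable circ (\<lambda>z. (cmod (f z))\<^sup>2)"
  by (simp add: L2_def)

lemma L2_I_bound:
  assumes "f \<in> borel_measurable circ" "integrable circ g"
    and "AE z in circ. (cmod (f z))\<^sup>2 \<le> g z"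
  shows "f \<in> L2"
  unfolding L2_def using assms
  by (auto intro!: Bochner_Integration.integrable_bound[OF assms(2)])

lemma L2_mult_integrable:
  assumes "f \<in> L2" "g \<in> L2"
  shows "integrable circ (\<lambda>z. f z * g z)"
proof (rule Bochner_Integration.integrable_bound)
  show "integrable circ (\<lambda>z. (cmod (f z))\<^sup>2 + (cmod (g z))\<^sup>2)"
    using assms by (simp add: L2_square_integrable)
  have "norm (f z * g z) \<le> norm ((cmod (f z))\<^sup>2 + (cmod (g z))\<^sup>2)" for z
    using sum_squares_bound[of "cmod (f z)" "cmod (g z)"]
      mult_nonneg_nonneg[OF norm_ge_zero[of "f z"] norm_ge_zero[of "g z"]]
    unfolding norm_mult real_norm_def by linarith
  then show "AE z in circ. norm (f z * g z) \<le> norm ((cmod (f z))\<^sup>2 + (cmod (g z))\<^sup>2)"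
    by simp
qed (use assms in \<open>simp add: L2_measurable borel_measurable_times\<close>)

lemma circ_measurable_cnj [measurable (raw)]:
  assumes "f \<in> borel_measurable circ"
  shows "(\<lambda>z. cnj (f z)) \<in> borel_measurable circ"
proof -
  have "cnj \<in> borel_measurable borel"
    by (intro borel_measurable_continuous_onI continuous_intros)
  from measurable_compose[OF assms this] show ?thesis .
qed

lemma L2_cnj: "f \<in> L2 \<Longrightarrow> (\<lambda>z. cnj (f z)) \<in> L2"
  by (auto simp: L2_def circ_measurable_cnj)

lemma L2_inner_integrable: "f \<in> L2 \<Longrightarrow> g \<in> L2 \<Longrightarrow> integrable circ (\<lambda>z. f z * cnj (g z))"
  using L2_mult_integrable L2_cnj by blast

lemma L2_add_closed:
  assumes "f \<in> L2" "g \<in> L2"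
  shows "(\<lambda>z. f z + g z) \<in> L2"
proof (rule L2_I_bound)
  show "integrable circ (\<lambda>z. 2 * (cmod (f z))\<^sup>2 + 2 * (cmod (g z))\<^sup>2)"
    using assms by (simp add: L2_square_integrable)
  have "(cmod (f z + g z))\<^sup>2 \<le> 2 * (cmod (f z))\<^sup>2 + 2 * (cmod (g z))\<^sup>2" for z
  proof -
    have "(cmod (f z + g z))\<^sup>2 \<le> (cmod (f z) + cmod (g z))\<^sup>2"
      by (intro power_mono norm_triangle_ineq) auto
    then show ?thesis using sum_squares_bound[of "cmod (f z)" "cmod (g z)"]
      by (simp add: power2_sum)
  qed
  then show "AE z in circ. (cmod (f z + g z))\<^sup>2 \<le> 2 * (cmod (f z))\<^sup>2 + 2 * (cmod (g z))\<^sup>2"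
    by simp
qed (use assms in \<open>simp add: L2_measurable borel_measurable_add\<close>)

lemma L2_mult_bounded:
  assumes "f \<in> L2" "h \<in> borel_measurable circ" "AE z in circ. cmod (h z) \<le> C"
  shows "(\<lambda>z. h z * f z) \<in> L2"
proof (rule L2_I_bound)
  show "integrable circ (\<lambda>z. C\<^sup>2 * (cmod (f z))\<^sup>2)"
    using assms by (simp add: L2_square_integrable)
  show "AE z in circ. (cmod (h z * f z))\<^sup>2 \<le> C\<^sup>2 * (cmod (f z))\<^sup>2"
    using assms(3) by eventually_elim (auto simp: norm_mult power_mult_distrib intro!: mult_right_mono power_mono)
qed (use assms in \<open>simp add: L2_measurable borel_measurable_times\<close>)

lemma L2_scale: "f \<in> L2 \<Longrightarrow> (\<lambda>z. c * f z) \<in> L2"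
  by (rule L2_mult_bounded[where C = "cmod c"]) auto

lemma L2_bounded:
  assumes "h \<in> borel_measurable circ" "AE z in circ. cmod (h z) \<le> C"
  shows "h \<in> L2"
proof (rule L2_I_bound[where g = "\<lambda>z. C\<^sup>2"])
  show "AE z in circ. (cmod (h z))\<^sup>2 \<le> C\<^sup>2"
    using assms(2) by eventually_elim (auto intro!: power_mono)
qed (use assms in auto)

interpretation Lsp: semi_inner L2 L2_inner
proof
  fix f g h :: "complex \<Rightarrow> complex" and c :: complex
  show "(\<lambda>z. 0) \<in> L2" by (rule L2_bounded[where C = 0]) auto
  show "f \<in> L2 \<Longrightarrow> g \<in> L2 \<Longrightarrow> (\<lambda>z. f z + g z) \<in> L2" by (rule L2_add_closed)
  show "f \<in> L2 \<Longrightarrow> (\<lambda>z. c * f z) \<in> L2" by (rule L2_scale)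
  show "L2_inner (\<lambda>z. f z + g z) h = L2_inner f h + L2_inner g h" if "f \<in> L2" "g \<in> L2" "h \<in> L2"
    using that by (simp add: L2_inner_def distrib_right L2_inner_integrable)
  show "L2_inner (\<lambda>z. c * f z) g = c * L2_inner f g"
    by (simp add: L2_inner_def mult.assoc)
  show "L2_inner g f = cnj (L2_inner f g)"
    unfolding L2_inner_def by (subst Bochner_Integration.integral_cnj[symmetric]) (simp add: mult.commute)
  have "L2_inner f f = of_real (LINT z|circ. (cmod (f z))\<^sup>2)"
    unfolding L2_inner_def complex_norm_square[symmetric] by (rule integral_complex_of_real)
  then show "0 \<le> Re (L2_inner f f)" by simp
qed

lemma L2_norm_eq: "L2_norm f = Lsp.nrm f"
proof -
  have "L2_inner f f = of_real (LINT z|circ. (cmod (f z))\<^sup>2)"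
    unfolding L2_inner_def complex_norm_square[symmetric] by (rule integral_complex_of_real)
  then show ?thesis by (simp add: L2_norm_def Lsp.nrm_def)
qed

lemmas L2_zero_mem = Lsp.zero_mem
lemmas L2_diff = Lsp.diff_mem
lemmas L2_minus = Lsp.minus_mem

lemma L2_norm_nonneg [simp]: "0 \<le> L2_norm f"
  by (simp add: L2_norm_def)

lemma L2_norm_square: "(L2_norm f)\<^sup>2 = (LINT z|circ. (cmod (f z))\<^sup>2)"
  by (simp add: L2_norm_def)

lemma L2_norm_triangle: "f \<in> L2 \<Longrightarrow> g \<in> L2 \<Longrightarrow> L2_norm (\<lambda>z. f z + g z) \<le> L2_norm f + L2_norm g"
  unfolding L2_norm_eq by (rule Lsp.nrm_add)

lemma L2_norm_scale: "f \<in> L2 \<Longrightarrow> L2_norm (\<lambda>z. c * f z) = cmod c * L2_norm f"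
  unfolding L2_norm_eq by (rule Lsp.nrm_scale)

lemma L2_norm_diff: "f \<in> L2 \<Longrightarrow> g \<in> L2 \<Longrightarrow> L2_norm (\<lambda>z. f z - g z) \<le> L2_norm f + L2_norm g"
  using L2_norm_triangle[OF _ L2_minus, of f g] L2_norm_scale[of g "-1"] by simp

lemma L2_Cauchy_Schwarz: "f \<in> L2 \<Longrightarrow> g \<in> L2 \<Longrightarrow> cmod (L2_inner f g) \<le> L2_norm f * L2_norm g"
  unfolding L2_norm_eq by (rule Lsp.form_bound)

lemma L2_inner_cnj: "L2_inner g f = cnj (L2_inner f g)"
  unfolding L2_inner_def by (subst Bochner_Integration.integral_cnj[symmetric]) (simp add: mult.commute)

lemma L2_norm_mono:
  assumes "f \<in> borel_measurable circ" "g \<in> L2" "AE z in circ. cmod (f z) \<le> C * cmod (g z)" "0 \<le> C"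
  shows "L2_norm f \<le> C * L2_norm g"
proof -
  have "(L2_norm f)\<^sup>2 \<le> (LINT z|circ. C\<^sup>2 * (cmod (g z))\<^sup>2)"
    unfolding L2_norm_square
  proof (rule integral_mono_AE')
    show "integrable circ (\<lambda>z. C\<^sup>2 * (cmod (g z))\<^sup>2)" using assms by (simp add: L2_square_integrable)
    show "AE z in circ. (cmod (f z))\<^sup>2 \<le> C\<^sup>2 * (cmod (g z))\<^sup>2"
      using assms(3) by eventually_elim (metis norm_ge_zero power_mono power_mult_distrib)
  qed auto
  also have "\<dots> = (C * L2_norm g)\<^sup>2" by (simp add: power_mult_distrib L2_norm_square)
  finally show ?thesis using assms(4) by (meson L2_norm_nonneg mult_nonneg_nonneg power2_le_imp_le)
qed

lemma L2_norm_mult_bounded: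
  assumes "f \<in> L2" "h \<in> borel_measurable circ" "AE z in circ. cmod (h z) \<le> C" "0 \<le> C"
  shows "L2_norm (\<lambda>z. h z * f z) \<le> C * L2_norm f"
proof (rule L2_norm_mono)
  show "AE z in circ. cmod (h z * f z) \<le> C * cmod (f z)"
    using assms(3) by eventually_elim (simp add: norm_mult mult_right_mono)
qed (use assms in \<open>auto simp: L2_measurable borel_measurable_times\<close>)

lemma L2_inner_cong:
  assumes "f \<in> L2" "f' \<in> L2" "g \<in> L2" "g' \<in> L2" "f \<doteq> f'" "g \<doteq> g'"
  shows "L2_inner f g = L2_inner f' g'"
  unfolding L2_inner_def
proof (rule integral_cong_AE)
  show "AE z in circ. f z * cnj (g z) = f' z * cnj (g' z)"
    using assms(5,6) by eventually_elim simp
qed (use assms L2_inner_integrable in auto)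

lemma L2_norm_cong:
  assumes "f \<in> L2" "f' \<in> L2" "f \<doteq> f'"
  shows "L2_norm f = L2_norm f'"
  using L2_inner_cong[of f f' f f'] assms by (simp add: L2_norm_eq Lsp.nrm_def)

lemma L2_cong: "f \<in> L2 \<Longrightarrow> g \<in> borel_measurable circ \<Longrightarrow> f \<doteq> g \<Longrightarrow> g \<in> L2"
  by (rule L2_I_bound[of g "\<lambda>z. (cmod (f z))\<^sup>2"]) (auto simp: L2_square_integrable)

lemma L2_norm_eq_0_iff: "f \<in> L2 \<Longrightarrow> L2_norm f = 0 \<longleftrightarrow> f \<doteq> (\<lambda>z. 0)"
  unfolding L2_norm_def
  by (simp add: integral_nonneg_eq_0_iff_AE L2_square_integrable)

lemma L1_le_L2:
  assumes "f \<in> L2"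
  shows "integrable circ f" "(LINT z|circ. cmod (f z)) \<le> L2_norm f"
proof -
  have 1: "(\<lambda>z. 1) \<in> L2" by (rule L2_bounded[where C = 1]) auto
  show "integrable circ f" using L2_mult_integrable[OF assms 1] by simp
  have abs: "(\<lambda>z. of_real (cmod (f z))) \<in> L2"
    using assms by (auto simp: L2_def)
  have "L2_inner (\<lambda>z. of_real (cmod (f z))) (\<lambda>z. 1) = of_real (LINT z|circ. cmod (f z))"
    by (simp add: L2_inner_def integral_complex_of_real)
  then have "(LINT z|circ. cmod (f z)) \<le> cmod (L2_inner (\<lambda>z. of_real (cmod (f z))) (\<lambda>z. 1))"
    by simp
  also have "\<dots> \<le> L2_norm (\<lambda>z. of_real (cmod (f z))) * L2_norm (\<lambda>z. 1)"
    by (rule L2_Cauchy_Schwarz[OF abs 1])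
  also have "\<dots> = L2_norm f" by (simp add: L2_norm_def)
  finally show "(LINT z|circ. cmod (f z)) \<le> L2_norm f" .
qed

text \<open>The mean moduli of the increments are bounded by a geometric series. By monotone
  convergence the series of moduli is finite almost everywhere, and the increments
  telescope.\<close>

lemma L2_Cauchy_subseq_convergent:
  assumes X: "\<And>n. X n \<in> L2"
    and fast: "\<And>j. L2_norm (\<lambda>z. X (Suc j) z - X j z) \<le> (1/2) ^ j"
  shows "AE z in circ. convergent (\<lambda>j. X j z)"
proof -
  define d where "d j z = X (Suc j) z - X j z" for j z
  have d: "d j \<in> L2" for j unfolding d_def using X by (simp add: L2_diff)
  have int: "(\<integral>\<^sup>+ z. ennreal (cmod (d j z)) \<partial>circ) \<le> ennreal ((1/2) ^ j)" for j
  proof -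
    have "(\<integral>\<^sup>+ z. ennreal (cmod (d j z)) \<partial>circ) = ennreal (LINT z|circ. cmod (d j z))"
      using L1_le_L2(1)[OF d] by (intro nn_integral_eq_integral) auto
    also have "\<dots> \<le> ennreal ((1/2) ^ j)"
      using L1_le_L2(2)[OF d, of j] fast[of j] by (intro ennreal_leI) (simp add: d_def[abs_def])
    finally show ?thesis .
  qed
  have "(\<integral>\<^sup>+ z. (\<Sum>j. ennreal (cmod (d j z))) \<partial>circ) = (\<Sum>j. \<integral>\<^sup>+ z. ennreal (cmod (d j z)) \<partial>circ)"
    using d[THEN L2_measurable] by (intro nn_integral_suminf) auto
  also have "\<dots> \<le> (\<Sum>j. ennreal ((1/2) ^ j))" by (intro suminf_le int) auto
  also have "\<dots> = ennreal (\<Sum>j. (1/2) ^ j)"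
    by (intro suminf_ennreal2) auto
  also have "\<dots> < \<infinity>" by simp
  finally have "AE z in circ. (\<Sum>j. ennreal (cmod (d j z))) \<noteq> \<infinity>"
    using d[THEN L2_measurable] by (intro nn_integral_PInf_AE) auto
  then show ?thesis
  proof eventually_elim
    fix z assume "(\<Sum>j. ennreal (cmod (d j z))) \<noteq> \<infinity>"
    then have "summable (\<lambda>j. cmod (d j z))"
      by (intro summable_suminf_not_top) auto
    then have "summable (\<lambda>j. d j z)" by (rule summable_norm_cancel)
    then have "(\<lambda>n. \<Sum>j<n. d j z) \<longlonglongrightarrow> suminf (\<lambda>j. d j z)" by (rule summable_LIMSEQ)
    moreover have "(\<Sum>j<n. d j z) = X n z - X 0 z" for n
      unfolding d_def by (rule sum_lessThan_telescope)
    ultimately have "(\<lambda>n. (X n z - X 0 z) + X 0 z) \<longlonglongrightarrow> suminf (\<lambda>j. d j z) + X 0 z"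
      by (intro tendsto_add) auto
    then show "convergent (\<lambda>j. X j z)" by (auto simp: convergent_def)
  qed
qed

text \<open>Fatou's lemma for the squared moduli. A bound that holds eventually suffices, so it can
  be applied to the tail of a Cauchy sequence; square integrability of the limit is part of the
  conclusion.\<close>

lemma L2_Fatou:
  assumes Y: "\<And>j. Y j \<in> L2" and f: "f \<in> borel_measurable circ"
    and lim: "AE z in circ. (\<lambda>j. Y j z) \<longlonglongrightarrow> f z"
    and bnd: "eventually (\<lambda>j. L2_norm (Y j) \<le> C) sequentially" and C: "0 \<le> C"
  shows "f \<in> L2" "L2_norm f \<le> C"
proof -
  have [measurable]: "Y j \<in> borel_measurable circ" for j using Y L2_measurable by blast
  have "(\<integral>\<^sup>+ z. ennreal ((cmod (f z))\<^sup>2) \<partial>circ)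
      = (\<integral>\<^sup>+ z. liminf (\<lambda>j. ennreal ((cmod (Y j z))\<^sup>2)) \<partial>circ)"
  proof (rule nn_integral_cong_AE)
    show "AE z in circ. ennreal ((cmod (f z))\<^sup>2) = liminf (\<lambda>j. ennreal ((cmod (Y j z))\<^sup>2))"
      using lim
    proof eventually_elim
      fix z assume "(\<lambda>j. Y j z) \<longlonglongrightarrow> f z"
      then have "(\<lambda>j. ennreal ((cmod (Y j z))\<^sup>2)) \<longlonglongrightarrow> ennreal ((cmod (f z))\<^sup>2)"
        by (intro tendsto_ennrealI tendsto_intros)
      then show "ennreal ((cmod (f z))\<^sup>2) = liminf (\<lambda>j. ennreal ((cmod (Y j z))\<^sup>2))"
        by (intro lim_imp_Liminf[symmetric]) auto
    qed
  qed
  also have "\<dots> \<le> liminf (\<lambda>j. \<integral>\<^sup>+ z. ennreal ((cmod (Y j z))\<^sup>2) \<partial>circ)"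
    by (intro nn_integral_liminf) measurable
  also have "\<dots> \<le> liminf (\<lambda>j. ennreal (C\<^sup>2))"
  proof (rule Liminf_mono)
    show "\<forall>\<^sub>F j in sequentially. (\<integral>\<^sup>+ z. ennreal ((cmod (Y j z))\<^sup>2) \<partial>circ) \<le> ennreal (C\<^sup>2)"
      using bnd
    proof eventually_elim
      fix j assume "L2_norm (Y j) \<le> C"
      then have "(L2_norm (Y j))\<^sup>2 \<le> C\<^sup>2" by (intro power_mono) auto
      moreover have "(\<integral>\<^sup>+ z. ennreal ((cmod (Y j z))\<^sup>2) \<partial>circ) = ennreal ((L2_norm (Y j))\<^sup>2)"
        unfolding L2_norm_square using Y L2_square_integrable by (intro nn_integral_eq_integral) auto
      ultimately show "(\<integral>\<^sup>+ z. ennreal ((cmod (Y j z))\<^sup>2) \<partial>circ) \<le> ennreal (C\<^sup>2)"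
        by (simp add: ennreal_leI)
    qed
  qed
  also have "\<dots> = ennreal (C\<^sup>2)" by (simp add: Liminf_const)
  finally have *: "(\<integral>\<^sup>+ z. ennreal ((cmod (f z))\<^sup>2) \<partial>circ) \<le> ennreal (C\<^sup>2)" .
  then have "integrable circ (\<lambda>z. (cmod (f z))\<^sup>2)"
    using f by (intro integrableI_bounded) (auto simp: le_less_trans[OF _ ennreal_less_top])
  then show "f \<in> L2" using f by (simp add: L2_def)
  then have "ennreal ((L2_norm f)\<^sup>2) \<le> ennreal (C\<^sup>2)"
    using * L2_square_integrable unfolding L2_norm_square
    by (subst nn_integral_eq_integral[symmetric]) auto
  then have "(L2_norm f)\<^sup>2 \<le> C\<^sup>2" by simp
  then show "L2_norm f \<le> C" using C by (rule power2_le_imp_le)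
qed

theorem L2_complete:
  assumes X: "\<And>n. X n \<in> L2"
    and Cauchy: "\<And>e. 0 < e \<Longrightarrow> \<exists>N. \<forall>m\<ge>N. \<forall>n\<ge>N. L2_norm (\<lambda>z. X m z - X n z) < e"
  shows "\<exists>l\<in>L2. (\<lambda>n. L2_norm (\<lambda>z. X n z - l z)) \<longlonglongrightarrow> 0"
proof -
  have "\<exists>N. \<forall>m\<ge>N. \<forall>n\<ge>N. L2_norm (\<lambda>z. X m z - X n z) < (1/2) ^ j" for j :: nat
    by (rule Cauchy) simp
  then obtain N where N: "\<And>j m n. N j \<le> m \<Longrightarrow> N j \<le> n \<Longrightarrow> L2_norm (\<lambda>z. X m z - X n z) < (1/2) ^ j"
    by metis
  \<comment> \<open>The partial sums make s monotone and at least \<open>N j\<close>; the summand j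
    makes the indices unbounded.\<close>
  define s where "s j = (\<Sum>i\<le>j. N i) + j" for j
  have Ns: "N j \<le> s j" for j
    unfolding s_def by (simp add: sum.remove[of "{..j}" j] trans_le_add1)
  have s_mono: "s j \<le> s (Suc j)" for j by (simp add: s_def)
  have s_ge: "j \<le> s j" for j by (simp add: s_def)
  have "AE z in circ. convergent (\<lambda>j. X (s j) z)"
  proof (rule L2_Cauchy_subseq_convergent)
    show "L2_norm (\<lambda>z. X (s (Suc j)) z - X (s j) z) \<le> (1/2) ^ j" for j
      using N[of j "s (Suc j)" "s j"] Ns[of j] s_mono[of j] by simp
  qed (rule X)
  then have lim: "AE z in circ. (\<lambda>j. X (s j) z) \<longlonglongrightarrow> lim (\<lambda>j. X (s j) z)"
    by eventually_elim (simp add: convergent_LIMSEQ_iff)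
  define l where "l z = lim (\<lambda>j. X (s j) z)" for z
  have [measurable]: "X n \<in> borel_measurable circ" for n using X L2_measurable by blast
  have l[measurable]: "l \<in> borel_measurable circ" unfolding l_def by measurable
  \<comment> \<open>The index n stays fixed while the subsequence runs to its pointwise limit, so
    the Cauchy estimate becomes an estimate for the distance to the limit.\<close>
  have close: "(\<lambda>z. X n z - l z) \<in> L2 \<and> L2_norm (\<lambda>z. X n z - l z) \<le> e"
    if "0 < e" and N: "\<And>m n. N \<le> m \<Longrightarrow> N \<le> n \<Longrightarrow> L2_norm (\<lambda>z. X m z - X n z) < e" and n: "N \<le> n" for e N n
  proof -
    have a: "(\<lambda>z. X n z - X (s j) z) \<in> L2" for j using X by (simp add: L2_diff)
    have b: "AE z in circ. (\<lambda>j. X n z - X (s j) z) \<longlonglongrightarrow> X n z - l z"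
      using lim unfolding l_def by eventually_elim (intro tendsto_intros)
    have c: "eventually (\<lambda>j. L2_norm (\<lambda>z. X n z - X (s j) z) \<le> e) sequentially"
      using eventually_ge_at_top[of N]
    proof eventually_elim
      fix j assume "N \<le> j"
      then have "N \<le> s j" using s_ge[of j] by linarith
      then show "L2_norm (\<lambda>z. X n z - X (s j) z) \<le> e" using N[OF n] by (simp add: less_imp_le)
    qed
    show ?thesis using L2_Fatou[OF a _ b c] that by auto
  qed
  obtain N0 where "\<And>m n. N0 \<le> m \<Longrightarrow> N0 \<le> n \<Longrightarrow> L2_norm (\<lambda>z. X m z - X n z) < 1"
    using Cauchy[of 1] by auto
  then have "(\<lambda>z. X N0 z - l z) \<in> L2" using close[of 1 N0 N0] by auto
  then have "(\<lambda>z. X N0 z - (X N0 z - l z)) \<in> L2" using X L2_diff by blast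
  then have "l \<in> L2" by simp
  moreover have "(\<lambda>n. L2_norm (\<lambda>z. X n z - l z)) \<longlonglongrightarrow> 0"
  proof (rule LIMSEQ_I)
    fix r :: real assume r: "0 < r"
    obtain N where N: "\<And>m n. N \<le> m \<Longrightarrow> N \<le> n \<Longrightarrow> L2_norm (\<lambda>z. X m z - X n z) < r / 2"
      using Cauchy[of "r/2"] r by auto
    have "L2_norm (\<lambda>z. X n z - l z) \<le> r / 2" if "N \<le> n" for n
      using close[of "r/2" N n] r N that by auto
    then show "\<exists>no. \<forall>n\<ge>no. norm (L2_norm (\<lambda>z. X n z - l z) - 0) < r"
      using r by (intro exI[of _ N]) fastforce
  qed
  ultimately show ?thesis by blast
qed

text \<open>Subspaces are given by orthogonality conditions, so closedness is automatic.\<close>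

definition orth :: "(complex \<Rightarrow> complex) set \<Rightarrow> (complex \<Rightarrow> complex) set" where
  "orth S = {f \<in> L2. \<forall>g\<in>S. L2_inner f g = 0}"

lemma orthI: "f \<in> L2 \<Longrightarrow> (\<And>g. g \<in> S \<Longrightarrow> L2_inner f g = 0) \<Longrightarrow> f \<in> orth S"
  by (simp add: orth_def)

lemma orthD: "f \<in> orth S \<Longrightarrow> g \<in> S \<Longrightarrow> L2_inner f g = 0"
  by (simp add: orth_def)

lemma orth_L2: "f \<in> orth S \<Longrightarrow> f \<in> L2"
  by (simp add: orth_def)

lemma orth_zero: "S \<subseteq> L2 \<Longrightarrow> (\<lambda>z. 0) \<in> orth S"
  by (simp add: orth_def L2_zero_mem L2_inner_def)

lemma orth_add: "S \<subseteq> L2 \<Longrightarrow> f \<in> orth S \<Longrightarrow> g \<in> orth S \<Longrightarrow> (\<lambda>z. f z + g z) \<in> orth S"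
  by (auto simp: orth_def L2_add_closed Lsp.form_add subset_iff)

lemma orth_diff: "S \<subseteq> L2 \<Longrightarrow> f \<in> orth S \<Longrightarrow> g \<in> orth S \<Longrightarrow> (\<lambda>z. f z - g z) \<in> orth S"
  by (auto simp: orth_def L2_diff Lsp.form_diff subset_iff)

lemma orth_scale: "S \<subseteq> L2 \<Longrightarrow> f \<in> orth S \<Longrightarrow> (\<lambda>z. c * f z) \<in> orth S"
  by (auto simp: orth_def L2_scale Lsp.form_scale subset_iff)

lemma orth_cong:
  assumes "S \<subseteq> L2" "f \<in> orth S" "g \<in> borel_measurable circ" "f \<doteq> g"
  shows "g \<in> orth S"
proof -
  have "g \<in> L2" using assms L2_cong orth_L2 by blast
  moreover have "L2_inner g h = 0" if "h \<in> S" for h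
    using L2_inner_cong[of f g h h] orthD[OF assms(2) that] assms orth_L2 \<open>g \<in> L2\<close> that by auto
  ultimately show ?thesis by (simp add: orth_def)
qed

lemma orth_limit:
  assumes S: "S \<subseteq> L2" and X: "\<And>n. X n \<in> orth S" and l: "l \<in> L2"
    and lim: "(\<lambda>n. L2_norm (\<lambda>z. X n z - l z)) \<longlonglongrightarrow> 0"
  shows "l \<in> orth S"
proof (rule orthI[OF l])
  fix g assume g: "g \<in> S"
  have "cmod (L2_inner l g) \<le> L2_norm (\<lambda>z. X n z - l z) * L2_norm g" for n
  proof -
    have "L2_inner (\<lambda>z. X n z - l z) g = - L2_inner l g"
      using Lsp.form_diff[of "X n" l g] X[of n] g S l by (auto simp: orth_def)
    then show ?thesis
      using L2_Cauchy_Schwarz[of "\<lambda>z. X n z - l z" g] X[of n] g S l by (auto simp: orth_def L2_diff)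
  qed
  moreover have "(\<lambda>n. L2_norm (\<lambda>z. X n z - l z) * L2_norm g) \<longlonglongrightarrow> 0 * L2_norm g"
    by (intro tendsto_intros lim)
  ultimately have "cmod (L2_inner l g) \<le> 0" by (intro LIMSEQ_le_const[of _ 0]) auto
  then show "L2_inner l g = 0" by simp
qed

lemma semi_inner_subspace:
  assumes "V \<subseteq> L2" "(\<lambda>z. 0) \<in> V" "\<And>f g. f \<in> V \<Longrightarrow> g \<in> V \<Longrightarrow> (\<lambda>z. f z + g z) \<in> V"
    "\<And>f c. f \<in> V \<Longrightarrow> (\<lambda>z. c * f z) \<in> V"
  shows "semi_inner V L2_inner"
proof
  show "L2_inner g f = cnj (L2_inner f g)" for f g by (rule L2_inner_cnj)
qed (use assms in \<open>auto simp: Lsp.form_add Lsp.form_scale Lsp.form_nonneg subset_iff\<close>)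

lemma orth_semi_inner: "S \<subseteq> L2 \<Longrightarrow> semi_inner (orth S) L2_inner"
  by (rule semi_inner_subspace) (auto simp: orth_L2 orth_zero orth_add orth_scale)

lemma orth_complete:
  assumes S: "S \<subseteq> L2" and X: "\<And>n. X n \<in> orth S"
    and Cauchy: "\<And>e. 0 < e \<Longrightarrow> \<exists>N. \<forall>m\<ge>N. \<forall>n\<ge>N. L2_norm (\<lambda>z. X m z - X n z) < e"
  shows "\<exists>l\<in>orth S. (\<lambda>n. L2_norm (\<lambda>z. X n z - l z)) \<longlonglongrightarrow> 0"
proof -
  obtain l where l: "l \<in> L2" "(\<lambda>n. L2_norm (\<lambda>z. X n z - l z)) \<longlonglongrightarrow> 0"
    using L2_complete[of X] X[THEN orth_L2] Cauchy by blast
  moreover have "l \<in> orth S" by (rule orth_limit[OF S X l])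
  ultimately show ?thesis by blast
qed

text \<open>The functional \<open>\<lambda>q. L2_inner q f\<close> on the complete space
  \<open>orth S\<close> is represented by an element of that space, and this element is the
  projection.\<close>

theorem projection_exists:
  assumes S: "S \<subseteq> L2" and f: "f \<in> L2"
  shows "\<exists>g\<in>orth S. (\<lambda>z. f z - g z) \<in> orth (orth S)"
proof -
  interpret V: semi_inner "orth S" L2_inner using S by (rule orth_semi_inner)
  have nrm: "V.nrm h = L2_norm h" for h by (simp add: V.nrm_def L2_norm_eq Lsp.nrm_def)
  have "\<exists>p\<in>orth S. \<forall>q\<in>orth S. L2_inner q f = L2_inner q p"
  proof (rule V.riesz_representation)
    show "cmod (L2_inner h f) \<le> L2_norm f * V.nrm h" if "h \<in> orth S" for h
      using L2_Cauchy_Schwarz[OF orth_L2[OF that] f] by (simp add: nrm mult.commute)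
  qed (use f orth_L2 orth_complete[OF S] in \<open>auto simp: nrm Lsp.form_add Lsp.form_scale\<close>)
  then obtain p where p: "p \<in> orth S" "\<And>q. q \<in> orth S \<Longrightarrow> L2_inner q f = L2_inner q p" by blast
  have "(\<lambda>z. f z - p z) \<in> orth (orth S)"
  proof (rule orthI)
    show "(\<lambda>z. f z - p z) \<in> L2" using f p orth_L2 L2_diff by blast
    fix q assume q: "q \<in> orth S"
    have "L2_inner f q = L2_inner p q"
      using p(2)[OF q] L2_inner_cnj[of f q] L2_inner_cnj[of p q] by simp
    then show "L2_inner (\<lambda>z. f z - p z) q = 0"
      using Lsp.form_diff[of f p q] f p(1) q orth_L2 by auto
  qed
  with p show ?thesis by blast
qed

section \<open>Circle means and Wirtinger derivatives\<close>

lemma uniform_measure_interval: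
  "uniform_measure lborel {0..2 * pi} = density lborel (\<lambda>t. ennreal (indicator {0..2 * pi} t / (2 * pi)))"
  unfolding uniform_measure_def
  by (intro arg_cong2[where f = density] refl ext) (auto simp: indicator_def divide_ennreal split: if_splits simp flip: ennreal_1)

text \<open>The passage to an integral over one period, where Leibniz' rule and the fundamental
  theorem of calculus apply.\<close>

lemma circ_integral_continuous:
  fixes f :: "complex \<Rightarrow> 'b :: euclidean_space"
  assumes f: "continuous_on (sphere 0 1) f"
  shows "(LINT z|circ. f z) = (1 / (2 * pi)) *\<^sub>R integral {0..2 * pi} (\<lambda>t. f (cis t))"
proof -
  have cont: "continuous_on UNIV (\<lambda>t. f (cis t))"
    by (intro continuous_on_compose2[OF f] continuous_on_cis continuous_intros) auto
  then have meas: "(\<lambda>t. f (cis t)) \<in> borel_measurable borel"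
    by (rule borel_measurable_continuous_onI)
  have fm: "f \<in> borel_measurable (restrict_space borel (sphere 0 1))"
    using f by (rule borel_measurable_continuous_on_restrict)
  have "(LINT z|circ. f z) = (LINT t|uniform_measure lborel {0..2 * pi}. f (cis t))"
    unfolding circ_def by (rule integral_distr[OF cis_measurable_circle fm])
  also have "\<dots> = (LINT t|lborel. (indicator {0..2 * pi} t / (2 * pi)) *\<^sub>R f (cis t))"
    unfolding uniform_measure_interval using meas by (intro integral_density) auto
  also have "\<dots> = (1 / (2 * pi)) *\<^sub>R (LINT t:{0..2 * pi}|lborel. f (cis t))"
    unfolding set_lebesgue_integral_def by (subst integral_scaleR_right[symmetric]) (auto intro!: Bochner_Integration.integral_cong)
  also have "(LINT t:{0..2 * pi}|lborel. f (cis t)) = integral {0..2 * pi} (\<lambda>t. f (cis t))"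
    using cont by (intro set_borel_integral_eq_integral borel_integrable_atLeastAtMost'
       continuous_on_subset[OF cont]) auto
  finally show ?thesis .
qed

lemma integrable_circ_continuous:
  fixes f :: "complex \<Rightarrow> 'b :: euclidean_space"
  assumes f: "continuous_on (sphere 0 1) f"
  shows "integrable circ f"
proof -
  have "compact (f ` sphere 0 1)" using f by (intro compact_continuous_image) auto
  then obtain B where B: "\<And>z. z \<in> sphere 0 1 \<Longrightarrow> norm (f z) \<le> B"
    using compact_imp_bounded bounded_iff by (metis image_eqI)
  show ?thesis
    using B by (intro integrable_circ_bounded[where C = B] circ_measurable_continuous f AE_I2) auto
qed

lemma L2_continuous: "continuous_on (sphere 0 1) f \<Longrightarrow> f \<in> L2"
  by (auto simp: L2_def intro!: circ_measurable_continuous integrable_circ_continuous continuous_intros)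

lemma circ_integral_continuous_param:
  fixes k :: "real \<Rightarrow> complex \<Rightarrow> 'b :: euclidean_space"
  assumes k: "continuous_on (U \<times> sphere 0 1) (\<lambda>(r, z). k r z)"
  shows "continuous_on U (\<lambda>r. LINT z|circ. k r z)"
proof -
  have kr: "continuous_on (sphere 0 1) (k r)" if "r \<in> U" for r
    using that by (intro continuous_on_compose2[OF k, of _ "\<lambda>z. (r, z)", simplified] continuous_intros) auto
  have "continuous_on (U \<times> {0..2*pi}) (\<lambda>(r, t). k r (cis t))"
    unfolding case_prod_unfold
    by (rule continuous_on_compose2[OF k, of _ "\<lambda>p. (fst p, cis (snd p))", simplified])
       (auto intro!: continuous_intros continuous_on_compose2[OF continuous_on_cis])
  then have "continuous_on U (\<lambda>r. integral (cbox 0 (2*pi)) (\<lambda>t. k r (cis t)))"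
    by (intro integral_continuous_on_param) simp
  then have "continuous_on U (\<lambda>r. (1 / (2 * pi)) *\<^sub>R integral {0..2 * pi} (\<lambda>t. k r (cis t)))"
    by (intro continuous_intros) simp
  then show ?thesis
    by (rule continuous_on_eq) (simp add: circ_integral_continuous kr)
qed

lemma dilate_continuous:
  fixes K :: "complex \<Rightarrow> 'b :: topological_space"
  assumes "continuous_on (ball 0 r0) K"
  shows "continuous_on ({-r0<..<r0} \<times> sphere 0 1) (\<lambda>p. K (of_real (fst p) * snd p))"
  by (rule continuous_on_compose2[OF assms])
     (auto intro!: continuous_intros simp: dist_norm norm_mult)

lemma dilate_continuous_circle:
  fixes K :: "complex \<Rightarrow> 'b :: topological_space"
  assumes "continuous_on (ball 0 r0) K" "\<bar>r\<bar> < r0"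
  shows "continuous_on (sphere 0 1) (\<lambda>z. K (of_real r * z))"
  by (rule continuous_on_compose2[OF assms(1)])
     (use assms in \<open>auto intro!: continuous_intros simp: dist_norm norm_mult\<close>)

text \<open>\<open>a\<close> and \<open>b\<close> are the Wirtinger derivatives with respect to \<open>z\<close> and \<open>cnj z\<close>.\<close>

definition wirt :: "(complex \<Rightarrow> complex) \<Rightarrow> complex \<Rightarrow> complex \<Rightarrow> complex \<Rightarrow> bool" where
  "wirt f a b z \<longleftrightarrow> (f has_derivative (\<lambda>h. a * h + b * cnj h)) (at z)"

lemma wirt_cong: "wirt f a b z \<Longrightarrow> a = a' \<Longrightarrow> b = b' \<Longrightarrow> wirt f a' b' z"
  by simp

lemma wirt_holomorphic:
  assumes "f holomorphic_on S" "open S" "z \<in> S"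
  shows "wirt f (deriv f z) 0 z"
  using holomorphic_derivI[OF assms] by (simp add: wirt_def has_field_derivative_def)

lemma wirt_cnj:
  assumes "wirt f a b z"
  shows "wirt (\<lambda>z. cnj (f z)) (cnj b) (cnj a) z"
  using bounded_linear.has_derivative[OF bounded_linear_cnj assms[unfolded wirt_def]]
  by (simp add: wirt_def add.commute)

lemma wirt_cnj_id: "wirt cnj 0 1 z"
  using wirt_cnj[of "\<lambda>z. z" 1 0 z] by (simp add: wirt_def)

lemma wirt_add:
  assumes "wirt f a b z" "wirt g a' b' z"
  shows "wirt (\<lambda>z. f z + g z) (a + a') (b + b') z"
  using has_derivative_add[OF assms[unfolded wirt_def]]
  by (simp add: wirt_def algebra_simps)

lemma wirt_mult:
  assumes "wirt f a b z" "wirt g a' b' z"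
  shows "wirt (\<lambda>z. f z * g z) (f z * a' + a * g z) (f z * b' + b * g z) z"
  using has_derivative_mult[OF assms[unfolded wirt_def]]
  by (simp add: wirt_def algebra_simps)

lemma wirt_inverse:
  assumes "wirt f a b z" "f z \<noteq> 0"
  shows "wirt (\<lambda>z. inverse (f z)) (- a / (f z)\<^sup>2) (- b / (f z)\<^sup>2) z"
proof -
  have "(\<lambda>h. - (inverse (f z) * (a * h + b * cnj h) * inverse (f z)))
      = (\<lambda>h. - a / (f z)\<^sup>2 * h + - b / (f z)\<^sup>2 * cnj h)"
    using assms(2) by (auto simp: field_simps power2_eq_square)
  then show ?thesis
    using Deriv.has_derivative_inverse[OF assms(2) assms(1)[unfolded wirt_def]] by (simp add: wirt_def)
qed

lemma wirt_continuous_on: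
  assumes "\<And>z. z \<in> S \<Longrightarrow> wirt f (a z) (b z) z"
  shows "continuous_on S f"
  using assms has_derivative_continuous unfolding wirt_def
  by (intro continuous_at_imp_continuous_on) blast

context
  fixes K Kz Kb :: "complex \<Rightarrow> complex" and r0 :: real
  assumes K: "\<And>z. z \<in> ball 0 r0 \<Longrightarrow> wirt K (Kz z) (Kb z) z"
    and Kz: "continuous_on (ball 0 r0) Kz" and Kb: "continuous_on (ball 0 r0) Kb"
begin

text \<open>Leibniz' rule, combined with the chain rule along the rays from the origin.\<close>

lemma circle_mean_deriv_aux:
  assumes "\<bar>r\<bar> < r0"
  shows "((\<lambda>r. LINT z|circ. K (of_real r * z)) has_vector_derivative
           (LINT z|circ. Kz (of_real r * z) * z + Kb (of_real r * z) * cnj z)) (at r)"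
proof -
  have Kc: "continuous_on (ball 0 r0) K" using K by (rule wirt_continuous_on)
  define U where "U = {-r0<..<r0}"
  have r: "r \<in> U" using assms by (auto simp: U_def)
  have ball: "of_real s * cis t \<in> ball 0 r0" if "s \<in> U" for s t
    using that by (auto simp: U_def norm_mult)
  let ?fx = "\<lambda>s t. Kz (of_real s * cis t) * cis t + Kb (of_real s * cis t) * cnj (cis t)"
  have cs: "continuous_on (U \<times> cbox 0 (2*pi)) (\<lambda>p. of_real (fst p) * cis (snd p))"
    by (intro continuous_intros continuous_on_compose2[OF continuous_on_cis]) auto
  have "((\<lambda>s. integral (cbox 0 (2*pi)) (\<lambda>t. K (of_real s * cis t))) has_vector_derivative
      integral (cbox 0 (2*pi)) (?fx r)) (at r within U)"
  proof (rule leibniz_rule_vector_derivative[where U = U])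
    fix s t assume s: "s \<in> U"
    have "((\<lambda>s. K (of_real s * cis t)) has_vector_derivative ?fx s t) (at s)"
    proof -
      have "((\<lambda>s. of_real s * cis t) has_derivative (\<lambda>h. of_real h * cis t)) (at s)"
        by (auto intro!: derivative_eq_intros)
      from diff_chain_at[OF this K[OF ball[OF s], unfolded wirt_def]]
      show ?thesis
        by (simp add: has_vector_derivative_def o_def algebra_simps scaleR_conv_of_real)
    qed
    then show "((\<lambda>s. K (of_real s * cis t)) has_vector_derivative ?fx s t) (at s within U)"
      by (rule has_vector_derivative_at_within)
  next
    fix s assume s: "s \<in> U"
    show "(\<lambda>t. K (of_real s * cis t)) integrable_on cbox 0 (2*pi)"
      by (intro integrable_continuous continuous_on_compose2[OF Kc] continuous_intros
            continuous_on_compose2[OF continuous_on_cis]) (use ball[OF s] in auto)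
  next
    show "continuous_on (U \<times> cbox 0 (2*pi)) (\<lambda>(s, t). ?fx s t)"
      unfolding case_prod_unfold
      by (intro continuous_intros continuous_on_compose2[OF Kz cs] continuous_on_compose2[OF Kb cs]
           continuous_on_compose2[OF continuous_on_cis]) (use ball in auto)
  next
    show "r \<in> U" "convex U" using r by (auto simp: U_def)
  qed
  then have "((\<lambda>s. integral {0..2*pi} (\<lambda>t. K (of_real s * cis t))) has_vector_derivative
      integral {0..2*pi} (?fx r)) (at r)"
    using at_within_open[OF r] by (simp add: U_def)
  from has_vector_derivative_scaleR[OF DERIV_const[of "1 / (2*pi)"] this]
  have D: "((\<lambda>s. (1 / (2*pi)) *\<^sub>R integral {0..2*pi} (\<lambda>t. K (of_real s * cis t))) has_vector_derivative
      (1 / (2*pi)) *\<^sub>R integral {0..2*pi} (?fx r)) (at r)" by simp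
  have eq1: "(LINT z|circ. K (of_real s * z)) = (1 / (2*pi)) *\<^sub>R integral {0..2*pi} (\<lambda>t. K (of_real s * cis t))"
    if "s \<in> U" for s
    using that by (intro circ_integral_continuous dilate_continuous_circle[OF Kc]) (auto simp: U_def)
  have eq2: "(LINT z|circ. Kz (of_real r * z) * z + Kb (of_real r * z) * cnj z)
      = (1 / (2*pi)) *\<^sub>R integral {0..2*pi} (?fx r)"
    using assms by (intro circ_integral_continuous continuous_intros dilate_continuous_circle[OF Kz] dilate_continuous_circle[OF Kb])
  show ?thesis unfolding eq2
    by (rule has_vector_derivative_transform_within_open[OF D _ r]) (auto simp: U_def eq1)
qed

text \<open>The difference of the two sides is the mean of an angular derivative.\<close>

lemma circle_mean_balance:
  assumes r: "\<bar>r\<bar> < r0" "r \<noteq> 0"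
  shows "(LINT z|circ. Kz (of_real r * z) * z) = (LINT z|circ. Kb (of_real r * z) * cnj z)"
proof -
  \<comment> \<open>The derivative of \<open>K (r * cis t)\<close> in t, whose integral over a
    period is zero. Its factor r has to be cancelled, hence the condition on r.\<close>
  let ?g = "\<lambda>t. \<i> * of_real r * (Kz (of_real r * cis t) * cis t - Kb (of_real r * cis t) * cnj (cis t))"
  have ball: "of_real r * cis t \<in> ball 0 r0" for t using r by (simp add: norm_mult)
  have "(?g has_integral (K (of_real r * cis (2*pi)) - K (of_real r * cis 0))) {0..2*pi}"
  proof (rule fundamental_theorem_of_calculus)
    fix t
    have "((\<lambda>t. of_real r * cis t) has_derivative (\<lambda>h. of_real r * (h *\<^sub>R (\<i> * cis t)))) (at t)"
      by (auto intro!: derivative_eq_intros)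
    from diff_chain_at[OF this K[OF ball, unfolded wirt_def]]
    have "((\<lambda>t. K (of_real r * cis t)) has_vector_derivative ?g t) (at t)"
      by (simp add: has_vector_derivative_def o_def algebra_simps scaleR_conv_of_real)
    then show "((\<lambda>t. K (of_real r * cis t)) has_vector_derivative ?g t) (at t within {0..2*pi})"
      by (rule has_vector_derivative_at_within)
  qed simp
  then have 0: "integral {0..2*pi} ?g = 0"
    by (intro integral_unique) (simp del: complex_cnj_mult)
  have cz: "continuous_on (sphere 0 1) (\<lambda>z. Kz (of_real r * z) * z)"
    by (intro continuous_intros dilate_continuous_circle[OF Kz r(1)])
  have cb: "continuous_on (sphere 0 1) (\<lambda>z. Kb (of_real r * z) * cnj z)"
    by (intro continuous_intros dilate_continuous_circle[OF Kb r(1)])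
  have "(LINT z|circ. \<i> * of_real r * (Kz (of_real r * z) * z - Kb (of_real r * z) * cnj z)) = 0"
    using cz cb by (subst circ_integral_continuous) (auto intro!: continuous_intros simp del: integral_mult_right simp: 0)
  then have "(LINT z|circ. Kz (of_real r * z) * z - Kb (of_real r * z) * cnj z) = 0"
    using r by simp
  then show ?thesis
    using cz cb by (simp add: integrable_circ_continuous)
qed

text \<open>The two terms of the radial derivative have equal means, so either one can be doubled.
  Green's formula uses the version for \<open>cnj z\<close> first and the version for z
  afterwards.\<close>

lemma circle_mean_deriv:
  assumes r: "\<bar>r\<bar> < r0" "r \<noteq> 0"
  shows "((\<lambda>r. LINT z|circ. K (of_real r * z)) has_vector_derivative
           2 * (LINT z|circ. Kz (of_real r * z) * z)) (at r)"
    and "((\<lambda>r. LINT z|circ. K (of_real r * z)) has_vector_derivative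
           2 * (LINT z|circ. Kb (of_real r * z) * cnj z)) (at r)"
proof -
  have cz: "integrable circ (\<lambda>z. Kz (of_real r * z) * z)"
    by (intro integrable_circ_continuous continuous_intros dilate_continuous_circle[OF Kz r(1)])
  have cb: "integrable circ (\<lambda>z. Kb (of_real r * z) * cnj z)"
    by (intro integrable_circ_continuous continuous_intros dilate_continuous_circle[OF Kb r(1)])
  show "((\<lambda>r. LINT z|circ. K (of_real r * z)) has_vector_derivative
           2 * (LINT z|circ. Kz (of_real r * z) * z)) (at r)"
    using circle_mean_deriv_aux[OF r(1)] circle_mean_balance[OF r] cz cb by simp
  show "((\<lambda>r. LINT z|circ. K (of_real r * z)) has_vector_derivative
           2 * (LINT z|circ. Kb (of_real r * z) * cnj z)) (at r)"
    using circle_mean_deriv_aux[OF r(1)] circle_mean_balance[OF r] cz cb by simp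
qed

lemma circle_mean_continuous: "continuous_on {-r0<..<r0} (\<lambda>r. LINT z|circ. K (of_real r * z))"
proof (rule continuous_at_imp_continuous_on, rule ballI)
  fix r assume "r \<in> {-r0<..<r0}"
  then have "\<bar>r\<bar> < r0" by auto
  from has_vector_derivative_continuous[OF circle_mean_deriv_aux[OF this]]
  show "isCont (\<lambda>r. LINT z|circ. K (of_real r * z)) r" .
qed

end

text \<open>The derivative with respect to \<open>cnj z\<close> vanishes, so the circle mean does
  not change with the radius.\<close>

lemma circle_mean_holomorphic:
  assumes F: "F holomorphic_on ball 0 r0" and r: "0 \<le> r" "r < r0"
  shows "(LINT z|circ. F (of_real r * z)) = F 0"
proof (cases "r = 0")
  case False
  have w: "\<And>z. z \<in> ball 0 r0 \<Longrightarrow> wirt F (deriv F z) 0 z"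
    using F by (intro wirt_holomorphic) auto
  have dc: "continuous_on (ball 0 r0) (deriv F)"
    using F by (intro holomorphic_on_imp_continuous_on holomorphic_deriv) auto
  have "((\<lambda>s. 0) has_integral ((LINT z|circ. F (of_real r * z)) - (LINT z|circ. F (of_real 0 * z)))) {0..r}"
  proof (rule fundamental_theorem_of_calculus_interior)
    show "continuous_on {0..r} (\<lambda>r. LINT z|circ. F (of_real r * z))"
      by (rule continuous_on_subset[OF circle_mean_continuous[OF w dc]]) (use r in auto)
    fix s assume "s \<in> {0<..<r}"
    then have "\<bar>s\<bar> < r0" "s \<noteq> 0" using r by auto
    from circle_mean_deriv(2)[OF w dc _ this]
    show "((\<lambda>r. LINT z|circ. F (of_real r * z)) has_vector_derivative 0) (at s)" by simp
  qed (use r in auto)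
  from has_integral_unique[OF this has_integral_0] show ?thesis by simp
qed simp

section \<open>Green's formula and the Littlewood-Paley inequality\<close>

lemma continuous_on_xlnx: "continuous_on {0..1} (\<lambda>r::real. r * ln r)"
proof (rule continuous_on_eq_continuous_within[THEN iffD2])
  show "\<forall>x\<in>{0..1}. continuous (at x within {0..1}) (\<lambda>r::real. r * ln r)"
  proof
    fix x :: real assume x: "x \<in> {0..1}"
    show "continuous (at x within {0..1}) (\<lambda>r. r * ln r)"
    proof (cases "x = 0")
      case True
      have bound: "\<bar>r * ln r\<bar> \<le> 2 * sqrt r" if "r \<in> {0..1}" for r :: real
      proof (cases "r = 0")
        case False
        then have r: "0 < r" "r \<le> 1" using that by auto
        \<comment> \<open>The inequality \<open>ln x \<le> x - 1\<close> at
          \<open>1 / sqrt r\<close> loses only a square root, which the factor r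
          compensates.\<close>
        have "ln (1 / sqrt r) \<le> 1 / sqrt r - 1" using r by (intro ln_le_minus_one) simp
        moreover have "ln (1 / sqrt r) = - ln r / 2" using r by (simp add: ln_div ln_sqrt)
        ultimately have "- ln r \<le> 2 / sqrt r" by simp
        then have "r * (- ln r) \<le> r * (2 / sqrt r)" using r by (intro mult_left_mono) auto
        also have "r * (2 / sqrt r) = 2 * sqrt r" using r by (simp add: field_simps)
        finally show ?thesis using r by (simp add: abs_mult mult_nonneg_nonpos abs_of_nonpos)
      qed simp
      have "((\<lambda>r. 2 * sqrt r) \<longlongrightarrow> 2 * sqrt 0) (at 0 within {0..1})"
        by (intro tendsto_intros)
      then have lim: "((\<lambda>r. 2 * sqrt r) \<longlongrightarrow> 0) (at 0 within {0..1})" by simp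
      have "\<forall>\<^sub>F r in at 0 within {0..1}. norm (r * ln r) \<le> 2 * sqrt r"
        unfolding eventually_at_filter real_norm_def using bound by simp
      from Lim_null_comparison[OF this lim]
      have "((\<lambda>r::real. r * ln r) \<longlongrightarrow> 0) (at 0 within {0..1})" .
      then show ?thesis using True by (simp add: continuous_within)
    next
      case False
      then show ?thesis using x by (intro continuous_intros) auto
    qed
  qed
qed

text \<open>The weight \<open>ln (1 / r)\<close> times r from polar coordinates times 4, because the
  Laplacian is four times the mixed Wirtinger derivative.\<close>

definition lp_weight :: "real \<Rightarrow> real" where
  "lp_weight r = - 4 * (r * ln r)"

lemma lp_weight_nonneg: "0 \<le> r \<Longrightarrow> r \<le> 1 \<Longrightarrow> 0 \<le> lp_weight r"
  by (cases "r = 0") (auto simp: lp_weight_def mult_nonneg_nonpos)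

lemma continuous_on_lp_weight [continuous_intros]: "continuous_on {0..1} lp_weight"
  unfolding lp_weight_def by (intro continuous_intros continuous_on_xlnx)

lemma circle_mean_continuous_on:
  fixes k :: "complex \<Rightarrow> 'b :: euclidean_space"
  assumes "continuous_on (ball 0 r0) k"
  shows "continuous_on {-r0<..<r0} (\<lambda>r. LINT z|circ. k (of_real r * z))"
  by (rule circ_integral_continuous_param)
     (use dilate_continuous[OF assms] in \<open>simp add: case_prod_unfold\<close>)

lemma circle_mean_continuous_on_unit:
  fixes k :: "complex \<Rightarrow> 'b :: euclidean_space"
  assumes "continuous_on (ball 0 r0) k" "1 < r0"
  shows "continuous_on {0..1} (\<lambda>r. LINT z|circ. k (of_real r * z))"
  by (rule continuous_on_subset[OF circle_mean_continuous_on[OF assms(1)]]) (use assms in auto)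

text \<open>Two differentiations in the radius: the mean M of G has derivative 2 Q, where Q is the
  mean of \<open>Gb * cnj z\<close>, and \<open>N = r Q\<close> has derivative 2 r P, where P is the
  mean of the mixed derivative. Integrating by parts against the logarithm gives the
  formula.\<close>

theorem Green_log:
  assumes r0: "1 < r0"
    and G: "\<And>z. z \<in> ball 0 r0 \<Longrightarrow> wirt G (Gz z) (Gb z) z"
    and Gb: "\<And>z. z \<in> ball 0 r0 \<Longrightarrow> wirt Gb (Gzb z) (Gbb z) z"
    and cz: "continuous_on (ball 0 r0) Gz"
    and czb: "continuous_on (ball 0 r0) Gzb" and cbb: "continuous_on (ball 0 r0) Gbb"
  shows "((\<lambda>r. of_real (lp_weight r) * (LINT z|circ. Gzb (of_real r * z))) has_integral
           ((LINT z|circ. G z) - G 0)) {0..1}"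
proof -
  have cb: "continuous_on (ball 0 r0) Gb" using Gb by (rule wirt_continuous_on)
  define K where "K z = cnj z * Gb z" for z
  have K: "wirt K (cnj z * Gzb z) (Gb z + cnj z * Gbb z) z" if "z \<in> ball 0 r0" for z
    unfolding K_def by (rule wirt_cong[OF wirt_mult[OF wirt_cnj_id Gb[OF that]]]) auto
  have cKz: "continuous_on (ball 0 r0) (\<lambda>z. cnj z * Gzb z)"
    and cKb: "continuous_on (ball 0 r0) (\<lambda>z. Gb z + cnj z * Gbb z)"
    by (intro continuous_intros cb czb cbb)+
  define M where "M r = (LINT z|circ. G (of_real r * z))" for r
  define N where "N r = (LINT z|circ. K (of_real r * z))" for r
  define Q where "Q r = (LINT z|circ. Gb (of_real r * z) * cnj z)" for r
  define P where "P r = (LINT z|circ. Gzb (of_real r * z))" for r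
  have M': "(M has_vector_derivative 2 * Q r) (at r)" if "\<bar>r\<bar> < r0" "r \<noteq> 0" for r
    unfolding M_def[abs_def] Q_def by (rule circle_mean_deriv(2)[OF G cz cb that])
  have N': "(N has_vector_derivative 2 * of_real r * P r) (at r)" if r: "\<bar>r\<bar> < r0" "r \<noteq> 0" for r
  proof -
    have "(LINT z|circ. (cnj (of_real r * z) * Gzb (of_real r * z)) * z) = (LINT z|circ. of_real r * Gzb (of_real r * z))"
      by (rule Bochner_Integration.integral_cong) (auto simp: complex_norm_square[symmetric] mult_ac)
    then have "2 * (LINT z|circ. (cnj (of_real r * z) * Gzb (of_real r * z)) * z) = 2 * of_real r * P r"
      by (simp add: P_def)
    then show ?thesis
      using circle_mean_deriv(1)[OF K cKz cKb r] by (simp only: N_def[abs_def])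
  qed
  have NQ: "N r = of_real r * Q r" for r
    unfolding N_def Q_def K_def by (simp add: mult_ac flip: integral_mult_right_zero)
  have Qc: "continuous_on {0..1} Q"
  proof -
    have "continuous_on ({-r0<..<r0} \<times> sphere 0 1) (\<lambda>p. Gb (of_real (fst p) * snd p) * cnj (snd p))"
      by (intro continuous_intros dilate_continuous cb)
    then have "continuous_on {-r0<..<r0} Q"
      unfolding Q_def[abs_def] by (intro circ_integral_continuous_param) (simp add: case_prod_unfold)
    then show ?thesis by (rule continuous_on_subset) (use r0 in auto)
  qed
  \<comment> \<open>The logarithmic term is chosen so that Q cancels in the derivative, which leaves
    \<open>- 4 r ln r\<close> times P. At 1 the logarithm vanishes, at 0 the factor N does.\<close>
  define \<Phi> where "\<Phi> r = M r - 2 * (N r * of_real (ln r))" for r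
  have "((\<lambda>r. of_real (lp_weight r) * P r) has_integral (\<Phi> 1 - \<Phi> 0)) {0..1}"
  proof (rule fundamental_theorem_of_calculus_interior)
    have Mc: "continuous_on {0..1} M"
      unfolding M_def[abs_def]
      by (rule continuous_on_subset[OF circle_mean_continuous[OF G cz cb]]) (use r0 in auto)
    \<comment> \<open>The factor r hidden in N is joined to \<open>ln r\<close>, since only the
      product is continuous at 0.\<close>
    have "\<Phi> = (\<lambda>r. M r - 2 * (of_real (r * ln r) * Q r))"
      by (rule ext) (simp add: \<Phi>_def NQ mult_ac)
    moreover have "continuous_on {0..1} (\<lambda>r. M r - 2 * (of_real (r * ln r) * Q r))"
      by (intro continuous_intros Mc Qc continuous_on_of_real continuous_on_xlnx)
    ultimately show "continuous_on {0..1} \<Phi>" by simp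
  next
    fix r :: real assume r: "r \<in> {0<..<1}"
    then have r1: "\<bar>r\<bar> < r0" "r \<noteq> 0" "0 < r" using r0 by auto
    have "((\<lambda>r. of_real (ln r) :: complex) has_vector_derivative of_real (1 / r)) (at r)"
      using r1 by (intro has_vector_derivative_of_real) (auto intro!: derivative_eq_intros simp: has_real_derivative_iff_has_vector_derivative[symmetric])
    from has_vector_derivative_diff[OF M'[OF r1(1,2)]
        has_vector_derivative_mult[OF has_vector_derivative_const[of 2] has_vector_derivative_mult[OF N'[OF r1(1,2)] this]]]
    show "(\<Phi> has_vector_derivative of_real (lp_weight r) * P r) (at r)"
      unfolding \<Phi>_def[abs_def] by (rule has_vector_derivative_eq_rhs) (use r1 in \<open>simp add: NQ lp_weight_def\<close>)
  qed simp
  moreover have "\<Phi> 1 - \<Phi> 0 = (LINT z|circ. G z) - G 0"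
    by (simp add: \<Phi>_def M_def NQ)
  ultimately show ?thesis by (simp add: P_def)
qed

text \<open>Integration over the unit disk against the Littlewood-Paley measure, with density
  \<open>(2 / pi) * ln (1 / |z|)\<close> relative to area.\<close>

definition lp_int :: "(complex \<Rightarrow> real) \<Rightarrow> real" where
  "lp_int g = integral {0..1} (\<lambda>r. lp_weight r * (LINT z|circ. g (of_real r * z)))"

context
  fixes r0 :: real
  assumes r0: "1 < r0"
begin

lemma lp_integrable:
  fixes g :: "complex \<Rightarrow> real"
  shows "continuous_on (ball 0 r0) g \<Longrightarrow>
    (\<lambda>r. lp_weight r * (LINT z|circ. g (of_real r * z))) integrable_on {0..1}"
  by (intro integrable_continuous_interval continuous_intros circle_mean_continuous_on_unit[OF _ r0])

lemma dilate_integrable: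
  fixes g :: "complex \<Rightarrow> 'b :: euclidean_space"
  assumes "continuous_on (ball 0 r0) g" "0 \<le> r" "r \<le> 1"
  shows "integrable circ (\<lambda>z. g (of_real r * z))"
  by (intro integrable_circ_continuous dilate_continuous_circle[OF assms(1)]) (use assms r0 in auto)

lemma lp_int_mono:
  assumes f: "continuous_on (ball 0 r0) f" and g: "continuous_on (ball 0 r0) g"
    and le: "\<And>z. z \<in> ball 0 r0 \<Longrightarrow> f z \<le> g z"
  shows "lp_int f \<le> lp_int g"
  unfolding lp_int_def
proof (rule integral_le[OF lp_integrable[OF f] lp_integrable[OF g]])
  fix r :: real assume r: "r \<in> {0..1}"
  have "(LINT z|circ. f (of_real r * z)) \<le> (LINT z|circ. g (of_real r * z))"
    using r r0 by (intro integral_mono dilate_integrable f g le) (auto simp: dist_norm norm_mult)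
  then show "lp_weight r * (LINT z|circ. f (of_real r * z)) \<le> lp_weight r * (LINT z|circ. g (of_real r * z))"
    using r by (intro mult_left_mono lp_weight_nonneg) auto
qed

lemma lp_int_add:
  assumes f: "continuous_on (ball 0 r0) f" and g: "continuous_on (ball 0 r0) g"
  shows "lp_int (\<lambda>z. f z + g z) = lp_int f + lp_int g"
proof -
  have "lp_int (\<lambda>z. f z + g z) = integral {0..1} (\<lambda>r. lp_weight r * (LINT z|circ. f (of_real r * z)) +
      lp_weight r * (LINT z|circ. g (of_real r * z)))"
    unfolding lp_int_def
    by (rule Henstock_Kurzweil_Integration.integral_cong)
       (simp add: dilate_integrable f g distrib_left)
  then show ?thesis
    by (simp add: lp_int_def Henstock_Kurzweil_Integration.integral_add lp_integrable f g)
qed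

lemma lp_int_cmult: "lp_int (\<lambda>z. c * f z) = c * lp_int f"
  by (simp add: lp_int_def mult.left_commute)

lemma lp_int_bound:
  fixes g :: "complex \<Rightarrow> complex"
  assumes g: "continuous_on (ball 0 r0) g"
  shows "cmod (integral {0..1} (\<lambda>r. of_real (lp_weight r) * (LINT z|circ. g (of_real r * z)))) \<le> lp_int (\<lambda>z. cmod (g z))"
  unfolding lp_int_def
proof (rule Henstock_Kurzweil_Integration.integral_norm_bound_integral)
  show "(\<lambda>r. of_real (lp_weight r) * (LINT z|circ. g (of_real r * z))) integrable_on {0..1}"
    by (intro integrable_continuous_interval continuous_intros circle_mean_continuous_on_unit[OF g r0]
       continuous_on_of_real continuous_on_lp_weight)
  show "(\<lambda>r. lp_weight r * (LINT z|circ. cmod (g (of_real r * z)))) integrable_on {0..1}"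
    by (intro lp_integrable continuous_intros g)
  fix r :: real assume r: "r \<in> {0..1}"
  have "cmod (LINT z|circ. g (of_real r * z)) \<le> (LINT z|circ. cmod (g (of_real r * z)))"
    by (rule integral_norm_bound)
  then show "norm (of_real (lp_weight r) * (LINT z|circ. g (of_real r * z))) \<le>
      lp_weight r * (LINT z|circ. cmod (g (of_real r * z)))"
    using r lp_weight_nonneg[of r] by (auto simp: norm_mult intro!: mult_left_mono)
qed

lemma holo_cont:
  "f holomorphic_on ball 0 r0 \<Longrightarrow> continuous_on (ball 0 r0) f"
  "f holomorphic_on ball 0 r0 \<Longrightarrow> continuous_on (ball 0 r0) (deriv f)"
  by (auto intro!: holomorphic_on_imp_continuous_on holomorphic_deriv)

text \<open>Green's formula for the square of the modulus of \<open>F\<close>.\<close>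

lemma Littlewood_Paley:
  assumes F: "F holomorphic_on ball 0 r0"
  shows "lp_int (\<lambda>z. (cmod (deriv F z))\<^sup>2) \<le> (LINT z|circ. (cmod (F z))\<^sup>2)"
proof -
  have F': "deriv F holomorphic_on ball 0 r0" using F by (auto intro: holomorphic_deriv)
  have c: "continuous_on (ball 0 r0) F" "continuous_on (ball 0 r0) (deriv F)" "continuous_on (ball 0 r0) (deriv (deriv F))"
    using F F' by (auto intro: holo_cont)
  have "((\<lambda>r. of_real (lp_weight r) * (LINT z|circ. of_real ((cmod (deriv F (of_real r * z)))\<^sup>2) :: complex)) has_integral
           ((LINT z|circ. F z * cnj (F z)) - F 0 * cnj (F 0))) {0..1}"
  proof (rule Green_log[OF r0])
    fix z :: complex assume z: "z \<in> ball 0 r0"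
    have w: "wirt F (deriv F z) 0 z" "wirt (deriv F) (deriv (deriv F) z) 0 z"
      using F F' z by (auto intro!: wirt_holomorphic)
    show "wirt (\<lambda>z. F z * cnj (F z)) (deriv F z * cnj (F z)) (F z * cnj (deriv F z)) z"
      by (rule wirt_cong[OF wirt_mult[OF w(1) wirt_cnj[OF w(1)]]]) auto
    show "wirt (\<lambda>z. F z * cnj (deriv F z)) (of_real ((cmod (deriv F z))\<^sup>2)) (F z * cnj (deriv (deriv F) z)) z"
      by (rule wirt_cong[OF wirt_mult[OF w(1) wirt_cnj[OF w(2)]]])
         (auto simp: complex_norm_square simp del: of_real_power)
  qed (intro continuous_intros c continuous_on_of_real)+
  then have "((\<lambda>r. Re (of_real (lp_weight r) * of_real (LINT z|circ. (cmod (deriv F (of_real r * z)))\<^sup>2))) has_integral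
           Re ((LINT z|circ. of_real ((cmod (F z))\<^sup>2)) - of_real ((cmod (F 0))\<^sup>2))) {0..1}"
    unfolding integral_complex_of_real complex_norm_square[symmetric] by (rule has_integral_Re)
  then have "lp_int (\<lambda>z. (cmod (deriv F z))\<^sup>2) = (LINT z|circ. (cmod (F z))\<^sup>2) - (cmod (F 0))\<^sup>2"
    unfolding lp_int_def integral_complex_of_real by (simp add: integral_unique)
  then show ?thesis by simp
qed

text \<open>For this particular Carleson measure the embedding follows from \<open>h' F = (h F)' - h F'\<close>.\<close>

lemma Carleson_embedding:
  assumes h: "h holomorphic_on ball 0 r0" and F: "F holomorphic_on ball 0 r0"
    and M: "\<And>z. z \<in> ball 0 r0 \<Longrightarrow> cmod (h z) \<le> M" "0 \<le> M"
  shows "lp_int (\<lambda>z. (cmod (deriv h z))\<^sup>2 * (cmod (F z))\<^sup>2) \<le> 4 * M\<^sup>2 * (LINT z|circ. (cmod (F z))\<^sup>2)"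
proof -
  note c = holo_cont[OF h] holo_cont[OF F]
  have hF: "(\<lambda>z. h z * F z) holomorphic_on ball 0 r0" using h F by (intro holomorphic_intros)
  have int: "integrable circ (\<lambda>z. (cmod (F z))\<^sup>2)"
    using dilate_integrable[of "\<lambda>z. (cmod (F z))\<^sup>2" 1] by (simp add: c continuous_intros)
  have "lp_int (\<lambda>z. (cmod (deriv h z))\<^sup>2 * (cmod (F z))\<^sup>2)
      \<le> lp_int (\<lambda>z. 2 * (cmod (deriv (\<lambda>z. h z * F z) z))\<^sup>2 + 2 * M\<^sup>2 * (cmod (deriv F z))\<^sup>2)"
  proof (rule lp_int_mono)
    fix z :: complex assume z: "z \<in> ball 0 r0"
    have "deriv (\<lambda>z. h z * F z) z = h z * deriv F z + deriv h z * F z"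
      using h F z by (intro deriv_mult) (auto simp: holomorphic_on_imp_differentiable_at)
    then have e: "deriv h z * F z = deriv (\<lambda>z. h z * F z) z - h z * deriv F z" by simp
    have "(cmod (deriv h z * F z))\<^sup>2 \<le> (cmod (deriv (\<lambda>z. h z * F z) z) + M * cmod (deriv F z))\<^sup>2"
      unfolding e
      by (intro power_mono order_trans[OF norm_triangle_ineq4] add_mono order_refl)
         (auto simp: norm_mult intro!: mult_right_mono M z)
    also have "\<dots> \<le> 2 * (cmod (deriv (\<lambda>z. h z * F z) z))\<^sup>2 + 2 * M\<^sup>2 * (cmod (deriv F z))\<^sup>2"
      using sum_squares_bound[of "cmod (deriv (\<lambda>z. h z * F z) z)" "M * cmod (deriv F z)"]
      by (simp add: power2_sum power_mult_distrib)
    finally show "(cmod (deriv h z))\<^sup>2 * (cmod (F z))\<^sup>2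
      \<le> 2 * (cmod (deriv (\<lambda>z. h z * F z) z))\<^sup>2 + 2 * M\<^sup>2 * (cmod (deriv F z))\<^sup>2"
      by (simp add: norm_mult power_mult_distrib)
  qed (intro continuous_intros c holo_cont hF)+
  also have "\<dots> = 2 * lp_int (\<lambda>z. (cmod (deriv (\<lambda>z. h z * F z) z))\<^sup>2) + 2 * M\<^sup>2 * lp_int (\<lambda>z. (cmod (deriv F z))\<^sup>2)"
    by (subst lp_int_add) (intro continuous_intros c holo_cont hF | simp add: lp_int_cmult)+
  also have "\<dots> \<le> 2 * (LINT z|circ. (cmod (h z * F z))\<^sup>2) + 2 * M\<^sup>2 * (LINT z|circ. (cmod (F z))\<^sup>2)"
    by (intro add_mono mult_left_mono Littlewood_Paley hF F) auto
  also have "(LINT z|circ. (cmod (h z * F z))\<^sup>2) \<le> (LINT z|circ. M\<^sup>2 * (cmod (F z))\<^sup>2)"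
  proof (rule integral_mono')
    show "integrable circ (\<lambda>z. M\<^sup>2 * (cmod (F z))\<^sup>2)" using int by simp
    fix z assume "z \<in> space circ"
    then have "cmod (h z) \<le> M" using M r0 by auto
    then show "(cmod (h z * F z))\<^sup>2 \<le> M\<^sup>2 * (cmod (F z))\<^sup>2"
      by (auto simp: norm_mult power_mult_distrib intro!: mult_right_mono power_mono)
  qed auto
  finally show ?thesis by simp
qed

end

section \<open>Wolff's estimate for a pair bounded away from common zeros\<close>

lemma two_mult_le_weighted:
  fixes a b t :: real
  assumes "0 < t"
  shows "2 * (a * b) \<le> t * a\<^sup>2 + b\<^sup>2 / t"
proof -
  have "0 \<le> (t * a - b)\<^sup>2 / t" using assms by simp
  also have "(t * a - b)\<^sup>2 / t = t * a\<^sup>2 - 2 * (a * b) + b\<^sup>2 / t"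
    using assms by (simp add: power2_eq_square field_simps)
  finally show ?thesis by simp
qed

context
  fixes r0 \<epsilon> M :: real and h1 h2 :: "complex \<Rightarrow> complex"
  assumes r0: "1 < r0" and \<epsilon>: "0 < \<epsilon>" and M0: "0 \<le> M"
    and h1: "h1 holomorphic_on ball 0 r0" and h2: "h2 holomorphic_on ball 0 r0"
    and M1: "\<And>z. z \<in> ball 0 r0 \<Longrightarrow> cmod (h1 z) \<le> M"
    and M2: "\<And>z. z \<in> ball 0 r0 \<Longrightarrow> cmod (h2 z) \<le> M"
    and low: "\<And>z. z \<in> ball 0 r0 \<Longrightarrow> \<epsilon> \<le> (cmod (h1 z))\<^sup>2 + (cmod (h2 z))\<^sup>2"
begin

text \<open>A majorant of \<open>|F'|^2 + (|h1'| + |h2'|)^2 |F|^2\<close>, the quantity left when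
  the mixed derivative in Green's formula is split by the inequality of arithmetic and geometric
  means. The factors 2 come from squaring a sum of two terms.\<close>

definition corona_energy :: "(complex \<Rightarrow> complex) \<Rightarrow> complex \<Rightarrow> real" where
  "corona_energy F z = (cmod (deriv F z))\<^sup>2 + 2 * ((cmod (deriv h1 z))\<^sup>2 * (cmod (F z))\<^sup>2)
     + 2 * ((cmod (deriv h2 z))\<^sup>2 * (cmod (F z))\<^sup>2)"

lemma continuous_corona_energy:
  assumes F: "F holomorphic_on ball 0 r0"
  shows "continuous_on (ball 0 r0) (corona_energy F)"
  unfolding corona_energy_def
  by (intro continuous_intros holo_cont[OF r0 F] holo_cont[OF r0 h1] holo_cont[OF r0 h2])

text \<open>The Littlewood-Paley inequality contributes 1, and the Carleson embedding contributes
  \<open>2 * 4 * M^2\<close> for each of \<open>h1\<close> and \<open>h2\<close>.\<close>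

lemma lp_int_corona_energy:
  assumes F: "F holomorphic_on ball 0 r0"
  shows "lp_int (corona_energy F) \<le> (1 + 16 * M\<^sup>2) * (LINT z|circ. (cmod (F z))\<^sup>2)"
proof -
  note c = holo_cont[OF r0 F] holo_cont[OF r0 h1] holo_cont[OF r0 h2]
  have "lp_int (corona_energy F) = lp_int (\<lambda>z. (cmod (deriv F z))\<^sup>2)
     + 2 * lp_int (\<lambda>z. (cmod (deriv h1 z))\<^sup>2 * (cmod (F z))\<^sup>2)
     + 2 * lp_int (\<lambda>z. (cmod (deriv h2 z))\<^sup>2 * (cmod (F z))\<^sup>2)"
    unfolding corona_energy_def
    by (simp add: lp_int_add[OF r0] lp_int_cmult[OF r0] c continuous_intros)
  also have "\<dots> \<le> (LINT z|circ. (cmod (F z))\<^sup>2) + 2 * (4 * M\<^sup>2 * (LINT z|circ. (cmod (F z))\<^sup>2))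
      + 2 * (4 * M\<^sup>2 * (LINT z|circ. (cmod (F z))\<^sup>2))"
    by (intro add_mono mult_left_mono Littlewood_Paley[OF r0 F] Carleson_embedding[OF r0 h1 F M1 M0]
        Carleson_embedding[OF r0 h2 F M2 M0]) auto
  finally show ?thesis by (simp add: algebra_simps)
qed

text \<open>Green's formula replaces the mean by an integral of the mixed derivative; the value at
  the origin is zero because \<open>k1\<close> and \<open>k2\<close> vanish there. Each term of the
  mixed derivative contains two first derivatives, so it can be divided between the energies of R
  and of \<kappa>. The weight t is kept free so that the part with R can later be absorbed.\<close>

lemma corona_estimate:
  assumes R: "R holomorphic_on ball 0 r0"
    and k1: "k1 holomorphic_on ball 0 r0" "k1 0 = 0" and k2: "k2 holomorphic_on ball 0 r0" "k2 0 = 0"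
    and t: "0 < t"
  shows "cmod (LINT z|circ. (cnj (h1 z) * k1 z + cnj (h2 z) * k2 z) * R z
               * inverse (h1 z * cnj (h1 z) + h2 z * cnj (h2 z)))
    \<le> (M / \<epsilon>\<^sup>2 + 2 * M\<^sup>2 / \<epsilon> ^ 3) * (1 + 16 * M\<^sup>2)
       * (t * (LINT z|circ. (cmod (R z))\<^sup>2) + (LINT z|circ. (cmod (h1 z * k2 z - h2 z * k1 z))\<^sup>2) / t)"
proof -
  define \<kappa> where "\<kappa> z = h1 z * k2 z - h2 z * k1 z" for z
  define J where "J z = h1 z * deriv h2 z - h2 z * deriv h1 z" for z
  define D where "D z = h1 z * cnj (h1 z) + h2 z * cnj (h2 z)" for z
  define E where "E z = inverse (D z)" for z
  define Dz where "Dz z = deriv h1 z * cnj (h1 z) + deriv h2 z * cnj (h2 z)" for z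
  define Db where "Db z = h1 z * cnj (deriv h1 z) + h2 z * cnj (deriv h2 z)" for z
  define A where "A z = cnj (h1 z) * k1 z + cnj (h2 z) * k2 z" for z
  define Az where "Az z = cnj (h1 z) * deriv k1 z + cnj (h2 z) * deriv k2 z" for z
  define Ab where "Ab z = cnj (deriv h1 z) * k1 z + cnj (deriv h2 z) * k2 z" for z
  define G where "G z = A z * R z * E z" for z
  \<comment> \<open>With \<open>a1 = cnj h1 / D\<close> and \<open>a2 = cnj h2 / D\<close> the derivatives with respect to \<open>cnj z\<close> are
    \<open>- h2 cnj J / D\<^sup>2\<close> and \<open>h1 cnj J / D\<^sup>2\<close>; hence the factor \<open>\<kappa>\<close> in \<open>Gb\<close>.\<close>
  define Gz where "Gz z = (A z * R z) * (- Dz z / (D z)\<^sup>2) + (A z * deriv R z + Az z * R z) * E z" for z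
  define Gb where "Gb z = (R z * \<kappa> z) * (cnj (J z) * (E z * E z))" for z
  define Gzb where "Gzb z = (R z * \<kappa> z) * (cnj (J z) * (2 * E z * (- Dz z / (D z)\<^sup>2)))
      + (R z * deriv \<kappa> z + deriv R z * \<kappa> z) * (cnj (J z) * (E z * E z))" for z
  define Gbb where "Gbb z = (R z * \<kappa> z) * (cnj (J z) * (2 * E z * (- Db z / (D z)\<^sup>2))
      + cnj (deriv J z) * (E z * E z))" for z
  have h1': "deriv h1 holomorphic_on ball 0 r0" and h2': "deriv h2 holomorphic_on ball 0 r0"
    using h1 h2 by (auto intro: holomorphic_deriv)
  have \<kappa>: "\<kappa> holomorphic_on ball 0 r0"
    unfolding \<kappa>_def[abs_def] by (intro holomorphic_intros h1 h2 k1 k2)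
  have J: "J holomorphic_on ball 0 r0"
    unfolding J_def[abs_def] by (intro holomorphic_intros h1 h2 h1' h2')
  have Dre: "D z = of_real ((cmod (h1 z))\<^sup>2 + (cmod (h2 z))\<^sup>2)" for z
    by (simp only: D_def complex_norm_square of_real_add)
  have Dnorm: "\<epsilon> \<le> cmod (D z)" if "z \<in> ball 0 r0" for z
    unfolding Dre norm_of_real using low[OF that] by linarith
  have Dnz: "D z \<noteq> 0" if "z \<in> ball 0 r0" for z
    using Dnorm[OF that] \<epsilon> by auto
  note hol = R \<kappa> J h1 h2 k1(1) k2(1)
  have w: "wirt f (deriv f z) 0 z" if "f holomorphic_on ball 0 r0" "z \<in> ball 0 r0" for f z
    using that by (intro wirt_holomorphic) auto
  note wc = wirt_cnj[OF w]
  have wD: "wirt D (Dz z) (Db z) z" if z: "z \<in> ball 0 r0" for z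
    unfolding D_def[abs_def]
    by (rule wirt_cong[OF wirt_add[OF wirt_mult[OF w[OF h1 z] wc[OF h1 z]] wirt_mult[OF w[OF h2 z] wc[OF h2 z]]]])
       (simp_all add: Dz_def Db_def)
  have wE: "wirt E (- Dz z / (D z)\<^sup>2) (- Db z / (D z)\<^sup>2) z" if z: "z \<in> ball 0 r0" for z
    unfolding E_def[abs_def] by (rule wirt_inverse[OF wD[OF z] Dnz[OF z]])
  have wA: "wirt A (Az z) (Ab z) z" if z: "z \<in> ball 0 r0" for z
    unfolding A_def[abs_def]
    by (rule wirt_cong[OF wirt_add[OF wirt_mult[OF wc[OF h1 z] w[OF k1(1) z]] wirt_mult[OF wc[OF h2 z] w[OF k2(1) z]]]])
       (simp_all add: Az_def Ab_def)
  have wG: "wirt G (Gz z) (Gb z) z" if z: "z \<in> ball 0 r0" for z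
  proof -
    have "(A z * R z) * (- Db z / (D z)\<^sup>2) + Ab z * R z * E z = R z * (Ab z * D z - A z * Db z) / (D z)\<^sup>2"
    proof -
      have "x * (- d / y\<^sup>2) + u * inverse y = (u * y - x * d) / y\<^sup>2" if "y \<noteq> 0" for x d u y :: complex
        using that by (simp add: field_simps power2_eq_square)
      from this[OF Dnz[OF z], of "A z * R z" "Db z" "Ab z * R z"] show ?thesis
        unfolding E_def by (simp only: right_diff_distrib mult_ac)
    qed
    \<comment> \<open>The Cauchy-Binet identity: a difference of products of bilinear pairings is a
      product of two determinants.\<close>
    also have "Ab z * D z - A z * Db z = \<kappa> z * cnj (J z)"
      by (simp add: A_def Ab_def D_def Db_def \<kappa>_def J_def algebra_simps)
    also have "R z * (\<kappa> z * cnj (J z)) / (D z)\<^sup>2 = Gb z"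
      unfolding Gb_def E_def by (simp only: divide_inverse power2_eq_square inverse_mult_distrib mult_ac)
    finally show ?thesis
      unfolding G_def[abs_def]
      by (intro wirt_cong[OF wirt_mult[OF wirt_mult[OF wA[OF z] w[OF R z]] wE[OF z]]])
         (simp_all add: Gz_def)
  qed
  have wGb: "wirt Gb (Gzb z) (Gbb z) z" if z: "z \<in> ball 0 r0" for z
    unfolding Gb_def[abs_def]
    by (rule wirt_cong[OF wirt_mult[OF wirt_mult[OF w[OF R z] w[OF \<kappa> z]]
          wirt_mult[OF wc[OF J z] wirt_mult[OF wE[OF z] wE[OF z]]]]])
       (simp_all add: Gzb_def Gbb_def algebra_simps)
  note cont = holo_cont[OF r0 R] holo_cont[OF r0 \<kappa>] holo_cont[OF r0 J] holo_cont[OF r0 h1] holo_cont[OF r0 h2]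
     holo_cont[OF r0 k1(1)] holo_cont[OF r0 k2(1)]
  have cD: "continuous_on (ball 0 r0) D" using wD by (rule wirt_continuous_on)
  have cE: "continuous_on (ball 0 r0) E" using wE by (rule wirt_continuous_on)
  have cDz: "continuous_on (ball 0 r0) (\<lambda>z. - Dz z / (D z)\<^sup>2)"
    and cDb: "continuous_on (ball 0 r0) (\<lambda>z. - Db z / (D z)\<^sup>2)"
    unfolding Dz_def Db_def by (intro continuous_intros cont cD; use Dnz in auto)+
  have cA: "continuous_on (ball 0 r0) A" using wA by (rule wirt_continuous_on)
  have cAz: "continuous_on (ball 0 r0) Az" unfolding Az_def by (intro continuous_intros cont)
  have cGz: "continuous_on (ball 0 r0) Gz"
    unfolding Gz_def by (intro continuous_intros cont cA cAz cE cDz)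
  have cGzb: "continuous_on (ball 0 r0) Gzb"
    unfolding Gzb_def by (intro continuous_intros cont cE cDz)
  have cGbb: "continuous_on (ball 0 r0) Gbb"
    unfolding Gbb_def by (intro continuous_intros cont cE cDb)
  have "integral {0..1} (\<lambda>r. of_real (lp_weight r) * (LINT z|circ. Gzb (of_real r * z))) = (LINT z|circ. G z) - G 0"
    by (rule integral_unique[OF Green_log[OF r0 wG wGb cGz cGzb cGbb]])
  moreover have "G 0 = 0" by (simp add: G_def A_def k1 k2)
  ultimately have "cmod (LINT z|circ. G z) \<le> lp_int (\<lambda>z. cmod (Gzb z))"
    using lp_int_bound[OF r0 cGzb] by simp
  also have "\<dots> \<le> lp_int (\<lambda>z. (M / \<epsilon>\<^sup>2 + 2 * M\<^sup>2 / \<epsilon> ^ 3) * (t * corona_energy R z + (1 / t) * corona_energy \<kappa> z))"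
  proof (rule lp_int_mono[OF r0])
    fix z :: complex assume z: "z \<in> ball 0 r0"
    define s where "s = cmod (deriv h1 z) + cmod (deriv h2 z)"
    \<comment> \<open>The factor a belongs to the terms in which one derivative falls on R or
      \<kappa>, the factor b to the term in which both fall on the pair, once through J and once
      through \<open>Dz\<close>.\<close>
    define a where "a = M / \<epsilon>\<^sup>2"
    define b where "b = 2 * M\<^sup>2 / \<epsilon> ^ 3"
    have ab: "0 \<le> a" "0 \<le> b" "0 \<le> s" using M0 \<epsilon> by (auto simp: a_def b_def s_def)
    have Jb: "cmod (J z) \<le> M * s"
    proof -
      have "cmod (J z) \<le> cmod (h1 z) * cmod (deriv h2 z) + cmod (h2 z) * cmod (deriv h1 z)"
        unfolding J_def norm_mult[symmetric] by (rule norm_triangle_ineq4)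
      also have "\<dots> \<le> M * cmod (deriv h2 z) + M * cmod (deriv h1 z)"
        using M1[OF z] M2[OF z] by (intro add_mono mult_right_mono) auto
      finally show ?thesis by (simp add: s_def algebra_simps)
    qed
    have Dzb: "cmod (Dz z) \<le> M * s"
    proof -
      have "cmod (Dz z) \<le> cmod (deriv h1 z) * cmod (h1 z) + cmod (deriv h2 z) * cmod (h2 z)"
        unfolding Dz_def by (rule order_trans[OF norm_triangle_ineq]) (simp add: norm_mult)
      also have "\<dots> \<le> cmod (deriv h1 z) * M + cmod (deriv h2 z) * M"
        using M1[OF z] M2[OF z] by (intro add_mono mult_left_mono) auto
      finally show ?thesis by (simp add: s_def algebra_simps)
    qed
    have Eb: "cmod (E z) \<le> 1 / \<epsilon>"
      using Dnorm[OF z] \<epsilon> unfolding E_def norm_inverse by (simp add: inverse_eq_divide divide_left_mono frac_le)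
    have Eb2: "cmod (E z * E z) \<le> 1 / \<epsilon>\<^sup>2"
      using mult_mono[OF Eb Eb] \<epsilon> by (simp add: norm_mult power2_eq_square)
    have first: "cmod (cnj (J z) * (2 * E z * (- Dz z / (D z)\<^sup>2))) \<le> b * s\<^sup>2"
    proof -
      have "cmod (cnj (J z) * (2 * E z * (- Dz z / (D z)\<^sup>2))) = 2 * cmod (J z) * cmod (Dz z) * (cmod (E z * E z) * cmod (E z))"
        by (simp add: norm_mult norm_divide norm_power E_def norm_inverse power2_eq_square divide_inverse)
      also have "\<dots> \<le> 2 * (M * s) * (M * s) * (1 / \<epsilon>\<^sup>2 * (1 / \<epsilon>))"
        using Jb Dzb Eb Eb2 M0 ab \<epsilon> by (intro mult_mono) auto
      also have "\<dots> = b * s\<^sup>2" by (simp add: b_def power2_eq_square power3_eq_cube)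
      finally show ?thesis .
    qed
    have second: "cmod (cnj (J z) * (E z * E z)) \<le> a * s"
    proof -
      have "cmod (cnj (J z) * (E z * E z)) \<le> (M * s) * (1 / \<epsilon>\<^sup>2)"
        unfolding norm_mult[of "cnj (J z)"] complex_mod_cnj
        using Jb Eb2 M0 ab by (intro mult_mono) auto
      then show ?thesis by (simp add: a_def)
    qed
    have "cmod (Gzb z) \<le> (cmod (R z) * cmod (\<kappa> z)) * (b * s\<^sup>2)
        + (cmod (R z) * cmod (deriv \<kappa> z) + cmod (deriv R z) * cmod (\<kappa> z)) * (a * s)"
      unfolding Gzb_def
      using first second
      by (intro order_trans[OF norm_triangle_ineq] add_mono)
         (simp_all only: norm_mult[of "R z * \<kappa> z"] norm_mult[of "R z * deriv \<kappa> z + deriv R z * \<kappa> z"] norm_mult[of "R z" "\<kappa> z"],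
          auto intro!: mult_mono mult_left_mono order_trans[OF norm_triangle_ineq] simp: norm_mult)
    also have "\<dots> = b * (s\<^sup>2 * (cmod (R z) * cmod (\<kappa> z))) + a * (s * cmod (R z) * cmod (deriv \<kappa> z))
         + a * (cmod (deriv R z) * (s * cmod (\<kappa> z)))"
      by (simp add: algebra_simps)
    also have "\<dots> \<le> (a + b) * (t * corona_energy R z + (1 / t) * corona_energy \<kappa> z)"
    proof -
      have s2: "s\<^sup>2 \<le> 2 * ((cmod (deriv h1 z))\<^sup>2 + (cmod (deriv h2 z))\<^sup>2)"
        using sum_squares_bound[of "cmod (deriv h1 z)" "cmod (deriv h2 z)"]
        by (simp add: s_def power2_sum)
      define e where "e F = (cmod (deriv F z))\<^sup>2 + s\<^sup>2 * (cmod (F z))\<^sup>2" for F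
      have e: "e F \<le> corona_energy F z" for F
        using mult_right_mono[OF s2, of "(cmod (F z))\<^sup>2"]
        by (simp add: e_def corona_energy_def algebra_simps)
      define X where "X = t * e R + (1 / t) * e \<kappa>"
      have t1: "2 * (s\<^sup>2 * (cmod (R z) * cmod (\<kappa> z))) \<le> t * (s\<^sup>2 * (cmod (R z))\<^sup>2) + (1 / t) * (s\<^sup>2 * (cmod (\<kappa> z))\<^sup>2)"
        using two_mult_le_weighted[OF t, of "s * cmod (R z)" "s * cmod (\<kappa> z)"]
        by (simp add: power_mult_distrib power2_eq_square mult_ac)
      have t2: "2 * (s * cmod (R z) * cmod (deriv \<kappa> z)) \<le> t * (s\<^sup>2 * (cmod (R z))\<^sup>2) + (1 / t) * (cmod (deriv \<kappa> z))\<^sup>2"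
        using two_mult_le_weighted[OF t, of "s * cmod (R z)" "cmod (deriv \<kappa> z)"]
        by (simp add: power_mult_distrib)
      have t3: "2 * (cmod (deriv R z) * (s * cmod (\<kappa> z))) \<le> t * (cmod (deriv R z))\<^sup>2 + (1 / t) * (s\<^sup>2 * (cmod (\<kappa> z))\<^sup>2)"
        using two_mult_le_weighted[OF t, of "cmod (deriv R z)" "s * cmod (\<kappa> z)"]
        by (simp add: power_mult_distrib)
      have nn: "0 \<le> t * (s\<^sup>2 * (cmod (R z))\<^sup>2)" "0 \<le> (1 / t) * (s\<^sup>2 * (cmod (\<kappa> z))\<^sup>2)"
        "0 \<le> t * (cmod (deriv R z))\<^sup>2" "0 \<le> (1 / t) * (cmod (deriv \<kappa> z))\<^sup>2"
        using t by auto
      have X: "X = t * (s\<^sup>2 * (cmod (R z))\<^sup>2) + (1 / t) * (s\<^sup>2 * (cmod (\<kappa> z))\<^sup>2)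
          + t * (cmod (deriv R z))\<^sup>2 + (1 / t) * (cmod (deriv \<kappa> z))\<^sup>2"
        by (simp add: X_def e_def algebra_simps add_divide_distrib)
      have "s\<^sup>2 * (cmod (R z) * cmod (\<kappa> z)) \<le> X"
        using t1 nn X by linarith
      moreover have "s * cmod (R z) * cmod (deriv \<kappa> z) + cmod (deriv R z) * (s * cmod (\<kappa> z)) \<le> X"
        using t2 t3 nn X by linarith
      ultimately have "b * (s\<^sup>2 * (cmod (R z) * cmod (\<kappa> z)))
          + a * (s * cmod (R z) * cmod (deriv \<kappa> z) + cmod (deriv R z) * (s * cmod (\<kappa> z))) \<le> b * X + a * X"
        using ab by (intro add_mono mult_left_mono)
      also have "b * X + a * X = (a + b) * X" by (simp add: algebra_simps)
      also have "\<dots> \<le> (a + b) * (t * corona_energy R z + (1 / t) * corona_energy \<kappa> z)"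
        unfolding X_def using ab t e by (intro mult_left_mono add_mono) auto
      finally show ?thesis by (simp add: algebra_simps)
    qed
    finally show "cmod (Gzb z) \<le> (M / \<epsilon>\<^sup>2 + 2 * M\<^sup>2 / \<epsilon> ^ 3) * (t * corona_energy R z + (1 / t) * corona_energy \<kappa> z)"
      by (simp add: a_def b_def)
  qed (intro continuous_intros cGzb continuous_corona_energy R \<kappa>)+
  also have "\<dots> = (M / \<epsilon>\<^sup>2 + 2 * M\<^sup>2 / \<epsilon> ^ 3) * (t * lp_int (corona_energy R) + (1 / t) * lp_int (corona_energy \<kappa>))"
  proof -
    have "lp_int (\<lambda>z. t * corona_energy R z + (1 / t) * corona_energy \<kappa> z)
        = lp_int (\<lambda>z. t * corona_energy R z) + lp_int (\<lambda>z. (1 / t) * corona_energy \<kappa> z)"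
      by (intro lp_int_add[OF r0] continuous_intros continuous_corona_energy R \<kappa>)
    then show ?thesis by (simp only: lp_int_cmult[OF r0])
  qed
  also have "\<dots> \<le> (M / \<epsilon>\<^sup>2 + 2 * M\<^sup>2 / \<epsilon> ^ 3) * (t * ((1 + 16 * M\<^sup>2) * (LINT z|circ. (cmod (R z))\<^sup>2))
      + (1 / t) * ((1 + 16 * M\<^sup>2) * (LINT z|circ. (cmod (\<kappa> z))\<^sup>2)))"
    using t M0 \<epsilon> by (intro mult_left_mono add_mono lp_int_corona_energy R \<kappa>) auto
  also have "x * (t * (y * u) + (1 / t) * (y * v)) = x * y * (t * u + v / t)" for x y u v
    by (simp add: algebra_simps)
  finally show ?thesis
    by (simp only: G_def A_def E_def D_def \<kappa>_def)
qed

end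

section \<open>Hardy space and complement by Fourier coefficients\<close>

lemma integrable_circ_indicator:
  fixes f :: "complex \<Rightarrow> complex"
  assumes f: "integrable circ f" and A: "A \<in> sets borel"
  shows "integrable circ (\<lambda>z. indicator A z *\<^sub>R f z)"
proof (rule Bochner_Integration.integrable_bound[OF f])
  have "(indicator A :: complex \<Rightarrow> real) \<in> borel_measurable circ"
    using A by (intro circ_measurable_borel borel_measurable_indicator) simp
  then show "(\<lambda>z. indicator A z *\<^sub>R f z) \<in> borel_measurable circ"
    by (rule borel_measurable_scaleR) (use f in auto)
qed (simp add: indicator_def)

text \<open>Integrate over the set where the real part is positive. Measurable sets of the circle
  are traces of Borel sets of the plane, which supplies the set A.\<close>

lemma AE_Re_nonpos_if_integrals_zero:
  fixes f :: "complex \<Rightarrow> complex"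
  assumes f: "integrable circ f"
    and zero: "\<And>A. A \<in> sets borel \<Longrightarrow> (LINT z|circ. indicator A z *\<^sub>R f z) = 0"
  shows "AE z in circ. Re (f z) \<le> 0"
proof -
  have [measurable]: "f \<in> borel_measurable circ" using f by auto
  have "{z \<in> space circ. 0 < Re (f z)} \<in> sets circ" by measurable
  then obtain A where A: "A \<in> sets borel" and eq: "{z \<in> space circ. 0 < Re (f z)} = A \<inter> sphere 0 1"
    unfolding sets_circ by (auto simp: sets_restrict_space)
  have int: "integrable circ (\<lambda>z. indicator A z *\<^sub>R f z)"
    by (rule integrable_circ_indicator[OF f A])
  have iff: "z \<in> A \<longleftrightarrow> 0 < Re (f z)" if "z \<in> space circ" for z
  proof -
    have "z \<in> {z \<in> space circ. 0 < Re (f z)} \<longleftrightarrow> z \<in> A \<inter> sphere 0 1" by (simp only: eq)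
    then show ?thesis using that by simp
  qed
  have "(LINT z|circ. Re (indicator A z *\<^sub>R f z)) = 0"
    using zero[OF A] integral_Re[OF int] by simp
  moreover have "AE z in circ. 0 \<le> Re (indicator A z *\<^sub>R f z)"
    using iff by (intro AE_I2) (auto simp: indicator_def)
  ultimately have "AE z in circ. Re (indicator A z *\<^sub>R f z) = 0"
    using integral_nonneg_eq_0_iff_AE[OF integrable_Re[OF int]] by simp
  then show ?thesis
    using AE_space by eventually_elim (use iff in \<open>force simp: indicator_def\<close>)
qed

lemma AE_zero_if_integrals_zero:
  fixes f :: "complex \<Rightarrow> complex"
  assumes f: "integrable circ f"
    and zero: "\<And>A. A \<in> sets borel \<Longrightarrow> (LINT z|circ. indicator A z *\<^sub>R f z) = 0"
  shows "f \<doteq> (\<lambda>z. 0)"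
proof -
  have le: "AE z in circ. Re (c * f z) \<le> 0" for c
  proof (rule AE_Re_nonpos_if_integrals_zero)
    show "(LINT z|circ. indicator A z *\<^sub>R (c * f z)) = 0" if "A \<in> sets borel" for A
      using zero[OF that] by (simp flip: mult_scaleR_right)
  qed (use f in simp)
  show ?thesis
    using le[of 1] le[of "-1"] le[of \<i>] le[of "-\<i>"]
    by eventually_elim (simp add: complex_eq_iff)
qed

text \<open>Closed sets form an intersection-stable generator of the Borel sets. Their indicators
  are limits of continuous functions, and the sets over which the integral vanishes are closed under
  complements and countable disjoint unions.\<close>

lemma AE_zero_if_continuous_integrals_zero:
  fixes f :: "complex \<Rightarrow> complex"
  assumes f: "integrable circ f"
    and zero: "\<And>g :: complex \<Rightarrow> real. continuous_on UNIV g \<Longrightarrow> (LINT z|circ. g z *\<^sub>R f z) = 0"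
  shows "f \<doteq> (\<lambda>z. 0)"
proof (rule AE_zero_if_integrals_zero[OF f])
  have [measurable]: "f \<in> borel_measurable circ" using f by auto
  fix A :: "complex set" assume A: "A \<in> sets borel"
  note int = integrable_circ_indicator[OF f]
  have bs: "sigma_sets UNIV (Collect closed) = sets (borel :: complex measure)"
    unfolding borel_eq_closed by simp
  have As: "A \<in> sigma_sets UNIV (Collect closed)" using A bs by simp
  have st: "Int_stable (Collect closed :: complex set set)" "Collect closed \<subseteq> Pow (UNIV :: complex set)"
    by (auto simp: Int_stable_def)
  from st As show "(LINT z|circ. indicator A z *\<^sub>R f z) = 0"
  proof (induction rule: sigma_sets_induct_disjoint)
    case (basic C)
    then have C: "closed C" by simp
    show ?case
    proof (cases "C = {}")
      case False
      \<comment> \<open>Continuous functions that decrease to the indicator of C. The empty set is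
        treated apart because \<open>infdist\<close> to it is 0.\<close>
      define g where "g n z = max 0 (1 - real n * infdist z C)" for n and z :: complex
      have "(\<lambda>n. LINT z|circ. g n z *\<^sub>R f z) \<longlonglongrightarrow> (LINT z|circ. indicator C z *\<^sub>R f z)"
      proof (rule integral_dominated_convergence[where w = "\<lambda>z. norm (f z)"])
        show "AE z in circ. (\<lambda>n. g n z *\<^sub>R f z) \<longlonglongrightarrow> indicator C z *\<^sub>R f z"
        proof (rule AE_I2)
          fix z :: complex
          have "(\<lambda>n. g n z) \<longlonglongrightarrow> indicator C z"
          proof (cases "z \<in> C")
            case True then show ?thesis by (simp add: g_def)
          next
            case out: False
            then have d: "0 < infdist z C"
              using C False infdist_nonneg[of z C] in_closed_iff_infdist_zero[OF C False] by (metis less_eq_real_def)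
            obtain N :: nat where N: "1 / infdist z C \<le> real N" using real_arch_simple by blast
            have "g n z = 0" if "N \<le> n" for n
            proof -
              have "1 / infdist z C \<le> real n" using N that by linarith
              then have "1 \<le> real n * infdist z C" using d by (simp add: divide_simps)
              then show ?thesis by (simp add: g_def)
            qed
            then have "eventually (\<lambda>n. g n z = 0) sequentially" by (auto simp: eventually_sequentially)
            then show ?thesis using out by (simp add: tendsto_eventually)
          qed
          then show "(\<lambda>n. g n z *\<^sub>R f z) \<longlonglongrightarrow> indicator C z *\<^sub>R f z" by (intro tendsto_intros)
        qed
        show "AE z in circ. norm (g n z *\<^sub>R f z) \<le> norm (f z)" for n
          by (rule AE_I2) (auto simp: g_def infdist_nonneg intro!: mult_left_le_one_le)
        have "continuous_on UNIV (g n)" for n unfolding g_def[abs_def] by (intro continuous_intros)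
        then have "g n \<in> borel_measurable circ" for n
          by (intro circ_measurable_borel borel_measurable_continuous_onI)
        then show "(\<lambda>z. g n z *\<^sub>R f z) \<in> borel_measurable circ" for n by measurable
        show "(\<lambda>z. indicator C z *\<^sub>R f z) \<in> borel_measurable circ"
          using int[of C] C by auto
      qed (use f in auto)
      moreover have "(LINT z|circ. g n z *\<^sub>R f z) = 0" for n
        unfolding g_def by (intro zero continuous_intros)
      ultimately show ?thesis by (simp add: LIMSEQ_const_iff)
    qed simp
  next
    case empty show ?case by simp
  next
    case (compl B)
    then have B: "B \<in> sets borel" by (simp add: bs)
    have "(LINT z|circ. indicator (UNIV - B) z *\<^sub>R f z) = (LINT z|circ. f z - indicator B z *\<^sub>R f z)"
      by (intro Bochner_Integration.integral_cong) (auto simp: indicator_def)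
    also have "\<dots> = 0" using compl zero[of "\<lambda>z. 1"] f int[OF B] by simp
    finally show ?case .
  next
    case (union B)
    then have B: "B i \<in> sets borel" for i using bs by (auto simp: subset_iff)
    have "(LINT z|circ. indicator (\<Union>i. B i) z *\<^sub>R f z) = (LINT z:(\<Union>i. B i \<inter> sphere 0 1)|circ. f z)"
      unfolding set_lebesgue_integral_def
      by (intro Bochner_Integration.integral_cong) (auto simp: indicator_def)
    also have "\<dots> = (\<Sum>i. (LINT z:(B i \<inter> sphere 0 1)|circ. f z))"
    proof (rule lebesgue_integral_countable_add)
      show "B i \<inter> sphere 0 1 \<in> sets circ" for i
        unfolding sets_circ using B by (auto simp: sets_restrict_space)
      then have "(\<Union>i. B i \<inter> sphere 0 1) \<in> sets circ" by (rule sets.countable_UN[OF image_subsetI])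
      then show "set_integrable circ (\<Union>i. B i \<inter> sphere 0 1) f"
        unfolding set_integrable_def using f by (intro integrable_mult_indicator)
      show "B i \<inter> sphere 0 1 \<inter> (B j \<inter> sphere 0 1) = {}" if "i \<noteq> j" for i j
        using union(1) that by (auto simp: disjoint_family_on_def)
    qed
    also have "\<dots> = (\<Sum>i. 0)"
    proof (rule arg_cong[where f = suminf], rule ext)
      fix i
      have "(LINT z:(B i \<inter> sphere 0 1)|circ. f z) = (LINT z|circ. indicator (B i) z *\<^sub>R f z)"
        unfolding set_lebesgue_integral_def
        by (intro Bochner_Integration.integral_cong) (auto simp: indicator_def)
      then show "(LINT z:(B i \<inter> sphere 0 1)|circ. f z) = 0" using union by simp
    qed
    finally show ?case by simp
  qed
qed

definition pos_chars :: "(complex \<Rightarrow> complex) set" where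
  "pos_chars = range (\<lambda>n z. z ^ n)"

text \<open>The exponents start at 1: the constant function belongs to the other family.\<close>

definition neg_chars :: "(complex \<Rightarrow> complex) set" where
  "neg_chars = range (\<lambda>n z. cnj z ^ Suc n)"

text \<open>\<open>HP\<close> contains \<open>H2\<close>; the equality, which amounts to Fatou's theorem, is not needed.\<close>

definition HP :: "(complex \<Rightarrow> complex) set" where
  "HP = orth neg_chars"

definition HM :: "(complex \<Rightarrow> complex) set" where
  "HM = orth pos_chars"

lemma chars_L2: "pos_chars \<subseteq> L2" "neg_chars \<subseteq> L2"
  unfolding pos_chars_def neg_chars_def by (auto intro!: L2_continuous continuous_intros)

lemma HP_iff: "f \<in> HP \<longleftrightarrow> f \<in> L2 \<and> (\<forall>n. (LINT z|circ. f z * z ^ Suc n) = 0)"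
  by (auto simp: HP_def orth_def neg_chars_def L2_inner_def)

lemma HM_iff: "f \<in> HM \<longleftrightarrow> f \<in> L2 \<and> (\<forall>n. (LINT z|circ. f z * cnj z ^ n) = 0)"
  by (auto simp: HM_def orth_def pos_chars_def L2_inner_def)

lemma HP_L2: "f \<in> HP \<Longrightarrow> f \<in> L2" and HM_L2: "f \<in> HM \<Longrightarrow> f \<in> L2"
  by (auto simp: HP_def HM_def orth_L2)

lemmas HP_closed = orth_zero[OF chars_L2(2), folded HP_def] orth_add[OF chars_L2(2), folded HP_def]
  orth_diff[OF chars_L2(2), folded HP_def] orth_scale[OF chars_L2(2), folded HP_def]
lemmas HM_closed = orth_zero[OF chars_L2(1), folded HM_def] orth_add[OF chars_L2(1), folded HM_def]
  orth_diff[OF chars_L2(1), folded HM_def] orth_scale[OF chars_L2(1), folded HM_def]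
lemmas HP_cong = orth_cong[OF chars_L2(2), folded HP_def]
lemmas HM_cong = orth_cong[OF chars_L2(1), folded HM_def]

definition Fourier_null :: "(complex \<Rightarrow> complex) set" where
  "Fourier_null = {f \<in> L2. \<forall>n. (LINT z|circ. f z * z ^ n) = 0 \<and> (LINT z|circ. f z * cnj z ^ n) = 0}"

text \<open>Multiplication by z or \<open>cnj z\<close> shifts the Fourier coefficients; only at
  exponent 0 does the shift pass from one of the two families to the other.\<close>

lemma Fourier_null_id:
  assumes f: "f \<in> Fourier_null"
  shows "(\<lambda>z. z * f z) \<in> Fourier_null" "(\<lambda>z. cnj z * f z) \<in> Fourier_null"
proof -
  have L: "f \<in> L2" using f by (simp add: Fourier_null_def)
  have 1: "(\<lambda>z. z * f z) \<in> L2" "(\<lambda>z. cnj z * f z) \<in> L2"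
    using L2_mult_bounded[OF L, of "\<lambda>z. z" 1] L2_mult_bounded[OF L, of cnj 1] AE_I2[of circ "\<lambda>z. cmod z \<le> 1"]
      circ_measurable_cnj[of "\<lambda>z. z"] by simp_all
  have e: "z * cnj z = 1" if "z \<in> space circ" for z :: complex
    using that by (simp add: complex_norm_square[symmetric])
  have 2: "(LINT z|circ. z * f z * z ^ n) = 0" "(LINT z|circ. cnj z * f z * cnj z ^ n) = 0" for n
  proof -
    have "(LINT z|circ. f z * z ^ Suc n) = 0" "(LINT z|circ. f z * cnj z ^ Suc n) = 0"
      using f unfolding Fourier_null_def by blast+
    then show "(LINT z|circ. z * f z * z ^ n) = 0" "(LINT z|circ. cnj z * f z * cnj z ^ n) = 0"
      by (simp_all add: mult_ac)
  qed
  have 3: "(LINT z|circ. z * f z * cnj z ^ n) = 0" for n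
  proof (cases n)
    case 0 then show ?thesis using 2(1)[of 0] by simp
  next
    case (Suc m)
    have "(LINT z|circ. z * f z * cnj z ^ n) = (LINT z|circ. f z * cnj z ^ m)"
    proof (rule Bochner_Integration.integral_cong[OF refl])
      fix z :: complex assume "z \<in> space circ"
      then have "z * cnj z = 1" by (rule e)
      then show "z * f z * cnj z ^ n = f z * cnj z ^ m"
        unfolding Suc power_Suc by (metis (no_types, opaque_lifting) mult.assoc mult.commute mult.left_neutral)
    qed
    then show ?thesis using f by (simp add: Fourier_null_def)
  qed
  have 4: "(LINT z|circ. cnj z * f z * z ^ n) = 0" for n
  proof (cases n)
    case 0 then show ?thesis using 2(2)[of 0] by simp
  next
    case (Suc m)
    have "(LINT z|circ. cnj z * f z * z ^ n) = (LINT z|circ. f z * z ^ m)"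
    proof (rule Bochner_Integration.integral_cong[OF refl])
      fix z :: complex assume "z \<in> space circ"
      then have "z * cnj z = 1" by (rule e)
      then show "cnj z * f z * z ^ n = f z * z ^ m"
        unfolding Suc power_Suc by (metis (no_types, opaque_lifting) mult.assoc mult.commute mult.left_neutral)
    qed
    then show ?thesis using f by (simp add: Fourier_null_def)
  qed
  show "(\<lambda>z. z * f z) \<in> Fourier_null" "(\<lambda>z. cnj z * f z) \<in> Fourier_null"
    using 1 2 3 4 by (auto simp: Fourier_null_def)
qed

lemma Fourier_null_add: "f \<in> Fourier_null \<Longrightarrow> g \<in> Fourier_null \<Longrightarrow> (\<lambda>z. f z + g z) \<in> Fourier_null"
  unfolding Fourier_null_def
  by (auto simp: L2_add_closed distrib_right intro!: trans[OF Bochner_Integration.integral_add] L2_mult_integrable L2_continuous continuous_intros)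

lemma Fourier_null_scale: "f \<in> Fourier_null \<Longrightarrow> (\<lambda>z. c * f z) \<in> Fourier_null"
  by (auto simp: Fourier_null_def L2_scale mult.assoc)

text \<open>A real linear form on the plane is a complex combination of z and \<open>cnj z\<close>,
  so the shifts settle the linear case, and the constructors of polynomials preserve the
  property.\<close>

lemma Fourier_null_polynomial:
  assumes "real_polynomial_function p" "f \<in> Fourier_null"
  shows "(\<lambda>z. of_real (p z) * f z) \<in> Fourier_null"
  using assms
proof (induction arbitrary: f rule: real_polynomial_function.induct)
  case (linear g)
  interpret g: bounded_linear g by fact
  have lin: "of_real (g z) = (g 1 / 2 - \<i> * g \<i> / 2) * z + (g 1 / 2 + \<i> * g \<i> / 2) * cnj z" for z
  proof -
    have "g z = g (Re z *\<^sub>R 1 + Im z *\<^sub>R \<i>)"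
      by (rule arg_cong[where f = g]) (simp add: complex_eq_iff)
    also have "\<dots> = Re z * g 1 + Im z * g \<i>" by (simp add: g.add g.scaleR)
    finally show ?thesis by (simp add: complex_eq_iff algebra_simps)
  qed
  have "(\<lambda>z. of_real (g z) * f z)
     = (\<lambda>z. (g 1 / 2 - \<i> * g \<i> / 2) * (z * f z) + (g 1 / 2 + \<i> * g \<i> / 2) * (cnj z * f z))"
  proof (intro ext)
    fix z
    show "of_real (g z) * f z = (g 1 / 2 - \<i> * g \<i> / 2) * (z * f z) + (g 1 / 2 + \<i> * g \<i> / 2) * (cnj z * f z)"
      unfolding lin[of z] by (simp only: distrib_right mult.assoc)
  qed
  then show ?case
    using Fourier_null_id[OF linear(2)] by (simp only: Fourier_null_add Fourier_null_scale)
next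
  case (const c) then show ?case by (intro Fourier_null_scale)
next
  case (add p q)
  show ?case using Fourier_null_add[OF add.IH(1)[OF add.prems] add.IH(2)[OF add.prems]]
    by (simp add: distrib_right)
next
  case (mult p q)
  show ?case using mult.IH(1)[OF mult.IH(2)[OF mult.prems]] by (simp add: mult.assoc)
qed

text \<open>Every real polynomial p has zero integral against f, and by Stone-Weierstrass these
  polynomials approximate any continuous function uniformly on the circle.\<close>

theorem Fourier_uniqueness:
  assumes f: "f \<in> Fourier_null"
  shows "f \<doteq> (\<lambda>z. 0)"
proof (rule AE_zero_if_continuous_integrals_zero)
  have "f \<in> L2" using f by (simp add: Fourier_null_def)
  then show int: "integrable circ f" by (rule L1_le_L2)
  fix g :: "complex \<Rightarrow> real" assume g: "continuous_on UNIV g"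
  have g': "integrable circ (\<lambda>z. g z *\<^sub>R f z)"
  proof -
    have "(\<lambda>z. of_real (g z)) \<in> L2" using continuous_on_subset[OF g] by (intro L2_continuous continuous_intros) auto
    then show ?thesis using L2_mult_integrable[OF _ \<open>f \<in> L2\<close>, of "\<lambda>z. of_real (g z)"] by (simp add: scaleR_conv_of_real)
  qed
  have "norm (LINT z|circ. g z *\<^sub>R f z) \<le> e * (LINT z|circ. norm (f z))" if "0 < e" for e
  proof -
    obtain p where p: "real_polynomial_function p" "\<And>z. z \<in> sphere 0 1 \<Longrightarrow> \<bar>g z - p z\<bar> < e"
      using Stone_Weierstrass_real_polynomial_function[of "sphere 0 1 :: complex set" g e] \<open>0 < e\<close> continuous_on_subset[OF g]
      by auto
    have pf: "(\<lambda>z. of_real (p z) * f z) \<in> Fourier_null" by (rule Fourier_null_polynomial[OF p(1) f])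
    then have p': "integrable circ (\<lambda>z. p z *\<^sub>R f z)"
      using L1_le_L2(1) by (auto simp: Fourier_null_def scaleR_conv_of_real)
    have "(LINT z|circ. of_real (p z) * f z * z ^ 0) = 0" using pf unfolding Fourier_null_def by blast
    then have "(LINT z|circ. g z *\<^sub>R f z) = (LINT z|circ. g z *\<^sub>R f z) - (LINT z|circ. p z *\<^sub>R f z)"
      by (simp add: scaleR_conv_of_real)
    also have "\<dots> = (LINT z|circ. (g z - p z) *\<^sub>R f z)"
      using g' p' by (simp add: scaleR_left_diff_distrib)
    also have "norm \<dots> \<le> (LINT z|circ. e * norm (f z))"
    proof (rule Bochner_Integration.integral_norm_bound_integral)
      show "integrable circ (\<lambda>z. (g z - p z) *\<^sub>R f z)" using g' p' by (simp add: scaleR_left_diff_distrib)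
      fix z assume "z \<in> space circ"
      then show "norm ((g z - p z) *\<^sub>R f z) \<le> e * norm (f z)"
        using p(2)[of z] by (simp add: mult_right_mono)
    qed (use int in auto)
    finally show ?thesis by simp
  qed
  note * = this
  have "norm (LINT z|circ. g z *\<^sub>R f z) \<le> 0"
  proof (rule field_le_epsilon)
    fix d :: real assume d: "0 < d"
    let ?I = "LINT z|circ. norm (f z)"
    have I: "0 \<le> ?I" by simp
    \<comment> \<open>The summand 1 in the denominator keeps the quotient meaningful when f has mean
      modulus 0.\<close>
    have "norm (LINT z|circ. g z *\<^sub>R f z) \<le> d / (?I + 1) * ?I" using d I by (intro *) (auto simp: add_nonneg_pos)
    also have "\<dots> \<le> d"
    proof -
      have "0 < ?I + 1" using I by linarith
      then show ?thesis using d by (simp add: pos_divide_le_eq algebra_simps)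
    qed
    finally show "norm (LINT z|circ. g z *\<^sub>R f z) \<le> 0 + d" by simp
  qed
  then show "(LINT z|circ. g z *\<^sub>R f z) = 0" by simp
qed

section \<open>The orthogonal decomposition into Hardy space and complement\<close>

lemma HP_HM_trivial:
  assumes "f \<in> HP" "f \<in> HM"
  shows "f \<doteq> (\<lambda>z. 0)"
proof (rule Fourier_uniqueness)
  \<comment> \<open>The mean value, at exponent 0, is covered by \<open>HM\<close>; the positive
    exponents are covered by \<open>HP\<close>.\<close>
  have "(LINT z|circ. f z * z ^ n) = 0" for n
    using assms by (cases n) (auto simp: HP_iff HM_iff dest: spec[of _ 0])
  with assms show "f \<in> Fourier_null" by (simp add: Fourier_null_def HM_iff)
qed

lemma char_HP: "(\<lambda>z. z ^ n) \<in> HP"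
proof -
  have "(LINT z|circ. z ^ n * z ^ Suc m) = 0" for m
    using circle_mean_holomorphic[of "\<lambda>z. z ^ n * z ^ Suc m" 2 1] by (simp add: holomorphic_intros)
  then show ?thesis using chars_L2 by (auto simp: HP_iff pos_chars_def)
qed

lemma cnj_char_HM: "(\<lambda>z. cnj z ^ Suc n) \<in> HM"
proof -
  have "(LINT z|circ. cnj z ^ Suc n * cnj z ^ m) = cnj (LINT z|circ. z ^ m * z ^ Suc n)" for m
    by (subst Bochner_Integration.integral_cnj[symmetric]) (simp add: mult_ac)
  moreover have "(LINT z|circ. z ^ m * z ^ Suc n) = 0" for m
    using char_HP[of m] unfolding HP_iff by blast
  ultimately show ?thesis using chars_L2 by (auto simp: HM_iff neg_chars_def)
qed

text \<open>Each space is known only to be orthogonal to characters. Project f to p in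
  \<open>orth HM\<close>. The powers of z lie in \<open>orth HM\<close>, so the remainder lies in
  \<open>HM\<close>; the conjugate powers lie in \<open>HM\<close>, so p and hence the remainder lie
  in \<open>HP\<close>. The remainder is therefore null.\<close>

lemma HP_orth_HM:
  assumes f: "f \<in> HP" and g: "g \<in> HM"
  shows "L2_inner f g = 0"
proof -
  have HM: "HM \<subseteq> L2" using HM_L2 by blast
  obtain p where p: "p \<in> orth HM" and d: "(\<lambda>z. f z - p z) \<in> orth (orth HM)"
    using projection_exists[OF HM HP_L2[OF f]] by blast
  have "(\<lambda>z. z ^ n) \<in> orth HM" for n
  proof (rule orthI[OF HP_L2[OF char_HP]])
    fix g assume "g \<in> HM"
    then have "L2_inner g (\<lambda>z. z ^ n) = 0" by (simp add: HM_iff L2_inner_def)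
    then show "L2_inner (\<lambda>z. z ^ n) g = 0" using L2_inner_cnj[of "\<lambda>z. z ^ n" g] by simp
  qed
  then have "(\<lambda>z. f z - p z) \<in> HM"
    using d by (auto simp: HM_def orth_def pos_chars_def)
  moreover have "p \<in> HP"
    using p cnj_char_HM by (auto simp: HP_def orth_def neg_chars_def)
  then have "(\<lambda>z. f z - p z) \<in> HP" using f by (intro HP_closed)
  ultimately have "(\<lambda>z. f z - p z) \<doteq> (\<lambda>z. 0)" by (intro HP_HM_trivial)
  then have "p \<doteq> f" by eventually_elim simp
  then have "f \<in> orth HM" by (rule orth_cong[OF HM p L2_measurable[OF HP_L2[OF f]]])
  then show ?thesis using g by (rule orthD)
qed

lemma HM_orth_HP: "f \<in> HM \<Longrightarrow> g \<in> HP \<Longrightarrow> L2_inner f g = 0"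
  using HP_orth_HM[of g f] L2_inner_cnj[of f g] by simp

text \<open>The remainder of the projection to \<open>HP\<close> is orthogonal to every power of z,
  since these lie in \<open>HP\<close>. The norm bounds are Pythagoras.\<close>

lemma L2_decompose:
  assumes f: "f \<in> L2"
  obtains p m where "p \<in> HP" "m \<in> HM" "\<And>z. f z = p z + m z" "L2_norm p \<le> L2_norm f" "L2_norm m \<le> L2_norm f"
proof -
  obtain p where p: "p \<in> HP" and d: "(\<lambda>z. f z - p z) \<in> orth HP"
    using projection_exists[OF chars_L2(2) f] unfolding HP_def by blast
  have m: "(\<lambda>z. f z - p z) \<in> HM"
    using d char_HP by (auto simp: HM_def orth_def pos_chars_def)
  have "(L2_norm (\<lambda>z. p z + 1 * (f z - p z)))\<^sup>2 = (L2_norm p)\<^sup>2 + (L2_norm (\<lambda>z. f z - p z))\<^sup>2"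
    using Lsp.nrm_square_add_scale[OF HP_L2[OF p] HM_L2[OF m], of 1] HP_orth_HM[OF p m]
    by (simp add: L2_norm_eq)
  then have "(L2_norm p)\<^sup>2 \<le> (L2_norm f)\<^sup>2" "(L2_norm (\<lambda>z. f z - p z))\<^sup>2 \<le> (L2_norm f)\<^sup>2"
    by simp_all
  then have "L2_norm p \<le> L2_norm f" "L2_norm (\<lambda>z. f z - p z) \<le> L2_norm f"
    by (auto dest: power2_le_imp_le)
  then show ?thesis using that[OF p m] by simp
qed

lemma circ_cnj_cancel: "z \<in> space circ \<Longrightarrow> z * cnj z = 1"
  by (simp add: complex_norm_square[symmetric])

text \<open>A norm-preserving conjugate-linear involution that exchanges \<open>HP\<close> and
  \<open>HM\<close>; the factor \<open>cnj z\<close> is there because constants belong to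
  \<open>HP\<close> alone. It carries results about the disk to the exterior.\<close>

definition flip :: "(complex \<Rightarrow> complex) \<Rightarrow> complex \<Rightarrow> complex" where
  "flip f z = cnj z * cnj (f z)"

lemma flip_L2: "f \<in> L2 \<Longrightarrow> flip f \<in> L2"
  unfolding flip_def[abs_def]
  by (rule L2_mult_bounded[OF L2_cnj, where C = 1]) (use AE_circ_norm in auto)

lemma flip_HP:
  assumes f: "f \<in> HP"
  shows "flip f \<in> HM"
proof -
  have "(LINT z|circ. flip f z * cnj z ^ n) = cnj (LINT z|circ. f z * z ^ Suc n)" for n
    by (subst Bochner_Integration.integral_cnj[symmetric]) (simp add: flip_def mult_ac)
  moreover have "(LINT z|circ. f z * z ^ Suc n) = 0" for n using f unfolding HP_iff by blast
  ultimately show ?thesis using f by (simp add: HM_iff flip_L2 HP_L2)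
qed

lemma flip_HM:
  assumes f: "f \<in> HM"
  shows "flip f \<in> HP"
proof -
  have "(LINT z|circ. flip f z * z ^ Suc n) = (LINT z|circ. cnj (f z * cnj z ^ n))" for n
  proof (rule Bochner_Integration.integral_cong[OF refl])
    fix z assume "z \<in> space circ"
    then have "z * cnj z = 1" by (rule circ_cnj_cancel)
    then show "flip f z * z ^ Suc n = cnj (f z * cnj z ^ n)"
      unfolding flip_def power_Suc by (simp add: mult_ac)
  qed
  then have "(LINT z|circ. flip f z * z ^ Suc n) = cnj (LINT z|circ. f z * cnj z ^ n)" for n
    by (simp only: Bochner_Integration.integral_cnj)
  then show ?thesis using f by (simp add: HM_iff HP_iff flip_L2)
qed

lemma flip_flip: "flip (flip f) \<doteq> f"
  by (rule AE_I2) (simp add: flip_def mult.assoc[symmetric] circ_cnj_cancel[unfolded mult.commute[of _ "cnj _"]])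

lemma L2_norm_flip:
  assumes "f \<in> L2"
  shows "L2_norm (flip f) = L2_norm f"
  unfolding L2_norm_def
  by (intro arg_cong[where f = sqrt] Bochner_Integration.integral_cong) (auto simp: flip_def norm_mult)

section \<open>Bounded analytic functions\<close>

text \<open>A sequence of radii, so that convergence theorems for sequences apply to radial limits.
  The summand 2 keeps \<open>rad 0\<close> positive.\<close>

definition rad :: "nat \<Rightarrow> real" where
  "rad k = 1 - 1 / (real k + 2)"

lemma rad_bounds: "0 < rad k" "rad k < 1"
  by (auto simp: rad_def field_simps)

lemma rad_at_left: "filterlim rad (at_left 1) sequentially"
proof -
  have "(\<lambda>k. 1 / (real k + 2)) \<longlonglongrightarrow> 0"
    by (intro tendsto_divide_0[OF tendsto_const] filterlim_at_top_imp_at_infinity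
        filterlim_tendsto_add_at_top[OF tendsto_const, of _ _ 2, unfolded add.commute[of 2]] filterlim_real_sequentially)
  then have "(\<lambda>k. 1 - 1 / (real k + 2)) \<longlonglongrightarrow> 1 - 0" by (intro tendsto_intros)
  then have "rad \<longlonglongrightarrow> 1" by (simp add: rad_def[abs_def])
  moreover have "rad k \<noteq> 1" for k using rad_bounds(2)[of k] by linarith
  ultimately show ?thesis by (simp add: filterlim_at rad_bounds)
qed

lemma rad_ball: "z \<in> space circ \<Longrightarrow> of_real (rad k) * z \<in> ball 0 1"
  using rad_bounds[of k] by (simp add: norm_mult)

lemma bdry_int_rad: "bdry_int F f \<Longrightarrow> AE z in circ. (\<lambda>k. F (of_real (rad k) * z)) \<longlonglongrightarrow> f z"
  unfolding bdry_int_def by (auto elim!: eventually_mono intro: filterlim_compose[OF _ rad_at_left])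

lemma circle_mean_one:
  assumes "F holomorphic_on ball 0 r0" "1 < r0"
  shows "(LINT z|circ. F z) = F 0"
  using circle_mean_holomorphic[OF assms(1), of 1] assms(2) by simp

lemma rad_dilate_holomorphic:
  assumes "F holomorphic_on ball 0 1"
  shows "(\<lambda>z. F (of_real (rad k) * z)) holomorphic_on ball 0 (1 / rad k)"
proof -
  have "((\<lambda>z. F z) \<circ> (\<lambda>z. of_real (rad k) * z)) holomorphic_on ball 0 (1 / rad k)"
    by (rule holomorphic_on_compose_gen[OF _ assms])
       (use rad_bounds[of k] in \<open>auto intro!: holomorphic_intros simp: dist_norm norm_mult field_simps\<close>)
  then show ?thesis by (simp add: o_def)
qed

lemma rad_dilate_continuous:
  assumes "F holomorphic_on ball 0 1"
  shows "continuous_on (sphere 0 1) (\<lambda>z. F (of_real (rad k) * z))"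
  using dilate_continuous_circle[OF holomorphic_on_imp_continuous_on[OF assms], of "rad k"] rad_bounds[of k]
  by simp

lemma HinfE:
  assumes "h \<in> Hinf"
  obtains H C where "Hinf_extension H h" "0 < C" "AE z in circ. cmod (h z) \<le> C"
    "\<And>z. z \<in> ball 0 1 \<Longrightarrow> cmod (H z) \<le> C" "h \<in> borel_measurable circ"
proof -
  obtain H where H: "Hinf_extension H h" using assms by (auto simp: Hinf_def)
  obtain C1 where C1: "AE z in circ. cmod (h z) \<le> C1" using assms by (auto simp: Hinf_def Linf_def)
  obtain C2 where C2: "\<And>z. z \<in> ball 0 1 \<Longrightarrow> cmod (H z) \<le> C2"
    using H unfolding Hinf_extension_def bounded_iff by blast
  let ?C = "max (max C1 C2) 1"
  show ?thesis
  proof (rule that[OF H, of ?C])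
    show "AE z in circ. cmod (h z) \<le> ?C" using C1 by eventually_elim simp
    show "cmod (H z) \<le> ?C" if "z \<in> ball 0 1" for z using C2[OF that] by simp
  qed (use assms in \<open>auto simp: Hinf_def Linf_def\<close>)
qed

lemma Hinf_measurable: "h \<in> Hinf \<Longrightarrow> h \<in> borel_measurable circ"
  by (auto simp: Hinf_def Linf_def)

lemma Hinf_L2: "h \<in> Hinf \<Longrightarrow> h \<in> L2"
  by (metis HinfE L2_bounded)

lemma Hinf_mult_L2: "h \<in> Hinf \<Longrightarrow> f \<in> L2 \<Longrightarrow> (\<lambda>z. h z * f z) \<in> L2"
  by (metis HinfE L2_mult_bounded)

lemma cnj_Hinf_mult_L2: "h \<in> Hinf \<Longrightarrow> f \<in> L2 \<Longrightarrow> (\<lambda>z. cnj (h z) * f z) \<in> L2"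
proof (erule HinfE)
  fix C assume "f \<in> L2" "AE z in circ. cmod (h z) \<le> C" "h \<in> borel_measurable circ"
  then show ?thesis by (intro L2_mult_bounded[where C = C]) auto
qed

text \<open>For the dilates the coefficients vanish by the mean value property, and the uniform
  bound lets them pass to the boundary by dominated convergence.\<close>

lemma Hinf_HP:
  assumes h: "h \<in> Hinf"
  shows "h \<in> HP"
proof -
  obtain H C where H: "Hinf_extension H h" and C: "AE z in circ. cmod (h z) \<le> C"
    and HC: "\<And>z. z \<in> ball 0 1 \<Longrightarrow> cmod (H z) \<le> C" and m[measurable]: "h \<in> borel_measurable circ"
    using HinfE[OF h] by metis
  have hol: "H holomorphic_on ball 0 1" using H by (simp add: Hinf_extension_def)
  have "(LINT z|circ. h z * z ^ Suc n) = 0" for n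
  proof -
    have "(\<lambda>k. LINT z|circ. H (of_real (rad k) * z) * z ^ Suc n) \<longlonglongrightarrow> (LINT z|circ. h z * z ^ Suc n)"
    proof (rule integral_dominated_convergence[where w = "\<lambda>z. C"])
      have "AE z in circ. (\<lambda>k. H (of_real (rad k) * z)) \<longlonglongrightarrow> h z"
        using H by (intro bdry_int_rad) (simp add: Hinf_extension_def)
      then show "AE z in circ. (\<lambda>k. H (of_real (rad k) * z) * z ^ Suc n) \<longlonglongrightarrow> h z * z ^ Suc n"
        by eventually_elim (intro tendsto_intros)
      show "AE z in circ. norm (H (of_real (rad k) * z) * z ^ Suc n) \<le> C" for k
        by (rule AE_I2) (use HC[OF rad_ball] in \<open>auto simp: norm_mult norm_power\<close>)
      show "(\<lambda>z. H (of_real (rad k) * z) * z ^ Suc n) \<in> borel_measurable circ" for k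
        by (intro circ_measurable_continuous continuous_intros rad_dilate_continuous hol)
    qed auto
    moreover have "(LINT z|circ. H (of_real (rad k) * z) * z ^ Suc n) = 0" for k
    proof -
      have "(\<lambda>z. H (of_real (rad k) * z) * z ^ Suc n) holomorphic_on ball 0 (1 / rad k)"
        by (intro holomorphic_intros rad_dilate_holomorphic hol)
      from circle_mean_one[OF this] show ?thesis using rad_bounds[of k] by simp
    qed
    ultimately show ?thesis by (simp add: LIMSEQ_const_iff)
  qed
  then show ?thesis using Hinf_L2[OF h] by (simp add: HP_iff)
qed

lemma Hinf_char_HP:
  assumes h: "h \<in> Hinf"
  shows "(\<lambda>z. h z * z ^ n) \<in> HP"
proof -
  have "(LINT z|circ. h z * z ^ n * z ^ Suc m) = 0" for m
  proof -
    have "(LINT z|circ. h z * z ^ Suc (n + m)) = 0" using Hinf_HP[OF h] unfolding HP_iff by blast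
    then show ?thesis by (simp add: power_add mult_ac)
  qed
  then show ?thesis using Hinf_mult_L2[OF h HP_L2[OF char_HP]] by (simp add: HP_iff)
qed

text \<open>The multiplier is moved to the other side of the inner product, where it acts on a power
  of z and stays in \<open>HP\<close>. \<open>Hinf_mult_HP\<close> results from the same exchange
  with the roles of the two spaces interchanged.\<close>

lemma cnj_Hinf_mult_HM:
  assumes h: "h \<in> Hinf" and f: "f \<in> HM"
  shows "(\<lambda>z. cnj (h z) * f z) \<in> HM"
proof -
  have "(LINT z|circ. cnj (h z) * f z * cnj z ^ n) = L2_inner f (\<lambda>z. h z * z ^ n)" for n
    by (simp add: L2_inner_def mult_ac)
  then show ?thesis
    using cnj_Hinf_mult_L2[OF h HM_L2[OF f]] HM_orth_HP[OF f Hinf_char_HP[OF h]] by (simp add: HM_iff)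
qed

lemma Hinf_mult_HP:
  assumes h: "h \<in> Hinf" and f: "f \<in> HP"
  shows "(\<lambda>z. h z * f z) \<in> HP"
proof -
  have "(LINT z|circ. h z * f z * z ^ Suc n) = L2_inner f (\<lambda>z. cnj (h z) * cnj z ^ Suc n)" for n
    by (simp add: L2_inner_def mult_ac)
  then show ?thesis
    using Hinf_mult_L2[OF h HP_L2[OF f]] HP_orth_HM[OF f cnj_Hinf_mult_HM[OF h cnj_char_HM]] by (simp add: HP_iff)
qed

text \<open>Truncate at height \<Lambda>. The truncated part tends to 0 by dominated convergence,
  and the excess is at most the square divided by \<Lambda>, which the bound of the norms makes
  uniformly small.\<close>

lemma L2_bounded_AE_null_L1:
  assumes e: "\<And>k. e k \<in> L2" and C: "\<And>k. L2_norm (e k) \<le> C"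
    and lim: "AE z in circ. (\<lambda>k. e k z) \<longlonglongrightarrow> 0"
  shows "(\<lambda>k. LINT z|circ. cmod (e k z)) \<longlonglongrightarrow> 0"
proof (rule LIMSEQ_I)
  have [measurable]: "e k \<in> borel_measurable circ" for k using e L2_measurable by blast
  fix r :: real assume r: "0 < r"
  \<comment> \<open>Chosen so that \<open>C^2 / \<Lambda>\<close> is at most \<open>r / 2\<close>;
    the summand 1 keeps it positive.\<close>
  define \<Lambda> where "\<Lambda> = (C\<^sup>2 + 1) * 2 / r"
  have L: "0 < \<Lambda>" using r by (simp add: \<Lambda>_def add_nonneg_pos)
  have "(\<lambda>k. LINT z|circ. min (cmod (e k z)) \<Lambda>) \<longlonglongrightarrow> (LINT z|circ. 0)"
  proof (rule integral_dominated_convergence[where w = "\<lambda>z. \<Lambda>"])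
    show "AE z in circ. (\<lambda>k. min (cmod (e k z)) \<Lambda>) \<longlonglongrightarrow> 0"
      using lim
    proof eventually_elim
      fix z assume "(\<lambda>k. e k z) \<longlonglongrightarrow> 0"
      then have "(\<lambda>k. min (cmod (e k z)) \<Lambda>) \<longlonglongrightarrow> min (cmod 0) \<Lambda>" by (intro tendsto_intros)
      then show "(\<lambda>k. min (cmod (e k z)) \<Lambda>) \<longlonglongrightarrow> 0" using L by (simp add: min_def)
    qed
  qed (use L in auto)
  then have "eventually (\<lambda>k. (LINT z|circ. min (cmod (e k z)) \<Lambda>) < r / 2) sequentially"
    using r by (intro order_tendstoD) auto
  then obtain N where N: "\<And>k. N \<le> k \<Longrightarrow> (LINT z|circ. min (cmod (e k z)) \<Lambda>) < r / 2"
    by (auto simp: eventually_sequentially)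
  have "(LINT z|circ. cmod (e k z)) < r" if k: "N \<le> k" for k
  proof -
    have i1: "integrable circ (\<lambda>z. min (cmod (e k z)) \<Lambda>)"
      by (rule integrable_circ_bounded[where C = \<Lambda>]) (use L in auto)
    have i2: "integrable circ (\<lambda>z. (cmod (e k z))\<^sup>2)" by (rule L2_square_integrable[OF e])
    have "(LINT z|circ. cmod (e k z)) \<le> (LINT z|circ. min (cmod (e k z)) \<Lambda> + (cmod (e k z))\<^sup>2 / \<Lambda>)"
    proof (rule integral_mono)
      show "integrable circ (\<lambda>z. cmod (e k z))" using L1_le_L2(1)[OF e] by auto
      fix z
      show "cmod (e k z) \<le> min (cmod (e k z)) \<Lambda> + (cmod (e k z))\<^sup>2 / \<Lambda>"
      proof (cases "cmod (e k z) \<le> \<Lambda>")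
        case False
        then have "cmod (e k z) * \<Lambda> \<le> cmod (e k z) * cmod (e k z)" by (intro mult_left_mono) auto
        then have "cmod (e k z) \<le> (cmod (e k z))\<^sup>2 / \<Lambda>"
          using L by (simp add: pos_le_divide_eq power2_eq_square)
        then show ?thesis using L False by simp
      qed (use L in simp)
    qed (use i1 i2 in auto)
    also have "\<dots> = (LINT z|circ. min (cmod (e k z)) \<Lambda>) + (L2_norm (e k))\<^sup>2 / \<Lambda>"
      using i1 i2 by (simp add: L2_norm_square)
    also have "(L2_norm (e k))\<^sup>2 / \<Lambda> \<le> r / 2"
    proof -
      have "(L2_norm (e k))\<^sup>2 \<le> C\<^sup>2" using C by (intro power_mono) auto
      then have "(L2_norm (e k))\<^sup>2 \<le> r / 2 * \<Lambda>" using r by (simp add: \<Lambda>_def)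
      then show ?thesis using L by (simp add: pos_divide_le_eq)
    qed
    finally show ?thesis using N[OF k] by simp
  qed
  then show "\<exists>no. \<forall>n\<ge>no. norm ((LINT z|circ. cmod (e n z)) - 0) < r"
    by (intro exI[of _ N]) auto
qed

text \<open>The dilates are bounded in norm and converge almost everywhere to f, hence in mean. That
  is enough to transfer the vanishing of their coefficients to f.\<close>

lemma H2_subset_HP: "H2 \<subseteq> HP"
proof
  fix f assume f: "f \<in> H2"
  then have fL: "f \<in> L2" by (simp add: H2_def)
  obtain F where F: "F holomorphic_on ball 0 1" "bdry_int F f"
    and bdd: "bdd_above ((\<lambda>r::real. LINT z|circ. (cmod (F (of_real r * z)))\<^sup>2) ` {0<..<1})"
    using f by (auto simp: H2_def)
  obtain B where B: "\<And>r. 0 < r \<Longrightarrow> r < 1 \<Longrightarrow> (LINT z|circ. (cmod (F (of_real r * z)))\<^sup>2) \<le> B"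
  proof -
    obtain B where "\<forall>x\<in>(\<lambda>r::real. LINT z|circ. (cmod (F (of_real r * z)))\<^sup>2) ` {0<..<1}. x \<le> B"
      using bdd unfolding bdd_above_def ..
    then show ?thesis using that[of B] by simp
  qed
  have FL: "(\<lambda>z. F (of_real (rad k) * z)) \<in> L2" for k
    by (intro L2_continuous rad_dilate_continuous F)
  define e where "e k z = f z - F (of_real (rad k) * z)" for k z
  have "(LINT z|circ. f z * z ^ Suc n) = 0" for n
  proof -
    have "(\<lambda>k. LINT z|circ. cmod (e k z)) \<longlonglongrightarrow> 0"
    proof (rule L2_bounded_AE_null_L1)
      show "e k \<in> L2" for k unfolding e_def by (intro L2_diff fL FL)
      have "L2_norm (\<lambda>z. F (of_real (rad k) * z)) \<le> sqrt B" for k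
        unfolding L2_norm_def using rad_bounds[of k] by (intro real_sqrt_le_mono B)
      then show "L2_norm (e k) \<le> L2_norm f + sqrt B" for k
        unfolding e_def[abs_def] by (intro order_trans[OF L2_norm_diff[OF fL FL]] add_left_mono)
      show "AE z in circ. (\<lambda>k. e k z) \<longlonglongrightarrow> 0"
        using bdry_int_rad[OF F(2)]
      proof eventually_elim
        fix z assume "(\<lambda>k. F (of_real (rad k) * z)) \<longlonglongrightarrow> f z"
        then have "(\<lambda>k. e k z) \<longlonglongrightarrow> f z - f z" unfolding e_def by (intro tendsto_intros)
        then show "(\<lambda>k. e k z) \<longlonglongrightarrow> 0" by simp
      qed
    qed
    moreover have "cmod (LINT z|circ. f z * z ^ Suc n) \<le> (LINT z|circ. cmod (e k z))" for k
    proof -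
      have eL: "e k \<in> L2" unfolding e_def by (intro L2_diff fL FL)
      have "(\<lambda>z. F (of_real (rad k) * z) * z ^ Suc n) holomorphic_on ball 0 (1 / rad k)"
        by (intro holomorphic_intros rad_dilate_holomorphic F)
      from circle_mean_one[OF this] have "(LINT z|circ. F (of_real (rad k) * z) * z ^ Suc n) = 0"
        using rad_bounds[of k] by simp
      then have "(LINT z|circ. f z * z ^ Suc n) = (LINT z|circ. f z * z ^ Suc n) - (LINT z|circ. F (of_real (rad k) * z) * z ^ Suc n)"
        by simp
      also have "\<dots> = (LINT z|circ. e k z * z ^ Suc n)"
        using L2_mult_integrable[OF fL HP_L2[OF char_HP]] L2_mult_integrable[OF FL HP_L2[OF char_HP]]
        unfolding e_def left_diff_distrib by (intro Bochner_Integration.integral_diff[symmetric])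
      also have "cmod \<dots> \<le> (LINT z|circ. cmod (e k z))"
      proof (rule Bochner_Integration.integral_norm_bound_integral)
        show "integrable circ (\<lambda>z. e k z * z ^ Suc n)" by (rule L2_mult_integrable[OF eL HP_L2[OF char_HP]])
        show "integrable circ (\<lambda>z. cmod (e k z))" using L1_le_L2(1)[OF eL] by auto
      qed (simp add: norm_mult norm_power)
      finally show ?thesis .
    qed
    ultimately have "cmod (LINT z|circ. f z * z ^ Suc n) \<le> 0"
      by (intro LIMSEQ_le_const[of _ 0]) auto
    then show ?thesis by simp
  qed
  then show "f \<in> HP" using fL by (simp add: HP_iff)
qed

lemma Hinf_subset_H2: "Hinf \<subseteq> H2"
proof
  fix h assume h: "h \<in> Hinf"
  obtain H C where H: "Hinf_extension H h" and HC: "\<And>z. z \<in> ball 0 1 \<Longrightarrow> cmod (H z) \<le> C"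
    using HinfE[OF h] by metis
  have hol: "H holomorphic_on ball 0 1" using H by (simp add: Hinf_extension_def)
  have "(LINT z|circ. (cmod (H (of_real r * z)))\<^sup>2) \<le> C\<^sup>2" if r: "r \<in> {0<..<1}" for r
  proof -
    have "(LINT z|circ. (cmod (H (of_real r * z)))\<^sup>2) \<le> (LINT z|circ. C\<^sup>2)"
    proof (rule integral_mono')
      fix z assume "z \<in> space circ"
      then have "cmod (H (of_real r * z)) \<le> C" using r by (intro HC) (simp add: norm_mult)
      then show "(cmod (H (of_real r * z)))\<^sup>2 \<le> C\<^sup>2" by (intro power_mono) auto
    qed auto
    then show ?thesis by simp
  qed
  then have "bdd_above ((\<lambda>r::real. LINT z|circ. (cmod (H (of_real r * z)))\<^sup>2) ` {0<..<1})"
    by (intro bdd_aboveI2[where M = "C\<^sup>2"])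
  then show "h \<in> H2" using Hinf_L2[OF h] H hol by (auto simp: H2_def Hinf_extension_def)
qed

lemma Hinf_char: "(\<lambda>z. z ^ n) \<in> Hinf"
proof -
  have "bounded ((\<lambda>z::complex. z ^ n) ` ball 0 1)"
    unfolding bounded_iff by (auto simp: norm_power intro!: exI[of _ 1] power_le_one)
  moreover have "bdry_int (\<lambda>z. z ^ n) (\<lambda>z. z ^ n)"
    unfolding bdry_int_def
  proof (rule AE_I2)
    fix z :: complex
    have "((\<lambda>r::real. (of_real r * z) ^ n) \<longlongrightarrow> (of_real 1 * z) ^ n) (at_left 1)" by (intro tendsto_intros)
    then show "((\<lambda>r::real. (of_real r * z) ^ n) \<longlongrightarrow> z ^ n) (at_left 1)" by simp
  qed
  moreover have "(\<lambda>z. z ^ n) \<in> Linf"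
    unfolding Linf_def by (auto intro!: exI[of _ 1] simp: norm_power)
  moreover have "(\<lambda>z::complex. z ^ n) holomorphic_on ball 0 1" by (intro holomorphic_intros)
  ultimately show ?thesis unfolding Hinf_def Hinf_extension_def by blast
qed

text \<open>The extension is the difference quotient of H at 0, with the singularity removed. It is
  bounded near 0 by compactness and, where \<open>|z| > 1 / 2\<close>, by 4 C. On the circle
  division by z is multiplication by \<open>cnj z\<close>.\<close>

lemma Hinf_backward_shift:
  assumes h: "h \<in> Hinf"
  shows "\<exists>c. (\<lambda>z. cnj z * (h z - c)) \<in> Hinf"
proof -
  obtain H C where H: "Hinf_extension H h" and C: "0 < C" "AE z in circ. cmod (h z) \<le> C"
    and HC: "\<And>z. z \<in> ball 0 1 \<Longrightarrow> cmod (H z) \<le> C" and m[measurable]: "h \<in> borel_measurable circ"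
    using HinfE[OF h] by metis
  have hol: "H holomorphic_on ball 0 1" using H by (simp add: Hinf_extension_def)
  define G where "G z = (if z = 0 then deriv H 0 else (H z - H 0) / (z - 0))" for z
  have G: "G holomorphic_on ball 0 1"
    unfolding G_def[abs_def] by (rule pole_lemma[OF hol]) simp
  have "bounded (G ` ball 0 1)"
  proof -
    have "compact (G ` cball 0 (1/2))"
      by (intro compact_continuous_image holomorphic_on_imp_continuous_on holomorphic_on_subset[OF G]) auto
    then have "bounded (G ` cball 0 (1/2))" by (rule compact_imp_bounded)
    then obtain B where "\<forall>x\<in>G ` cball 0 (1/2). cmod x \<le> B" unfolding bounded_iff ..
    then have B: "\<And>z. z \<in> cball 0 (1/2) \<Longrightarrow> cmod (G z) \<le> B" by simp
    have "cmod (G z) \<le> max B (4 * C)" if z: "z \<in> ball 0 1" for z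
    proof (cases "cmod z \<le> 1/2")
      case True then show ?thesis using B[of z] by (simp add: le_max_iff_disj)
    next
      case False
      then have nz: "z \<noteq> 0" by auto
      have "cmod (H z - H 0) \<le> 2 * C"
        using norm_triangle_ineq4[of "H z" "H 0"] HC[OF z] HC[of 0] by simp
      then have "cmod (H z - H 0) / cmod z \<le> (2 * C) / (1 / 2)"
        using False C by (intro frac_le) auto
      then show ?thesis using nz by (simp add: G_def norm_divide le_max_iff_disj)
    qed
    then show ?thesis unfolding bounded_iff by blast
  qed
  moreover have "bdry_int G (\<lambda>z. cnj z * (h z - H 0))"
  proof -
    have "AE z in circ. ((\<lambda>r::real. H (of_real r * z)) \<longlongrightarrow> h z) (at_left 1)"
      using H by (simp add: Hinf_extension_def bdry_int_def)
    then show ?thesis unfolding bdry_int_def using AE_space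
    proof eventually_elim
      fix z assume lim: "((\<lambda>r::real. H (of_real r * z)) \<longlongrightarrow> h z) (at_left 1)" and z: "z \<in> space circ"
      have nz: "z \<noteq> 0" using z by auto
      have "((\<lambda>r::real. (H (of_real r * z) - H 0) / (of_real r * z)) \<longlongrightarrow> (h z - H 0) / (of_real 1 * z)) (at_left 1)"
        using nz by (intro tendsto_intros lim) auto
      moreover have "(h z - H 0) / (of_real 1 * z) = cnj z * (h z - H 0)"
        using circ_cnj_cancel[OF z] nz by (simp add: field_simps) (simp add: mult.assoc[symmetric])
      moreover have "\<forall>\<^sub>F r::real in at_left 1. (H (of_real r * z) - H 0) / (of_real r * z) = G (of_real r * z)"
        by (rule eventually_mono[OF eventually_at_left_real[of 0 1]]) (use nz in \<open>auto simp: G_def\<close>)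
      ultimately show "((\<lambda>r::real. G (of_real r * z)) \<longlongrightarrow> cnj z * (h z - H 0)) (at_left 1)"
        by (simp only: tendsto_cong)
    qed
  qed
  moreover have "(\<lambda>z. cnj z * (h z - H 0)) \<in> Linf"
  proof -
    have "AE z in circ. cmod (cnj z * (h z - H 0)) \<le> C + cmod (H 0)"
      using C(2) AE_space
      by eventually_elim (auto simp: norm_mult intro!: order_trans[OF norm_triangle_ineq4])
    then show ?thesis unfolding Linf_def by auto
  qed
  ultimately show ?thesis using G unfolding Hinf_def Hinf_extension_def by blast
qed

section \<open>Model spaces and dual truncated Toeplitz operators\<close>

lemma inner_fun_Hinf: "inner_fun \<theta> \<Longrightarrow> \<theta> \<in> Hinf"
  and inner_fun_unimodular: "inner_fun \<theta> \<Longrightarrow> AE z in circ. cmod (\<theta> z) = 1"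
  by (auto simp: inner_fun_def)

lemma inner_fun_cnj_cancel:
  assumes "inner_fun \<theta>"
  shows "AE z in circ. \<theta> z * cnj (\<theta> z) = 1"
  using inner_fun_unimodular[OF assms] by eventually_elim (simp add: complex_norm_square[symmetric])

lemma L2_inner_unimodular:
  assumes "inner_fun \<theta>" "f \<in> L2" "g \<in> L2"
  shows "L2_inner f (\<lambda>z. \<theta> z * g z) = L2_inner (\<lambda>z. cnj (\<theta> z) * f z) g"
  by (simp add: L2_inner_def mult_ac)

lemma model_space_subset_HP: "model_space \<theta> \<subseteq> HP"
  using H2_subset_HP by (auto simp: model_space_def)

lemma model_space_L2: "model_space \<theta> \<subseteq> L2"
  using model_space_subset_HP HP_L2 by blast

lemma model_perp_orth: "model_perp \<theta> = orth (model_space \<theta>)"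
  by (simp add: model_perp_def orth_def)

lemmas model_perp_L2 = orth_L2[of _ "model_space \<theta>" for \<theta>, folded model_perp_orth]
lemmas model_perp_closed = orth_zero[OF model_space_L2, folded model_perp_orth]
  orth_add[OF model_space_L2, folded model_perp_orth]
  orth_diff[OF model_space_L2, folded model_perp_orth] orth_scale[OF model_space_L2, folded model_perp_orth]
lemmas model_perp_cong = orth_cong[OF model_space_L2, folded model_perp_orth]

lemma model_space_cnj_HM:
  assumes \<theta>: "inner_fun \<theta>" and k: "k \<in> model_space \<theta>"
  shows "(\<lambda>z. cnj (\<theta> z) * k z) \<in> HM"
proof -
  have kL: "k \<in> L2" using k model_space_L2 by blast
  have "L2_inner (\<lambda>z. cnj (\<theta> z) * k z) (\<lambda>z. z ^ n) = 0" for n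
  proof -
    have "(\<lambda>z. z ^ n) \<in> H2" using Hinf_char Hinf_subset_H2 by blast
    then have "L2_inner k (\<lambda>z. \<theta> z * z ^ n) = 0" using k by (simp add: model_space_def)
    then show ?thesis using L2_inner_unimodular[OF \<theta> kL HP_L2[OF char_HP]] by simp
  qed
  then show ?thesis
    using cnj_Hinf_mult_L2[OF inner_fun_Hinf[OF \<theta>] kL] by (simp add: HM_iff L2_inner_def)
qed

text \<open>For \<open>n > 0\<close> the function \<open>\<kappa>\<close>, the \<open>n\<close>-th backward shift of \<open>\<theta>\<close>, is an element of the model space
  whose boundary values are known, and these elements determine the orthogonal complement.\<close>

lemma backward_shift_model_space:
  assumes \<theta>: "inner_fun \<theta>"
  shows "\<exists>\<kappa> m. \<kappa> \<in> Hinf \<and> m \<in> HM \<and> \<kappa> \<doteq> (\<lambda>z. cnj z ^ n * \<theta> z - m z)"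
proof (induction n)
  case 0
  show ?case using inner_fun_Hinf[OF \<theta>] HM_closed(1) by (intro exI[of _ \<theta>] exI[of _ "\<lambda>z. 0"]) simp
next
  case (Suc n)
  then obtain \<kappa> m where k: "\<kappa> \<in> Hinf" "m \<in> HM" "\<kappa> \<doteq> (\<lambda>z. cnj z ^ n * \<theta> z - m z)" by blast
  obtain c where c: "(\<lambda>z. cnj z * (\<kappa> z - c)) \<in> Hinf" using Hinf_backward_shift[OF k(1)] by blast
  have "(\<lambda>z. cnj (z ^ 1) * m z) \<in> HM" by (rule cnj_Hinf_mult_HM[OF Hinf_char k(2)])
  moreover have "(\<lambda>z. c * cnj z ^ Suc 0) \<in> HM" by (intro HM_closed cnj_char_HM)
  ultimately have "(\<lambda>z. cnj (z ^ 1) * m z + c * cnj z ^ Suc 0) \<in> HM" by (rule HM_closed)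
  then have "(\<lambda>z. cnj z * m z + c * cnj z) \<in> HM" by simp
  moreover have "(\<lambda>z. cnj z * (\<kappa> z - c)) \<doteq> (\<lambda>z. cnj z ^ Suc n * \<theta> z - (cnj z * m z + c * cnj z))"
    using k(3)
  proof eventually_elim
    case (elim z)
    show ?case unfolding elim by (simp add: right_diff_distrib distrib_left mult_ac)
  qed
  ultimately show ?case using c by blast
qed

text \<open>For the forward direction split f into p in \<open>HP\<close> and m in
  \<open>HM\<close>; it remains to see that \<open>cnj \<theta> p\<close> lies in \<open>HP\<close>.
  Its coefficients are inner products of p with \<open>cnj z ^ Suc n * \<theta>\<close>, which is a
  model space element \<kappa> plus an element of \<open>HM\<close>. The latter is orthogonal to p,
  and \<kappa> is orthogonal to f and to m.\<close>

lemma model_perp_iff: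
  assumes \<theta>: "inner_fun \<theta>"
  shows "f \<in> model_perp \<theta> \<longleftrightarrow> f \<in> L2 \<and> (\<exists>m\<in>HM. \<exists>g\<in>HP. f \<doteq> (\<lambda>z. m z + \<theta> z * g z))"
proof safe
  assume f: "f \<in> model_perp \<theta>"
  then show fL: "f \<in> L2" by (rule model_perp_L2)
  obtain p m where pm: "p \<in> HP" "m \<in> HM" "\<And>z. f z = p z + m z" using L2_decompose[OF fL] by metis
  define g where "g z = cnj (\<theta> z) * p z" for z
  note \<theta>H = inner_fun_Hinf[OF \<theta>]
  have gL: "g \<in> L2" unfolding g_def by (intro cnj_Hinf_mult_L2 \<theta>H HP_L2 pm)
  have "(LINT z|circ. g z * z ^ Suc n) = 0" for n
  proof -
    obtain \<kappa> k where k: "\<kappa> \<in> Hinf" "k \<in> HM" "\<kappa> \<doteq> (\<lambda>z. cnj z ^ Suc n * \<theta> z - k z)"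
      using backward_shift_model_space[OF \<theta>] by blast
    have \<kappa>L: "\<kappa> \<in> L2" by (rule Hinf_L2[OF k(1)])
    have sL: "(\<lambda>z. cnj z ^ Suc n * \<theta> z) \<in> L2"
      using Hinf_mult_L2[OF \<theta>H HM_L2[OF cnj_char_HM[of n]]] by (simp add: mult.commute)
    have \<kappa>s: "L2_inner h \<kappa> = L2_inner h (\<lambda>z. cnj z ^ Suc n * \<theta> z) - L2_inner h k" if "h \<in> L2" for h
      using L2_inner_cong[OF that that \<kappa>L L2_diff[OF sL HM_L2[OF k(2)]] _ k(3)]
        Lsp.form_diff_right[OF sL HM_L2[OF k(2)] that] by simp
    have "\<kappa> \<in> model_space \<theta>"
      unfolding model_space_def
    proof safe
      show "\<kappa> \<in> H2" using k(1) Hinf_subset_H2 by blast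
      fix u assume "u \<in> H2"
      then have u: "u \<in> HP" using H2_subset_HP by blast
      have uL: "(\<lambda>z. \<theta> z * u z) \<in> HP" by (rule Hinf_mult_HP[OF \<theta>H u])
      have "L2_inner (\<lambda>z. \<theta> z * u z) (\<lambda>z. cnj z ^ Suc n * \<theta> z) = (LINT z|circ. u z * z ^ Suc n)"
        unfolding L2_inner_def
      proof (rule integral_cong_AE)
        show "AE z in circ. \<theta> z * u z * cnj (cnj z ^ Suc n * \<theta> z) = u z * z ^ Suc n"
          using inner_fun_cnj_cancel[OF \<theta>]
        proof eventually_elim
          case (elim z)
          have "\<theta> z * u z * cnj (cnj z ^ Suc n * \<theta> z) = (\<theta> z * cnj (\<theta> z)) * (u z * z ^ Suc n)" by simp
          then show ?case using elim by simp
        qed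
        show "(\<lambda>z. u z * z ^ Suc n) \<in> borel_measurable circ"
          using borel_measurable_integrable[OF L2_mult_integrable[OF HP_L2[OF u] HP_L2[OF char_HP[of "Suc n"]]]] .
        show "(\<lambda>z. \<theta> z * u z * cnj (cnj z ^ Suc n * \<theta> z)) \<in> borel_measurable circ"
          using borel_measurable_integrable[OF L2_inner_integrable[OF HP_L2[OF uL] sL]] .
      qed
      also have "\<dots> = 0" using u unfolding HP_iff by blast
      finally have "L2_inner (\<lambda>z. \<theta> z * u z) \<kappa> = 0"
        using \<kappa>s[OF HP_L2[OF uL]] HP_orth_HM[OF uL k(2)] by simp
      then show "L2_inner \<kappa> (\<lambda>z. \<theta> z * u z) = 0" using L2_inner_cnj[of \<kappa> "\<lambda>z. \<theta> z * u z"] by simp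
    qed
    then have "L2_inner f \<kappa> = 0" using f by (simp add: model_perp_def)
    moreover have "L2_inner f \<kappa> = L2_inner p \<kappa> + L2_inner m \<kappa>"
      using Lsp.form_add[OF HP_L2[OF pm(1)] HM_L2[OF pm(2)] \<kappa>L] pm(3) by presburger
    moreover have "L2_inner m \<kappa> = 0" using HM_orth_HP[OF pm(2) Hinf_HP[OF k(1)]] .
    moreover have "L2_inner p k = 0" using HP_orth_HM[OF pm(1) k(2)] .
    ultimately have "L2_inner p (\<lambda>z. cnj z ^ Suc n * \<theta> z) = 0"
      using \<kappa>s[OF HP_L2[OF pm(1)]] by simp
    then show ?thesis by (simp add: L2_inner_def g_def mult_ac)
  qed
  then have g: "g \<in> HP" using gL by (simp add: HP_iff)
  have "f \<doteq> (\<lambda>z. m z + \<theta> z * g z)"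
    using inner_fun_cnj_cancel[OF \<theta>]
    by eventually_elim (simp add: pm(3) g_def mult.assoc[symmetric])
  then show "\<exists>m\<in>HM. \<exists>g\<in>HP. f \<doteq> (\<lambda>z. m z + \<theta> z * g z)" using pm(2) g by blast
next
  fix m g assume fL: "f \<in> L2" and m: "m \<in> HM" and g: "g \<in> HP" and eq: "f \<doteq> (\<lambda>z. m z + \<theta> z * g z)"
  note \<theta>H = inner_fun_Hinf[OF \<theta>]
  have gL: "(\<lambda>z. \<theta> z * g z) \<in> L2" by (intro Hinf_mult_L2 \<theta>H HP_L2 g)
  show "f \<in> model_perp \<theta>"
    unfolding model_perp_def
  proof safe
    show "f \<in> L2" by (rule fL)
    fix k assume k: "k \<in> model_space \<theta>"
    have kL: "k \<in> L2" using k model_space_L2 by blast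
    have "L2_inner f k = L2_inner m k + L2_inner (\<lambda>z. \<theta> z * g z) k"
      using L2_inner_cong[OF fL L2_add_closed[OF HM_L2[OF m] gL] kL kL eq]
        Lsp.form_add[OF HM_L2[OF m] gL kL] by simp
    moreover have "L2_inner m k = 0" using HM_orth_HP[OF m] k model_space_subset_HP by blast
    moreover have "L2_inner k (\<lambda>z. \<theta> z * g z) = 0"
      unfolding L2_inner_unimodular[OF \<theta> kL HP_L2[OF g]]
      by (rule HM_orth_HP[OF model_space_cnj_HM[OF \<theta> k] g])
    ultimately show "L2_inner f k = 0"
      using L2_inner_cnj[of "\<lambda>z. \<theta> z * g z" k] by simp
  qed
qed

lemma HM_model_perp:
  assumes "inner_fun \<theta>" "m \<in> HM"
  shows "m \<in> model_perp \<theta>"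
proof -
  have "m \<doteq> (\<lambda>z. m z + \<theta> z * 0)" by simp
  then show ?thesis
    unfolding model_perp_iff[OF assms(1)]
    by (intro conjI HM_L2[OF assms(2)] bexI[OF _ assms(2)] bexI[OF _ HP_closed(1)])
qed

lemma inner_mult_HP_model_perp:
  assumes "inner_fun \<theta>" "g \<in> HP"
  shows "(\<lambda>z. \<theta> z * g z) \<in> model_perp \<theta>"
proof -
  have "(\<lambda>z. \<theta> z * g z) \<doteq> (\<lambda>z. 0 + \<theta> z * g z)" by simp
  then show ?thesis
    unfolding model_perp_iff[OF assms(1)]
    by (intro conjI Hinf_mult_L2 inner_fun_Hinf HP_L2 assms bexI[OF _ HM_closed(1)] bexI[OF _ assms(2)])
qed

text \<open>The double complement of the model space in terms of Fourier coefficients, without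
  reference to radial limits. The differences between \<open>\<phi> f\<close> and its projection lie
  in this space.\<close>

lemma orth_model_perp_iff:
  assumes \<theta>: "inner_fun \<theta>"
  shows "k \<in> orth (model_perp \<theta>) \<longleftrightarrow> k \<in> HP \<and> (\<lambda>z. cnj (\<theta> z) * k z) \<in> HM"
proof safe
  assume k: "k \<in> orth (model_perp \<theta>)"
  have kL: "k \<in> L2" using k by (rule orth_L2)
  have "L2_inner k (\<lambda>z. cnj z ^ Suc n) = 0" for n
    by (rule orthD[OF k HM_model_perp[OF \<theta> cnj_char_HM]])
  then show "k \<in> HP" using kL by (auto simp: HP_def orth_def neg_chars_def)
  have "L2_inner (\<lambda>z. cnj (\<theta> z) * k z) (\<lambda>z. z ^ n) = 0" for n
    using orthD[OF k inner_mult_HP_model_perp[OF \<theta> char_HP[of n]]]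
    by (simp add: L2_inner_unimodular[OF \<theta> kL HP_L2[OF char_HP]])
  then show "(\<lambda>z. cnj (\<theta> z) * k z) \<in> HM"
    using cnj_Hinf_mult_L2[OF inner_fun_Hinf[OF \<theta>] kL] by (auto simp: HM_def orth_def pos_chars_def)
next
  assume k: "k \<in> HP" "(\<lambda>z. cnj (\<theta> z) * k z) \<in> HM"
  show "k \<in> orth (model_perp \<theta>)"
  proof (rule orthI[OF HP_L2[OF k(1)]])
    fix f assume f: "f \<in> model_perp \<theta>"
    then obtain m g where mg: "m \<in> HM" "g \<in> HP" "f \<doteq> (\<lambda>z. m z + \<theta> z * g z)" and fL: "f \<in> L2"
      using model_perp_iff[OF \<theta>] by blast
    have gL: "(\<lambda>z. \<theta> z * g z) \<in> L2" by (intro Hinf_mult_L2 inner_fun_Hinf \<theta> HP_L2 mg)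
    have "L2_inner k f = L2_inner k m + L2_inner k (\<lambda>z. \<theta> z * g z)"
      using L2_inner_cong[OF HP_L2[OF k(1)] HP_L2[OF k(1)] fL L2_add_closed[OF HM_L2[OF mg(1)] gL] _ mg(3)]
        Lsp.form_add_right[OF HM_L2[OF mg(1)] gL HP_L2[OF k(1)]] by simp
    then show "L2_inner k f = 0"
      using HP_orth_HM[OF k(1) mg(1)] HM_orth_HP[OF k(2) mg(2)]
      by (simp add: L2_inner_unimodular[OF \<theta> HP_L2[OF k(1)] HP_L2[OF mg(2)]])
  qed
qed

section \<open>The projection, and boundedness of the operator\<close>

lemma Linf_measurable: "\<phi> \<in> Linf \<Longrightarrow> \<phi> \<in> borel_measurable circ"
  by (simp add: Linf_def)

lemma Linf_bound: "\<phi> \<in> Linf \<Longrightarrow> \<exists>C>0. AE z in circ. cmod (\<phi> z) \<le> C"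
proof -
  assume "\<phi> \<in> Linf"
  then obtain C where "AE z in circ. cmod (\<phi> z) \<le> C" by (auto simp: Linf_def)
  then have "AE z in circ. cmod (\<phi> z) \<le> max C 1" by eventually_elim simp
  then show ?thesis by (intro exI[of _ "max C 1"]) auto
qed

lemma Linf_mult_L2: "\<phi> \<in> Linf \<Longrightarrow> f \<in> L2 \<Longrightarrow> (\<lambda>z. \<phi> z * f z) \<in> L2"
  using L2_mult_bounded Linf_measurable unfolding Linf_def by blast

lemma L2_proj_props:
  assumes "S \<subseteq> L2" "f \<in> L2"
  shows "L2_proj (orth S) f \<in> orth S" "(\<lambda>z. f z - L2_proj (orth S) f z) \<in> orth (orth S)"
proof -
  have "\<exists>g. g \<in> orth S \<and> (\<forall>h\<in>orth S. L2_inner (\<lambda>z. f z - g z) h = 0)"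
    using projection_exists[OF assms] unfolding orth_def[of "orth S"] by blast
  from someI_ex[OF this]
  have *: "L2_proj (orth S) f \<in> orth S" "\<forall>h\<in>orth S. L2_inner (\<lambda>z. f z - L2_proj (orth S) f z) h = 0"
    unfolding L2_proj_def by blast+
  then show "L2_proj (orth S) f \<in> orth S" by blast
  show "(\<lambda>z. f z - L2_proj (orth S) f z) \<in> orth (orth S)"
    using * L2_diff[OF assms(2) orth_L2] by (intro orthI) auto
qed

lemma orth_Int_trivial:
  assumes "f \<in> S" "f \<in> orth S"
  shows "f \<doteq> (\<lambda>z. 0)"
proof -
  have "L2_inner f f = 0" using assms(2,1) by (rule orthD)
  then have "L2_norm f = 0" by (simp add: L2_norm_eq Lsp.nrm_def)
  then show ?thesis using L2_norm_eq_0_iff[OF orth_L2[OF assms(2)]] by simp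
qed

lemma L2_proj_unique:
  assumes S: "S \<subseteq> L2" and f: "f \<in> L2" and g: "g \<in> orth S" "(\<lambda>z. f z - g z) \<in> orth (orth S)"
  shows "L2_proj (orth S) f \<doteq> g"
proof -
  let ?p = "L2_proj (orth S) f"
  note p = L2_proj_props[OF S f]
  have SL: "orth S \<subseteq> L2" using orth_L2 by blast
  have "(\<lambda>z. (f z - g z) - (f z - ?p z)) \<in> orth (orth S)" by (rule orth_diff[OF SL g(2) p(2)])
  moreover have "(\<lambda>z. ?p z - g z) \<in> orth S" by (rule orth_diff[OF S p(1) g(1)])
  ultimately have "(\<lambda>z. ?p z - g z) \<doteq> (\<lambda>z. 0)" by (intro orth_Int_trivial) auto
  then show ?thesis by eventually_elim simp
qed

lemma L2_norm_proj:
  assumes S: "S \<subseteq> L2" and f: "f \<in> L2"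
  shows "L2_norm (L2_proj (orth S) f) \<le> L2_norm f"
proof -
  let ?p = "L2_proj (orth S) f"
  note p = L2_proj_props[OF S f]
  have o: "L2_inner ?p (\<lambda>z. f z - ?p z) = 0"
    using orthD[OF p(2) p(1)] L2_inner_cnj[of ?p "\<lambda>z. f z - ?p z"] by simp
  have "(L2_norm (\<lambda>z. ?p z + 1 * (f z - ?p z)))\<^sup>2 = (L2_norm ?p)\<^sup>2 + (L2_norm (\<lambda>z. f z - ?p z))\<^sup>2"
    using Lsp.nrm_square_add_scale[OF orth_L2[OF p(1)] orth_L2[OF p(2)], of 1] o by (simp add: L2_norm_eq)
  then have "(L2_norm ?p)\<^sup>2 \<le> (L2_norm f)\<^sup>2" by simp
  then show ?thesis by (rule power2_le_imp_le) simp
qed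

context
  fixes \<theta> \<alpha> \<phi> :: "complex \<Rightarrow> complex"
  assumes \<phi>: "\<phi> \<in> Linf"
begin

lemma dual_toeplitz_props:
  assumes "f \<in> L2"
  shows "dual_toeplitz \<theta> \<alpha> \<phi> f \<in> model_perp \<alpha>"
    "(\<lambda>z. \<phi> z * f z - dual_toeplitz \<theta> \<alpha> \<phi> f z) \<in> orth (model_perp \<alpha>)"
  using L2_proj_props[OF model_space_L2 Linf_mult_L2[OF \<phi> assms]]
  by (simp_all add: dual_toeplitz_def model_perp_orth)

text \<open>The operator is defined through a choice of representative; its values are identified,
  up to null sets, by this characterisation.\<close>

lemma dual_toeplitz_unique:
  assumes "f \<in> L2" "g \<in> model_perp \<alpha>" "(\<lambda>z. \<phi> z * f z - g z) \<in> orth (model_perp \<alpha>)"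
  shows "dual_toeplitz \<theta> \<alpha> \<phi> f \<doteq> g"
  using L2_proj_unique[OF model_space_L2 Linf_mult_L2[OF \<phi> assms(1)]] assms(2,3)
  by (simp add: dual_toeplitz_def model_perp_orth)

lemma dual_toeplitz_bounded_op: "bounded_op (dual_toeplitz \<theta> \<alpha> \<phi>) (model_perp \<theta>) (model_perp \<alpha>)"
  unfolding bounded_op_def
proof (intro conjI ballI allI)
  let ?D = "dual_toeplitz \<theta> \<alpha> \<phi>"
  have sub: "model_perp \<alpha> \<subseteq> L2" using model_perp_L2 by blast
  fix f assume f: "f \<in> model_perp \<theta>"
  note fL = model_perp_L2[OF f] and Df = dual_toeplitz_props[OF model_perp_L2[OF f]]
  show "?D f \<in> model_perp \<alpha>" by (rule Df)
  show "?D (\<lambda>z. c * f z) \<doteq> (\<lambda>z. c * ?D f z)" for c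
  proof (rule dual_toeplitz_unique)
    show "(\<lambda>z. \<phi> z * (c * f z) - c * ?D f z) \<in> orth (model_perp \<alpha>)"
      using orth_scale[OF sub Df(2), of c] by (simp add: algebra_simps)
  qed (intro L2_scale fL model_perp_closed Df)+
  fix g assume g: "g \<in> model_perp \<theta>"
  note gL = model_perp_L2[OF g] and Dg = dual_toeplitz_props[OF model_perp_L2[OF g]]
  show "?D (\<lambda>z. f z + g z) \<doteq> (\<lambda>z. ?D f z + ?D g z)"
  proof (rule dual_toeplitz_unique)
    show "(\<lambda>z. \<phi> z * (f z + g z) - (?D f z + ?D g z)) \<in> orth (model_perp \<alpha>)"
      using orth_add[OF sub Df(2) Dg(2)] by (simp add: algebra_simps)
  qed (intro L2_add_closed fL gL model_perp_closed Df Dg)+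
next
  obtain C where C: "C > 0" "AE z in circ. cmod (\<phi> z) \<le> C" using Linf_bound[OF \<phi>] by blast
  have "L2_norm (dual_toeplitz \<theta> \<alpha> \<phi> f) \<le> C * L2_norm f" if "f \<in> model_perp \<theta>" for f
  proof -
    note fL = model_perp_L2[OF that]
    have "L2_norm (dual_toeplitz \<theta> \<alpha> \<phi> f) \<le> L2_norm (\<lambda>z. \<phi> z * f z)"
      unfolding dual_toeplitz_def model_perp_orth by (rule L2_norm_proj[OF model_space_L2 Linf_mult_L2[OF \<phi> fL]])
    also have "\<dots> \<le> C * L2_norm f"
      using C by (intro L2_norm_mult_bounded fL Linf_measurable \<phi>) auto
    finally show ?thesis .
  qed
  then show "\<exists>C. \<forall>f\<in>model_perp \<theta>. L2_norm (dual_toeplitz \<theta> \<alpha> \<phi> f) \<le> C * L2_norm f" by blast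
qed

end

text \<open>A preimage with controlled norm is chosen for each g separately. The choice need not
  respect sums or multiples, but both sides of each linearity equation have the same image under T
  almost everywhere, so injectivity makes them equal almost everywhere.\<close>

lemma op_invertibleI:
  assumes T: "bounded_op T X Y" and inj: "op_injective T X"
    and X: "\<And>f g. f \<in> X \<Longrightarrow> g \<in> X \<Longrightarrow> (\<lambda>z. f z + g z) \<in> X" "\<And>c f. f \<in> X \<Longrightarrow> (\<lambda>z. c * f z) \<in> X" "X \<subseteq> L2"
    and Y: "\<And>f g. f \<in> Y \<Longrightarrow> g \<in> Y \<Longrightarrow> (\<lambda>z. f z + g z) \<in> Y" "\<And>c f. f \<in> Y \<Longrightarrow> (\<lambda>z. c * f z) \<in> Y"
    and surj: "\<And>g. g \<in> Y \<Longrightarrow> \<exists>f\<in>X. T f \<doteq> g \<and> L2_norm f \<le> C * L2_norm g"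
  shows "op_invertible T X Y"
proof -
  define S where "S g = (SOME f. f \<in> X \<and> T f \<doteq> g \<and> L2_norm f \<le> C * L2_norm g)" for g
  have S: "S g \<in> X" "T (S g) \<doteq> g" "L2_norm (S g) \<le> C * L2_norm g" if "g \<in> Y" for g
  proof -
    have "\<exists>f. f \<in> X \<and> T f \<doteq> g \<and> L2_norm f \<le> C * L2_norm g" using surj[OF that] by blast
    from someI_ex[OF this] show "S g \<in> X" "T (S g) \<doteq> g" "L2_norm (S g) \<le> C * L2_norm g"
      unfolding S_def by blast+
  qed
  have injD: "f \<doteq> g" if "f \<in> X" "g \<in> X" "T f \<doteq> T g" for f g
    using inj that unfolding op_injective_def by blast
  have T1: "T f \<in> Y" if "f \<in> X" for f using T that unfolding bounded_op_def by blast
  have T2: "T (\<lambda>z. f z + g z) \<doteq> (\<lambda>z. T f z + T g z)" if "f \<in> X" "g \<in> X" for f g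
    using T that unfolding bounded_op_def by blast
  have T3: "T (\<lambda>z. c * f z) \<doteq> (\<lambda>z. c * T f z)" if "f \<in> X" for f c
    using T that unfolding bounded_op_def by blast
  have "bounded_op S Y X"
    unfolding bounded_op_def
  proof (intro conjI ballI allI)
    fix f assume f: "f \<in> Y"
    show "S f \<in> X" by (rule S(1)[OF f])
    show "S (\<lambda>z. c * f z) \<doteq> (\<lambda>z. c * S f z)" for c
    proof (rule injD[OF S(1)[OF Y(2)[OF f]] X(2)[OF S(1)[OF f]]])
      show "T (S (\<lambda>z. c * f z)) \<doteq> T (\<lambda>z. c * S f z)"
        using S(2)[OF Y(2)[OF f, of c]] T3[OF S(1)[OF f], of c] S(2)[OF f]
        by eventually_elim simp
    qed
    fix g assume g: "g \<in> Y"
    show "S (\<lambda>z. f z + g z) \<doteq> (\<lambda>z. S f z + S g z)"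
    proof (rule injD[OF S(1)[OF Y(1)[OF f g]] X(1)[OF S(1)[OF f] S(1)[OF g]]])
      show "T (S (\<lambda>z. f z + g z)) \<doteq> T (\<lambda>z. S f z + S g z)"
        using S(2)[OF Y(1)[OF f g]] T2[OF S(1)[OF f] S(1)[OF g]] S(2)[OF f] S(2)[OF g]
        by eventually_elim simp
    qed
  next
    show "\<exists>C. \<forall>f\<in>Y. L2_norm (S f) \<le> C * L2_norm f" using S(3) by blast
  qed
  moreover have "S (T f) \<doteq> f" if "f \<in> X" for f
    by (rule injD[OF S(1)[OF T1[OF that]] that S(2)[OF T1[OF that]]])
  ultimately show ?thesis using T S(2) unfolding op_invertible_def by blast
qed

section \<open>The corona problem in the Hardy space\<close>

text \<open>On the circle \<open>cnj z\<close> is \<open>1 / z\<close>. Each further coefficient of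
  P divides the previous holomorphic part k by z, and this stays holomorphic because
  \<open>k 0 = 0\<close>. The same normalisation later puts the conjugate of k into
  \<open>HM\<close>.\<close>

lemma poly_cnj_decomposition:
  assumes h: "h holomorphic_on ball 0 r0" and r0: "0 < r0"
  shows "\<exists>k Q. k holomorphic_on ball 0 r0 \<and> k 0 = 0 \<and>
    (\<forall>z\<in>sphere 0 1. h z * cnj (poly P z) = k z + cnj (poly Q z))"
proof (induction P)
  case 0
  show ?case by (intro exI[of _ "\<lambda>z. 0"] exI[of _ 0]) auto
next
  case (pCons a P)
  then obtain k Q where k: "k holomorphic_on ball 0 r0" "k 0 = 0"
    and eq: "\<And>z. z \<in> sphere 0 1 \<Longrightarrow> h z * cnj (poly P z) = k z + cnj (poly Q z)" by blast
  define g where "g z = (if z = 0 then deriv k 0 else (k z - k 0) / (z - 0))" for z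
  have g: "g holomorphic_on ball 0 r0"
    unfolding g_def[abs_def] by (rule pole_lemma[OF k(1)]) (use r0 in simp)
  \<comment> \<open>The values at 0 of both new holomorphic parts are moved into the polynomial,
    which restores the normalisation.\<close>
  define k' where "k' z = cnj a * (h z - h 0) + (g z - g 0)" for z
  define Q' where "Q' = pCons (cnj (cnj a * h 0 + g 0)) Q"
  have "k' holomorphic_on ball 0 r0" unfolding k'_def[abs_def] by (intro holomorphic_intros h g)
  moreover have "k' 0 = 0" by (simp add: k'_def)
  moreover have "h z * cnj (poly (pCons a P) z) = k' z + cnj (poly Q' z)" if z: "z \<in> sphere 0 1" for z
  proof -
    have nz: "z \<noteq> 0" using z by auto
    have zc: "cnj z * z = 1" using z by (simp add: complex_norm_square[symmetric] mult.commute)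
    have "k z = z * g z" using nz k(2) by (simp add: g_def)
    then have gk: "cnj z * k z = g z" using zc by (metis mult.assoc mult.left_neutral)
    have "h z * cnj (poly (pCons a P) z) = cnj a * h z + cnj z * (h z * cnj (poly P z))"
      by (simp add: algebra_simps)
    also have "cnj z * (h z * cnj (poly P z)) = g z + cnj (z * poly Q z)"
      unfolding eq[OF z] using gk by (simp add: distrib_left)
    finally show ?thesis by (simp add: k'_def Q'_def algebra_simps)
  qed
  ultimately show ?case by blast
qed

text \<open>The constant results from the choice \<open>t = 1 / (2 (K + L))\<close> of the weight in the estimates below.\<close>

definition corona_const :: "real \<Rightarrow> real \<Rightarrow> real" where
  "corona_const \<epsilon> M = (let K = (M / \<epsilon>\<^sup>2 + 2 * M\<^sup>2 / \<epsilon> ^ 3) * (1 + 16 * M\<^sup>2); L = M / \<epsilon>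
     in 4 * (K + L) * (2 * M\<^sup>2 * K + L))"

text \<open>Here \<open>q1\<close> and \<open>q2\<close> play the part of the projections of
  \<open>cnj h1 p\<close> and \<open>cnj h2 p\<close>. Inserting \<open>D / D\<close> splits the
  squared modulus of p into F, with the holomorphic parts \<open>k1\<close>, \<open>k2\<close>, and
  E, with \<open>q1\<close>, \<open>q2\<close>. F is bounded by \<open>corona_estimate\<close>, E by
  size alone, and a small weight t absorbs what involves p.\<close>

lemma corona_lower_bound:
  fixes r0 \<epsilon> M :: real and h1 h2 p k1 k2 q1 q2 :: "complex \<Rightarrow> complex"
  assumes r0: "1 < r0" and \<epsilon>: "0 < \<epsilon>" and M0: "0 < M"
    and h: "h1 holomorphic_on ball 0 r0" "h2 holomorphic_on ball 0 r0"
    and M1: "\<And>z. z \<in> ball 0 r0 \<Longrightarrow> cmod (h1 z) \<le> M"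
    and M2: "\<And>z. z \<in> ball 0 r0 \<Longrightarrow> cmod (h2 z) \<le> M"
    and low: "\<And>z. z \<in> ball 0 r0 \<Longrightarrow> \<epsilon> \<le> (cmod (h1 z))\<^sup>2 + (cmod (h2 z))\<^sup>2"
    and p: "p holomorphic_on ball 0 r0"
    and k1: "k1 holomorphic_on ball 0 r0" "k1 0 = 0" and k2: "k2 holomorphic_on ball 0 r0" "k2 0 = 0"
    and q: "q1 \<in> L2" "q2 \<in> L2"
    and e1: "\<And>z. z \<in> sphere 0 1 \<Longrightarrow> h1 z * cnj (p z) = k1 z + cnj (q1 z)"
    and e2: "\<And>z. z \<in> sphere 0 1 \<Longrightarrow> h2 z * cnj (p z) = k2 z + cnj (q2 z)"
  shows "(L2_norm p)\<^sup>2 \<le> corona_const \<epsilon> M * ((L2_norm q1)\<^sup>2 + (L2_norm q2)\<^sup>2)"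
proof -
  define K where "K = (M / \<epsilon>\<^sup>2 + 2 * M\<^sup>2 / \<epsilon> ^ 3) * (1 + 16 * M\<^sup>2)"
  define L where "L = M / \<epsilon>"
  have K: "0 \<le> K" and L: "0 < L"
    using M0 \<epsilon> by (auto simp: K_def L_def)
  define t where "t = 1 / (2 * (K + L))"
  have t: "0 < t" using K L by (simp add: t_def add_nonneg_pos)
  have sub: "z \<in> ball 0 r0" if "z \<in> space circ" for z using that r0 by simp
  have scont: "f \<in> L2" if "f holomorphic_on ball 0 r0" for f
    using holo_cont(1)[OF r0 that] r0 by (intro L2_continuous) (auto elim!: continuous_on_subset)
  define D where "D z = h1 z * cnj (h1 z) + h2 z * cnj (h2 z)" for z
  have Dre: "D z = of_real ((cmod (h1 z))\<^sup>2 + (cmod (h2 z))\<^sup>2)" for z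
    by (simp only: D_def complex_norm_square of_real_add)
  have Dn: "\<epsilon> \<le> cmod (D z)" if "z \<in> space circ" for z
    unfolding Dre norm_of_real using low[OF sub[OF that]] by linarith
  define F where "F z = (cnj (h1 z) * k1 z + cnj (h2 z) * k2 z) * p z * inverse (D z)" for z
  define E where "E z = (cnj (h1 z) * cnj (q1 z) + cnj (h2 z) * cnj (q2 z)) * p z * inverse (D z)" for z
  have split: "of_real ((cmod (p z))\<^sup>2) = F z + E z" if z: "z \<in> space circ" for z
  proof -
    have nz: "D z \<noteq> 0" using Dn[OF z] \<epsilon> by auto
    have "F z + E z = (cnj (h1 z) * (k1 z + cnj (q1 z)) + cnj (h2 z) * (k2 z + cnj (q2 z))) * p z * inverse (D z)"
      by (simp add: F_def E_def algebra_simps)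
    also have "\<dots> = D z * (cnj (p z) * p z) * inverse (D z)"
    proof -
      have "k1 z + cnj (q1 z) = h1 z * cnj (p z)" "k2 z + cnj (q2 z) = h2 z * cnj (p z)"
        using e1[of z] e2[of z] z by simp_all
      then show ?thesis unfolding D_def by (simp only: distrib_left distrib_right mult_ac)
    qed
    also have "\<dots> = of_real ((cmod (p z))\<^sup>2)"
      unfolding complex_norm_square using nz by (simp add: mult.commute)
    finally show ?thesis by simp
  qed
  define \<kappa> where "\<kappa> z = h1 z * k2 z - h2 z * k1 z" for z
  have Pb: "integrable circ (\<lambda>z. (cmod (p z))\<^sup>2)" "integrable circ (\<lambda>z. (cmod (q1 z))\<^sup>2)" "integrable circ (\<lambda>z. (cmod (q2 z))\<^sup>2)"
    using scont[OF p] q L2_square_integrable by auto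
  have Eb: "cmod (E z) \<le> L * (t * (cmod (p z))\<^sup>2) + (L / t) * ((cmod (q1 z))\<^sup>2 + (cmod (q2 z))\<^sup>2)"
    if z: "z \<in> space circ" for z
  proof -
    have "cmod (cnj (h1 z) * cnj (q1 z) + cnj (h2 z) * cnj (q2 z)) \<le> M * (cmod (q1 z) + cmod (q2 z))"
      using M1[OF sub[OF z]] M2[OF sub[OF z]]
      by (intro order_trans[OF norm_triangle_ineq]) (auto simp: norm_mult distrib_left intro!: add_mono mult_right_mono)
    moreover have "cmod (inverse (D z)) \<le> 1 / \<epsilon>"
      using Dn[OF z] \<epsilon> unfolding norm_inverse by (simp add: inverse_eq_divide frac_le)
    ultimately have "cmod (E z) \<le> M * (cmod (q1 z) + cmod (q2 z)) * cmod (p z) * (1 / \<epsilon>)"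
      unfolding E_def norm_mult[of _ "inverse (D z)"] norm_mult[of _ "p z"]
      using M0 by (intro mult_mono) auto
    also have "\<dots> = L * (cmod (p z) * cmod (q1 z) + cmod (p z) * cmod (q2 z))"
      by (simp add: L_def algebra_simps)
    also have "\<dots> \<le> L * (t * (cmod (p z))\<^sup>2 + (1 / t) * ((cmod (q1 z))\<^sup>2 + (cmod (q2 z))\<^sup>2))"
    proof (rule mult_left_mono)
      have "0 \<le> (cmod (q1 z))\<^sup>2 / t" "0 \<le> (cmod (q2 z))\<^sup>2 / t" using t by auto
      then show "cmod (p z) * cmod (q1 z) + cmod (p z) * cmod (q2 z)
        \<le> t * (cmod (p z))\<^sup>2 + (1 / t) * ((cmod (q1 z))\<^sup>2 + (cmod (q2 z))\<^sup>2)"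
        using two_mult_le_weighted[OF t, of "cmod (p z)" "cmod (q1 z)"] two_mult_le_weighted[OF t, of "cmod (p z)" "cmod (q2 z)"]
        unfolding distrib_left[of "1 / t"] by simp
    qed (use L in simp)
    finally show ?thesis by (simp add: algebra_simps)
  qed
  have \<kappa>b: "(LINT z|circ. (cmod (\<kappa> z))\<^sup>2) \<le> 2 * M\<^sup>2 * ((L2_norm q1)\<^sup>2 + (L2_norm q2)\<^sup>2)"
  proof -
    have "(LINT z|circ. (cmod (\<kappa> z))\<^sup>2) \<le> (LINT z|circ. 2 * M\<^sup>2 * ((cmod (q1 z))\<^sup>2 + (cmod (q2 z))\<^sup>2))"
    proof (rule integral_mono')
      show "integrable circ (\<lambda>z. 2 * M\<^sup>2 * ((cmod (q1 z))\<^sup>2 + (cmod (q2 z))\<^sup>2))" using Pb by auto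
      fix z assume z: "z \<in> space circ"
      have k: "k1 z = h1 z * cnj (p z) - cnj (q1 z)" "k2 z = h2 z * cnj (p z) - cnj (q2 z)"
        using e1[of z] e2[of z] z by (auto simp: algebra_simps)
      \<comment> \<open>The terms with p cancel in the determinant, so on the circle \<kappa> is
        controlled by \<open>q1\<close> and \<open>q2\<close> alone.\<close>
      have "\<kappa> z = h2 z * cnj (q1 z) - h1 z * cnj (q2 z)"
        unfolding \<kappa>_def k by (simp add: algebra_simps)
      then have "cmod (\<kappa> z) \<le> cmod (h2 z) * cmod (q1 z) + cmod (h1 z) * cmod (q2 z)"
        using norm_triangle_ineq4[of "h2 z * cnj (q1 z)" "h1 z * cnj (q2 z)"] by (simp add: norm_mult)
      also have "\<dots> \<le> M * (cmod (q1 z) + cmod (q2 z))"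
        using M1[OF sub[OF z]] M2[OF sub[OF z]] unfolding distrib_left by (intro add_mono mult_right_mono) auto
      finally have "(cmod (\<kappa> z))\<^sup>2 \<le> (M * (cmod (q1 z) + cmod (q2 z)))\<^sup>2" by (intro power_mono) auto
      also have "\<dots> = M\<^sup>2 * (cmod (q1 z) + cmod (q2 z))\<^sup>2" by (simp add: power_mult_distrib)
      also have "\<dots> \<le> M\<^sup>2 * (2 * ((cmod (q1 z))\<^sup>2 + (cmod (q2 z))\<^sup>2))"
        using sum_squares_bound[of "cmod (q1 z)" "cmod (q2 z)"] by (intro mult_left_mono) (auto simp: power2_sum)
      finally show "(cmod (\<kappa> z))\<^sup>2 \<le> 2 * M\<^sup>2 * ((cmod (q1 z))\<^sup>2 + (cmod (q2 z))\<^sup>2)" by (simp add: algebra_simps)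
    qed auto
    then show ?thesis using Pb by (simp add: L2_norm_square)
  qed
  define S where "S = (L2_norm q1)\<^sup>2 + (L2_norm q2)\<^sup>2"
  define N where "N = (L2_norm p)\<^sup>2"
  have S0: "0 \<le> S" by (simp add: S_def)
  have Fb: "cmod (LINT z|circ. F z) \<le> K * (t * N + (2 * M\<^sup>2 * S) / t)"
  proof -
    have "cmod (LINT z|circ. F z) \<le> K * (t * (LINT z|circ. (cmod (p z))\<^sup>2) + (LINT z|circ. (cmod (\<kappa> z))\<^sup>2) / t)"
      unfolding F_def D_def K_def \<kappa>_def
      by (rule corona_estimate[OF r0 \<epsilon> less_imp_le[OF M0] h M1 M2 low p k1 k2 t])
    also have "\<dots> \<le> K * (t * N + (2 * M\<^sup>2 * S) / t)"
      unfolding N_def S_def L2_norm_square[of p]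
      using K t \<kappa>b by (intro mult_left_mono add_mono divide_right_mono) auto
    finally show ?thesis .
  qed
  have Fi: "integrable circ F"
  proof -
    have c: "continuous_on (sphere 0 1) f" if "f holomorphic_on ball 0 r0" for f
      using holo_cont(1)[OF r0 that] r0 by (auto elim!: continuous_on_subset)
    have Dnz: "h1 z * cnj (h1 z) + h2 z * cnj (h2 z) \<noteq> 0" if z: "z \<in> sphere 0 1" for z
    proof
      assume "h1 z * cnj (h1 z) + h2 z * cnj (h2 z) = 0"
      then have "cmod (D z) = 0" by (simp add: D_def)
      then show False using Dn[of z] z \<epsilon> by simp
    qed
    show ?thesis
      unfolding F_def D_def
      by (intro integrable_circ_continuous continuous_intros c[OF h(1)] c[OF h(2)] c[OF k1(1)] c[OF k2(1)] c[OF p])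
        (use Dnz in blast)
  qed
  have [measurable]: "h1 \<in> borel_measurable circ" "h2 \<in> borel_measurable circ" "p \<in> borel_measurable circ"
    "q1 \<in> borel_measurable circ" "q2 \<in> borel_measurable circ"
    using scont[OF h(1)] scont[OF h(2)] scont[OF p] q by (auto intro: L2_measurable)
  have "E \<in> borel_measurable circ"
    unfolding E_def[abs_def] D_def by measurable
  then have Ei: "integrable circ E"
  proof (rule Bochner_Integration.integrable_bound[rotated])
    show "AE z in circ. norm (E z) \<le> norm (L * (t * (cmod (p z))\<^sup>2) + (L / t) * ((cmod (q1 z))\<^sup>2 + (cmod (q2 z))\<^sup>2))"
      by (rule AE_I2) (use Eb in \<open>force intro: order_trans\<close>)
  qed (use Pb in simp)
  have "of_real N = (LINT z|circ. of_real ((cmod (p z))\<^sup>2) :: complex)"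
    unfolding N_def L2_norm_square by (rule integral_complex_of_real[symmetric])
  also have "\<dots> = (LINT z|circ. F z + E z)"
    by (rule Bochner_Integration.integral_cong[OF refl]) (rule split)
  also have "\<dots> = (LINT z|circ. F z) + (LINT z|circ. E z)" using Fi Ei by simp
  finally have "N \<le> cmod ((LINT z|circ. F z) + (LINT z|circ. E z))"
    by (metis abs_ge_self norm_of_real)
  also have "\<dots> \<le> K * (t * N + (2 * M\<^sup>2 * S) / t) + (LINT z|circ. L * (t * (cmod (p z))\<^sup>2) + (L / t) * ((cmod (q1 z))\<^sup>2 + (cmod (q2 z))\<^sup>2))"
    by (intro order_trans[OF norm_triangle_ineq] add_mono Fb Bochner_Integration.integral_norm_bound_integral Ei Eb)
       (simp add: Pb)
  also have "(LINT z|circ. L * (t * (cmod (p z))\<^sup>2) + (L / t) * ((cmod (q1 z))\<^sup>2 + (cmod (q2 z))\<^sup>2)) = L * (t * N) + (L / t) * S"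
    using Pb by (simp add: N_def S_def L2_norm_square)
  finally have "N \<le> (K + L) * t * N + (2 * M\<^sup>2 * K + L) * S / t"
    by (simp add: algebra_simps add_divide_distrib)
  \<comment> \<open>Half of N remains on the left after absorption.\<close>
  also have "(K + L) * t = 1 / 2" using K L by (simp add: t_def)
  finally have "N \<le> 2 * ((2 * M\<^sup>2 * K + L) * S / t)" by simp
  also have "\<dots> = corona_const \<epsilon> M * S"
    by (simp add: corona_const_def Let_def K_def[symmetric] L_def[symmetric] t_def)
  finally show ?thesis by (simp add: N_def S_def)
qed

section \<open>The Riesz projection, and density of the polynomials\<close>

definition hproj :: "(complex \<Rightarrow> complex) \<Rightarrow> complex \<Rightarrow> complex" where
  "hproj f = (SOME p. p \<in> HP \<and> (\<lambda>z. f z - p z) \<in> HM)"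

lemma hproj_props:
  assumes "f \<in> L2"
  shows "hproj f \<in> HP" "(\<lambda>z. f z - hproj f z) \<in> HM"
proof -
  obtain p m where "p \<in> HP" "m \<in> HM" "\<And>z. f z = p z + m z" using L2_decompose[OF assms] by metis
  then have "\<exists>p. p \<in> HP \<and> (\<lambda>z. f z - p z) \<in> HM" by (intro exI[of _ p]) simp
  from someI_ex[OF this] show "hproj f \<in> HP" "(\<lambda>z. f z - hproj f z) \<in> HM"
    unfolding hproj_def by blast+
qed

lemma hproj_unique:
  assumes "f \<in> L2" "p \<in> HP" "(\<lambda>z. f z - p z) \<in> HM"
  shows "hproj f \<doteq> p"
proof -
  have "(\<lambda>z. hproj f z - p z) \<in> HP" by (intro HP_closed hproj_props assms)
  moreover have "(\<lambda>z. (f z - p z) - (f z - hproj f z)) \<in> HM" by (intro HM_closed hproj_props assms)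
  ultimately have "(\<lambda>z. hproj f z - p z) \<doteq> (\<lambda>z. 0)" by (intro HP_HM_trivial) auto
  then show ?thesis by eventually_elim simp
qed

lemma hproj_inner:
  assumes f: "f \<in> L2" and g: "g \<in> HP"
  shows "L2_inner (hproj f) g = L2_inner f g"
proof -
  have "L2_inner (\<lambda>z. f z - hproj f z) g = L2_inner f g - L2_inner (hproj f) g"
    by (intro Lsp.form_diff f HP_L2 hproj_props g)
  then show ?thesis using HM_orth_HP[OF hproj_props(2)[OF f] g] by simp
qed

lemma hproj_add:
  assumes "f \<in> L2" "g \<in> L2"
  shows "hproj (\<lambda>z. f z + g z) \<doteq> (\<lambda>z. hproj f z + hproj g z)"
proof (rule hproj_unique)
  show "(\<lambda>z. f z + g z - (hproj f z + hproj g z)) \<in> HM"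
    using HM_closed(2)[OF hproj_props(2)[OF assms(1)] hproj_props(2)[OF assms(2)]] by (simp add: algebra_simps)
qed (intro L2_add_closed HP_closed hproj_props assms)+

lemma hproj_scale:
  assumes "f \<in> L2"
  shows "hproj (\<lambda>z. c * f z) \<doteq> (\<lambda>z. c * hproj f z)"
proof (rule hproj_unique)
  show "(\<lambda>z. c * f z - c * hproj f z) \<in> HM"
    using HM_closed(4)[OF hproj_props(2)[OF assms], of c] by (simp add: algebra_simps)
qed (intro L2_scale HP_closed hproj_props assms)+

lemma hproj_norm:
  assumes f: "f \<in> L2"
  shows "L2_norm (hproj f) \<le> L2_norm f"
proof -
  obtain p m where p: "p \<in> HP" "m \<in> HM" "\<And>z. f z = p z + m z" "L2_norm p \<le> L2_norm f"
    using L2_decompose[OF f] by metis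
  have "hproj f \<doteq> p" using p by (intro hproj_unique f) auto
  then show ?thesis using L2_norm_cong[OF HP_L2[OF hproj_props(1)[OF f]] HP_L2[OF p(1)]] p(4) by simp
qed

lemma hproj_norm_diff:
  assumes f: "f \<in> L2" and g: "g \<in> L2"
  shows "L2_norm (hproj f) \<le> L2_norm (hproj g) + L2_norm (\<lambda>z. f z - g z)"
proof -
  have d: "(\<lambda>z. f z - g z) \<in> L2" using f g by (rule L2_diff)
  have "hproj (\<lambda>z. g z + (f z - g z)) \<doteq> (\<lambda>z. hproj g z + hproj (\<lambda>z. f z - g z) z)" by (rule hproj_add[OF g d])
  then have "hproj f \<doteq> (\<lambda>z. hproj g z + hproj (\<lambda>z. f z - g z) z)" by simp
  then have "L2_norm (hproj f) = L2_norm (\<lambda>z. hproj g z + hproj (\<lambda>z. f z - g z) z)"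
    by (intro L2_norm_cong HP_L2 HP_closed hproj_props f g d)
  also have "\<dots> \<le> L2_norm (hproj g) + L2_norm (hproj (\<lambda>z. f z - g z))"
    by (intro L2_norm_triangle HP_L2 hproj_props g d)
  also have "L2_norm (hproj (\<lambda>z. f z - g z)) \<le> L2_norm (\<lambda>z. f z - g z)" by (rule hproj_norm[OF d])
  finally show ?thesis by simp
qed

lemma poly_HP: "poly P \<in> HP"
proof (induction P)
  case 0
  have "poly 0 = (\<lambda>z::complex. 0)" by (simp add: fun_eq_iff)
  then show ?case using HP_closed(1) by metis
next
  case (pCons a P)
  have "(\<lambda>z. a * z ^ 0 + z ^ 1 * poly P z) \<in> HP"
    by (intro HP_closed char_HP Hinf_mult_HP[OF Hinf_char] pCons)
  moreover have "poly (pCons a P) = (\<lambda>z. a * z ^ 0 + z ^ 1 * poly P z)" by (simp add: fun_eq_iff)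
  ultimately show ?case by metis
qed

text \<open>The closure V of the polynomials in \<open>HP\<close> is complete, so f has a projection
  g in V. The difference is orthogonal to all powers of z, hence in \<open>HM\<close> as well as in
  \<open>HP\<close>, and so it is null.\<close>

lemma poly_dense_HP:
  assumes f: "f \<in> HP" and e: "0 < e"
  shows "\<exists>P. L2_norm (\<lambda>z. f z - poly P z) < e"
proof -
  define V where "V = {f \<in> HP. \<forall>e>0. \<exists>P. L2_norm (\<lambda>z. f z - poly P z) < e}"
  have VHP: "V \<subseteq> HP" by (auto simp: V_def)
  then have VL: "V \<subseteq> L2" using HP_L2 by blast
  have pL: "poly P \<in> L2" for P by (rule HP_L2[OF poly_HP])
  have V_approx: "\<exists>P. L2_norm (\<lambda>z. f z - poly P z) < e" if "f \<in> V" "0 < e" for f e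
    using that unfolding V_def by blast
  have poly_V: "poly P \<in> V" for P
    unfolding V_def using poly_HP
    by (auto intro!: exI[of _ P] simp: L2_norm_def)
  interpret V: semi_inner V L2_inner
  proof (rule semi_inner_subspace[OF VL])
    show "(\<lambda>z. 0) \<in> V"
    proof -
      have "poly 0 = (\<lambda>z::complex. 0)" by (simp add: fun_eq_iff)
      then show ?thesis using poly_V[of 0] by metis
    qed
    fix f g assume fg: "f \<in> V" "g \<in> V"
    have "\<exists>P. L2_norm (\<lambda>z. f z + g z - poly P z) < e" if "0 < e" for e
    proof -
      obtain P Q where P: "L2_norm (\<lambda>z. f z - poly P z) < e / 2" and Q: "L2_norm (\<lambda>z. g z - poly Q z) < e / 2"
        using V_approx[OF fg(1), of "e / 2"] V_approx[OF fg(2), of "e / 2"] \<open>0 < e\<close> by auto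
      have "L2_norm (\<lambda>z. (f z - poly P z) + (g z - poly Q z)) \<le> L2_norm (\<lambda>z. f z - poly P z) + L2_norm (\<lambda>z. g z - poly Q z)"
        using fg VL pL by (intro L2_norm_triangle L2_diff) auto
      then have "L2_norm (\<lambda>z. f z + g z - poly (P + Q) z) < e" using P Q by (simp add: algebra_simps)
      then show ?thesis by blast
    qed
    then show "(\<lambda>z. f z + g z) \<in> V" using fg VHP HP_closed(2) unfolding V_def by blast
  next
    fix f c assume f: "f \<in> V"
    have "\<exists>P. L2_norm (\<lambda>z. c * f z - poly P z) < e" if "0 < e" for e
    proof -
      have "0 < e / (cmod c + 1)" using \<open>0 < e\<close> by (simp add: add_nonneg_pos)
      then obtain P where P: "L2_norm (\<lambda>z. f z - poly P z) < e / (cmod c + 1)"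
        using f unfolding V_def by blast
      have "L2_norm (\<lambda>z. c * (f z - poly P z)) = cmod c * L2_norm (\<lambda>z. f z - poly P z)"
        using f VL pL by (intro L2_norm_scale L2_diff) auto
      also have "\<dots> \<le> (cmod c + 1) * L2_norm (\<lambda>z. f z - poly P z)" by (intro mult_right_mono) auto
      also have "\<dots> < e" using P by (simp add: pos_less_divide_eq add_nonneg_pos mult.commute)
      finally have "L2_norm (\<lambda>z. c * f z - poly (smult c P) z) < e" by (simp add: algebra_simps)
      then show ?thesis by blast
    qed
    then show "(\<lambda>z. c * f z) \<in> V" using f VHP HP_closed(4) unfolding V_def by blast
  qed
  have nrm: "V.nrm h = L2_norm h" for h by (simp add: V.nrm_def L2_norm_eq Lsp.nrm_def)
  have fL: "f \<in> L2" using f by (rule HP_L2)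
  have "\<exists>p\<in>V. \<forall>q\<in>V. L2_inner q f = L2_inner q p"
  proof (rule V.riesz_representation)
    fix X :: "nat \<Rightarrow> complex \<Rightarrow> complex"
    assume X: "\<And>n. X n \<in> V" and C: "\<And>e. 0 < e \<Longrightarrow> \<exists>N. \<forall>m\<ge>N. \<forall>n\<ge>N. V.nrm (\<lambda>z. X m z - X n z) < e"
    obtain l where l: "l \<in> HP" and lim: "(\<lambda>n. L2_norm (\<lambda>z. X n z - l z)) \<longlonglongrightarrow> 0"
      using orth_complete[OF chars_L2(2), of X] X VHP C unfolding nrm HP_def[symmetric] by blast
    have "\<exists>P. L2_norm (\<lambda>z. l z - poly P z) < e" if "0 < e" for e
    proof -
      have "eventually (\<lambda>n. L2_norm (\<lambda>z. X n z - l z) < e / 2) sequentially"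
        using lim \<open>0 < e\<close> by (intro order_tendstoD) auto
      then obtain n where n: "L2_norm (\<lambda>z. X n z - l z) < e / 2" by (auto simp: eventually_sequentially)
      obtain P where P: "L2_norm (\<lambda>z. X n z - poly P z) < e / 2"
        using V_approx[OF X[of n], of "e / 2"] \<open>0 < e\<close> by auto
      have "L2_norm (\<lambda>z. (X n z - poly P z) - (X n z - l z)) \<le> L2_norm (\<lambda>z. X n z - poly P z) + L2_norm (\<lambda>z. X n z - l z)"
        using X VL pL HP_L2[OF l] by (intro L2_norm_diff L2_diff) auto
      then show ?thesis using n P by (intro exI[of _ P]) simp
    qed
    then have "l \<in> V" using l by (simp add: V_def)
    then show "\<exists>l\<in>V. (\<lambda>n. V.nrm (\<lambda>z. X n z - l z)) \<longlonglongrightarrow> 0" using lim unfolding nrm by blast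
  next
    show "cmod (L2_inner h f) \<le> L2_norm f * V.nrm h" if "h \<in> V" for h
      using L2_Cauchy_Schwarz[of h f] VL that fL by (auto simp: nrm mult.commute)
  qed (use fL VL in \<open>auto simp: Lsp.form_add Lsp.form_scale subset_iff\<close>)
  then obtain g where g: "g \<in> V" "\<And>q. q \<in> V \<Longrightarrow> L2_inner q f = L2_inner q g" by blast
  have gHP: "g \<in> HP" using g VHP by blast
  have d: "(\<lambda>z. f z - g z) \<in> HP" by (intro HP_closed f gHP)
  have "L2_inner (\<lambda>z. f z - g z) (\<lambda>z. z ^ n) = 0" for n
  proof -
    have "(\<lambda>z::complex. z ^ n) = poly (monom 1 n)" by (simp add: fun_eq_iff poly_monom)
    then have "L2_inner (\<lambda>z. z ^ n) f = L2_inner (\<lambda>z. z ^ n) g" using g(2)[OF poly_V[of "monom 1 n"]] by simp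
    then have "L2_inner (\<lambda>z. z ^ n) (\<lambda>z. f z - g z) = 0"
      using Lsp.form_diff_right[OF fL HP_L2[OF gHP] HP_L2[OF char_HP]] by simp
    then show ?thesis using L2_inner_cnj[of "\<lambda>z. f z - g z" "\<lambda>z. z ^ n"] by simp
  qed
  then have "(\<lambda>z. f z - g z) \<in> HM" using HP_L2[OF d] by (auto simp: HM_def orth_def pos_chars_def)
  then have z: "(\<lambda>z. f z - g z) \<doteq> (\<lambda>z. 0)" using d by (intro HP_HM_trivial)
  obtain P where P: "L2_norm (\<lambda>z. g z - poly P z) < e" using g(1) e unfolding V_def by blast
  have "L2_norm (\<lambda>z. f z - poly P z) = L2_norm (\<lambda>z. g z - poly P z)"
  proof (rule L2_norm_cong)
    show "(\<lambda>z. f z - poly P z) \<doteq> (\<lambda>z. g z - poly P z)" using z by eventually_elim simp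
  qed (intro L2_diff fL pL HP_L2[OF gHP])+
  then show ?thesis using P by metis
qed


section \<open>Passage from dilated data to the given corona pair\<close>

lemma CP_plusE:
  assumes "(h1, h2) \<in> CP_plus"
  obtains H1 H2 \<epsilon> M where "Hinf_extension H1 h1" "Hinf_extension H2 h2" "0 < \<epsilon>" "0 < M"
    "\<And>z. z \<in> ball 0 1 \<Longrightarrow> \<epsilon> \<le> (cmod (H1 z))\<^sup>2 + (cmod (H2 z))\<^sup>2"
    "\<And>z. z \<in> ball 0 1 \<Longrightarrow> cmod (H1 z) \<le> M" "\<And>z. z \<in> ball 0 1 \<Longrightarrow> cmod (H2 z) \<le> M"
proof -
  obtain H1 H2 where H: "Hinf_extension H1 h1" "Hinf_extension H2 h2"
    and pos: "0 < (INF z\<in>ball 0 1. cmod (H1 z) + cmod (H2 z))"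
    using assms by (auto simp: CP_plus_def)
  define \<delta> where "\<delta> = (INF z\<in>ball 0 1. cmod (H1 z) + cmod (H2 z))"
  have low: "\<delta>\<^sup>2 / 2 \<le> (cmod (H1 z))\<^sup>2 + (cmod (H2 z))\<^sup>2" if z: "z \<in> ball 0 1" for z
  proof -
    have "\<delta> \<le> cmod (H1 z) + cmod (H2 z)"
      unfolding \<delta>_def by (rule cINF_lower[OF _ z]) (auto intro!: bdd_belowI2[of _ 0])
    then have "\<delta>\<^sup>2 \<le> (cmod (H1 z) + cmod (H2 z))\<^sup>2"
      using pos by (intro power_mono) (auto simp: \<delta>_def)
    then show ?thesis using sum_squares_bound[of "cmod (H1 z)" "cmod (H2 z)"] by (simp add: power2_sum)
  qed
  obtain M1 where M1: "\<forall>x\<in>H1 ` ball 0 1. cmod x \<le> M1" using H(1) unfolding Hinf_extension_def bounded_iff by blast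
  obtain M2 where M2: "\<forall>x\<in>H2 ` ball 0 1. cmod x \<le> M2" using H(2) unfolding Hinf_extension_def bounded_iff by blast
  show ?thesis
    by (rule that[OF H, of "\<delta>\<^sup>2 / 2" "max 1 (max M1 M2)"])
       (use pos low M1 M2 in \<open>auto simp: \<delta>_def le_max_iff_disj\<close>)
qed

lemma CP_plus_Hinf: "(h1, h2) \<in> CP_plus \<Longrightarrow> h1 \<in> Hinf" "(h1, h2) \<in> CP_plus \<Longrightarrow> h2 \<in> Hinf"
  by (auto simp: CP_plus_def)

text \<open>Radial limits carry the lower bound to the circle, where it permits pointwise
  division.\<close>

lemma CP_plus_boundary:
  assumes cp: "(h1, h2) \<in> CP_plus"
  shows "\<exists>\<epsilon>>0. AE z in circ. \<epsilon> \<le> (cmod (h1 z))\<^sup>2 + (cmod (h2 z))\<^sup>2"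
proof -
  obtain H1 H2 \<epsilon> M where H: "Hinf_extension H1 h1" "Hinf_extension H2 h2" and \<epsilon>: "0 < \<epsilon>"
    and low: "\<And>z. z \<in> ball 0 1 \<Longrightarrow> \<epsilon> \<le> (cmod (H1 z))\<^sup>2 + (cmod (H2 z))\<^sup>2"
    using CP_plusE[OF cp] by metis
  have "AE z in circ. (\<lambda>k. H1 (of_real (rad k) * z)) \<longlonglongrightarrow> h1 z"
    "AE z in circ. (\<lambda>k. H2 (of_real (rad k) * z)) \<longlonglongrightarrow> h2 z"
    using H by (auto intro: bdry_int_rad simp: Hinf_extension_def)
  then have "AE z in circ. \<epsilon> \<le> (cmod (h1 z))\<^sup>2 + (cmod (h2 z))\<^sup>2"
    using AE_space
  proof eventually_elim
    fix z assume l: "(\<lambda>k. H1 (of_real (rad k) * z)) \<longlonglongrightarrow> h1 z" "(\<lambda>k. H2 (of_real (rad k) * z)) \<longlonglongrightarrow> h2 z"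
      and z: "z \<in> space circ"
    have "(\<lambda>k. (cmod (H1 (of_real (rad k) * z)))\<^sup>2 + (cmod (H2 (of_real (rad k) * z)))\<^sup>2)
        \<longlonglongrightarrow> (cmod (h1 z))\<^sup>2 + (cmod (h2 z))\<^sup>2" by (intro tendsto_intros l)
    then show "\<epsilon> \<le> (cmod (h1 z))\<^sup>2 + (cmod (h2 z))\<^sup>2"
      by (rule LIMSEQ_le_const) (use low[OF rad_ball[OF z]] in auto)
  qed
  then show ?thesis using \<epsilon> by blast
qed

text \<open>The dilates converge only almost everywhere, but multiplied by a fixed square integrable
  f they are dominated.\<close>

lemma dilate_mult_tendsto:
  assumes H: "Hinf_extension H h" and M: "\<And>z. z \<in> ball 0 1 \<Longrightarrow> cmod (H z) \<le> M"
    and h: "h \<in> Hinf" and f: "f \<in> L2"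
  shows "(\<lambda>k. L2_norm (\<lambda>z. cnj (H (of_real (rad k) * z)) * f z - cnj (h z) * f z)) \<longlonglongrightarrow> 0"
proof -
  obtain C where C: "AE z in circ. cmod (h z) \<le> C" using HinfE[OF h] by metis
  have [measurable]: "h \<in> borel_measurable circ" "f \<in> borel_measurable circ"
    using h f by (auto intro: Hinf_measurable L2_measurable)
  have [measurable]: "(\<lambda>z. H (of_real (rad k) * z)) \<in> borel_measurable circ" for k
    using H by (intro circ_measurable_continuous rad_dilate_continuous) (simp add: Hinf_extension_def)
  have "(\<lambda>k. LINT z|circ. (cmod (cnj (H (of_real (rad k) * z)) * f z - cnj (h z) * f z))\<^sup>2) \<longlonglongrightarrow> (LINT z|circ. 0)"
  proof (rule integral_dominated_convergence[where w = "\<lambda>z. (M + C)\<^sup>2 * (cmod (f z))\<^sup>2"])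
    have "AE z in circ. (\<lambda>k. H (of_real (rad k) * z)) \<longlonglongrightarrow> h z"
      using H by (intro bdry_int_rad) (simp add: Hinf_extension_def)
    then show "AE z in circ. (\<lambda>k. (cmod (cnj (H (of_real (rad k) * z)) * f z - cnj (h z) * f z))\<^sup>2) \<longlonglongrightarrow> 0"
    proof eventually_elim
      fix z assume "(\<lambda>k. H (of_real (rad k) * z)) \<longlonglongrightarrow> h z"
      then have "(\<lambda>k. (cmod (cnj (H (of_real (rad k) * z)) * f z - cnj (h z) * f z))\<^sup>2)
          \<longlonglongrightarrow> (cmod (cnj (h z) * f z - cnj (h z) * f z))\<^sup>2" by (intro tendsto_intros)
      then show "(\<lambda>k. (cmod (cnj (H (of_real (rad k) * z)) * f z - cnj (h z) * f z))\<^sup>2) \<longlonglongrightarrow> 0" by simp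
    qed
    show "AE z in circ. norm ((cmod (cnj (H (of_real (rad k) * z)) * f z - cnj (h z) * f z))\<^sup>2) \<le> (M + C)\<^sup>2 * (cmod (f z))\<^sup>2" for k
      using C AE_space
    proof eventually_elim
      fix z assume c: "cmod (h z) \<le> C" and z: "z \<in> space circ"
      have "cmod (cnj (H (of_real (rad k) * z)) * f z - cnj (h z) * f z) \<le> (M + C) * cmod (f z)"
      proof -
        have "cmod (cnj (H (of_real (rad k) * z)) - cnj (h z)) \<le> M + C"
          using norm_triangle_ineq4[of "cnj (H (of_real (rad k) * z))" "cnj (h z)"] c M[OF rad_ball[OF z], of k] by simp
        then show ?thesis by (simp add: left_diff_distrib[symmetric] norm_mult mult_right_mono)
      qed
      then have "(cmod (cnj (H (of_real (rad k) * z)) * f z - cnj (h z) * f z))\<^sup>2 \<le> ((M + C) * cmod (f z))\<^sup>2"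
        by (intro power_mono) auto
      then show "norm ((cmod (cnj (H (of_real (rad k) * z)) * f z - cnj (h z) * f z))\<^sup>2) \<le> (M + C)\<^sup>2 * (cmod (f z))\<^sup>2"
        by (simp add: power_mult_distrib)
    qed
  qed (use f in \<open>auto simp: L2_square_integrable\<close>)
  then have "(\<lambda>k. sqrt (LINT z|circ. (cmod (cnj (H (of_real (rad k) * z)) * f z - cnj (h z) * f z))\<^sup>2)) \<longlonglongrightarrow> sqrt 0"
    by (intro tendsto_real_sqrt) simp
  then show ?thesis by (simp add: L2_norm_def)
qed

text \<open>For the dilated pair and polynomial p the data are holomorphic beyond the closed disk.
  The bounds \<epsilon> and M are the same for every dilate, so the constant survives the limit, and
  the projection is continuous.\<close>

lemma corona_lower_bound_poly:
  assumes cp: "(h1, h2) \<in> CP_plus"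
  shows "\<exists>C\<ge>0. \<forall>P. (L2_norm (poly P))\<^sup>2 \<le> C * ((L2_norm (hproj (\<lambda>z. cnj (h1 z) * poly P z)))\<^sup>2
     + (L2_norm (hproj (\<lambda>z. cnj (h2 z) * poly P z)))\<^sup>2)"
proof -
  obtain H1 H2 \<epsilon> M where H: "Hinf_extension H1 h1" "Hinf_extension H2 h2" and pos: "0 < \<epsilon>" "0 < M"
    and low: "\<And>z. z \<in> ball 0 1 \<Longrightarrow> \<epsilon> \<le> (cmod (H1 z))\<^sup>2 + (cmod (H2 z))\<^sup>2"
    and M: "\<And>z. z \<in> ball 0 1 \<Longrightarrow> cmod (H1 z) \<le> M" "\<And>z. z \<in> ball 0 1 \<Longrightarrow> cmod (H2 z) \<le> M"
    using CP_plusE[OF cp] by metis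
  note h = CP_plus_Hinf[OF cp]
  have hol: "H1 holomorphic_on ball 0 1" "H2 holomorphic_on ball 0 1"
    using H by (auto simp: Hinf_extension_def)
  have C0: "0 \<le> corona_const \<epsilon> M" using pos by (simp add: corona_const_def Let_def)
  have step: "(L2_norm (poly P))\<^sup>2 \<le> corona_const \<epsilon> M * ((L2_norm (hproj (\<lambda>z. cnj (H1 (of_real (rad n) * z)) * poly P z)))\<^sup>2
     + (L2_norm (hproj (\<lambda>z. cnj (H2 (of_real (rad n) * z)) * poly P z)))\<^sup>2)" for P n
  proof -
    define r0 where "r0 = 1 / rad n"
    have r0: "1 < r0" using rad_bounds[of n] by (simp add: r0_def)
    define g1 where "g1 z = H1 (of_real (rad n) * z)" for z
    define g2 where "g2 z = H2 (of_real (rad n) * z)" for z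
    have g: "g1 holomorphic_on ball 0 r0" "g2 holomorphic_on ball 0 r0"
      unfolding g1_def[abs_def] g2_def[abs_def] r0_def by (intro rad_dilate_holomorphic hol)+
    have in_ball: "of_real (rad n) * z \<in> ball 0 1" if "z \<in> ball 0 r0" for z :: complex
      using that rad_bounds[of n] by (simp add: r0_def dist_norm norm_mult field_simps)
    obtain k1 Q1 where k1: "k1 holomorphic_on ball 0 r0" "k1 0 = 0"
      and e1: "\<And>z. z \<in> sphere 0 1 \<Longrightarrow> g1 z * cnj (poly P z) = k1 z + cnj (poly Q1 z)"
      using poly_cnj_decomposition[OF g(1), of P] r0 by auto
    obtain k2 Q2 where k2: "k2 holomorphic_on ball 0 r0" "k2 0 = 0"
      and e2: "\<And>z. z \<in> sphere 0 1 \<Longrightarrow> g2 z * cnj (poly P z) = k2 z + cnj (poly Q2 z)"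
      using poly_cnj_decomposition[OF g(2), of P] r0 by auto
    have pL: "poly Q \<in> L2" for Q by (rule HP_L2[OF poly_HP])
    have scont: "f \<in> L2" if "f holomorphic_on ball 0 r0" for f
      using holo_cont(1)[OF r0 that] r0 by (intro L2_continuous) (auto elim!: continuous_on_subset)
    \<comment> \<open>The polynomial part of the decomposition is the projection of
      \<open>cnj g P\<close>, because the rest is the conjugate of a holomorphic function vanishing
      at 0 and so lies in \<open>HM\<close>.\<close>
    have key: "L2_norm (hproj (\<lambda>z. cnj (g z) * poly P z)) = L2_norm (poly Q)"
      if g: "g holomorphic_on ball 0 r0" and k: "k holomorphic_on ball 0 r0" "k 0 = 0"
        and e: "\<And>z. z \<in> sphere 0 1 \<Longrightarrow> g z * cnj (poly P z) = k z + cnj (poly Q z)" for g k Q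
    proof -
      have gL: "(\<lambda>z. cnj (g z) * poly P z) \<in> L2"
        using holo_cont(1)[OF r0 g] r0
        by (intro L2_continuous continuous_intros) (auto elim!: continuous_on_subset)
      have eq: "cnj (g z) * poly P z - poly Q z = cnj (k z)" if "z \<in> space circ" for z
      proof -
        have "cnj (g z * cnj (poly P z)) = cnj (k z + cnj (poly Q z))" using e[of z] that by simp
        then show ?thesis by simp
      qed
      have "(\<lambda>z. cnj (k z)) \<in> HM"
      proof -
        have "(LINT z|circ. cnj (k z) * cnj z ^ n) = 0" for n
        proof -
          have "(LINT z|circ. cnj (k z) * cnj z ^ n) = (LINT z|circ. cnj (k z * z ^ n))" by simp
          also have "\<dots> = cnj (LINT z|circ. k z * z ^ n)" by (rule Bochner_Integration.integral_cnj)
          also have "(LINT z|circ. k z * z ^ n) = k 0 * 0 ^ n"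
            by (rule circle_mean_one[OF _ r0]) (intro holomorphic_intros k)
          finally show ?thesis using k by simp
        qed
        then show ?thesis using L2_cnj[OF scont[OF k(1)]] by (simp add: HM_iff)
      qed
      then have "(\<lambda>z. cnj (g z) * poly P z - poly Q z) \<in> HM"
      proof (rule HM_cong)
        show "(\<lambda>z. cnj (k z)) \<doteq> (\<lambda>z. cnj (g z) * poly P z - poly Q z)"
          by (rule AE_I2) (simp only: eq)
      qed (intro L2_measurable L2_diff gL pL)
      then have "hproj (\<lambda>z. cnj (g z) * poly P z) \<doteq> poly Q" by (intro hproj_unique gL poly_HP)
      then show ?thesis by (intro L2_norm_cong HP_L2 hproj_props gL poly_HP)
    qed
    have "(L2_norm (poly P))\<^sup>2 \<le> corona_const \<epsilon> M * ((L2_norm (poly Q1))\<^sup>2 + (L2_norm (poly Q2))\<^sup>2)"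
    proof (rule corona_lower_bound[OF r0 pos g _ _ _ _ k1 k2 pL pL e1 e2])
      fix z :: complex assume z: "z \<in> ball 0 r0"
      show "cmod (g1 z) \<le> M" "cmod (g2 z) \<le> M" "\<epsilon> \<le> (cmod (g1 z))\<^sup>2 + (cmod (g2 z))\<^sup>2"
        unfolding g1_def g2_def using M low in_ball[OF z] by blast+
    qed (intro holomorphic_intros)
    then show ?thesis
      using key[OF g(1) k1 e1] key[OF g(2) k2 e2] by (simp add: g1_def g2_def)
  qed
  have "(L2_norm (poly P))\<^sup>2 \<le> corona_const \<epsilon> M * ((L2_norm (hproj (\<lambda>z. cnj (h1 z) * poly P z)))\<^sup>2
     + (L2_norm (hproj (\<lambda>z. cnj (h2 z) * poly P z)))\<^sup>2)" for P
  proof -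
    have pL: "poly P \<in> L2" by (rule HP_L2[OF poly_HP])
    define d1 where "d1 n = L2_norm (\<lambda>z. cnj (H1 (of_real (rad n) * z)) * poly P z - cnj (h1 z) * poly P z)" for n
    define d2 where "d2 n = L2_norm (\<lambda>z. cnj (H2 (of_real (rad n) * z)) * poly P z - cnj (h2 z) * poly P z)" for n
    let ?a = "L2_norm (hproj (\<lambda>z. cnj (h1 z) * poly P z))" and ?b = "L2_norm (hproj (\<lambda>z. cnj (h2 z) * poly P z))"
    have lim: "d1 \<longlonglongrightarrow> 0" "d2 \<longlonglongrightarrow> 0"
      unfolding d1_def[abs_def] d2_def[abs_def]
      using dilate_mult_tendsto[OF H(1) M(1) h(1) pL] dilate_mult_tendsto[OF H(2) M(2) h(2) pL] by blast+
    have "(L2_norm (poly P))\<^sup>2 \<le> corona_const \<epsilon> M * ((?a + d1 n)\<^sup>2 + (?b + d2 n)\<^sup>2)" for n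
    proof -
      have dL: "(\<lambda>z. cnj (F (of_real (rad n) * z)) * poly P z) \<in> L2" if "F holomorphic_on ball 0 1" for F
        by (intro L2_continuous continuous_intros rad_dilate_continuous that)
      have "L2_norm (hproj (\<lambda>z. cnj (H1 (of_real (rad n) * z)) * poly P z)) \<le> ?a + d1 n"
        "L2_norm (hproj (\<lambda>z. cnj (H2 (of_real (rad n) * z)) * poly P z)) \<le> ?b + d2 n"
        unfolding d1_def d2_def by (intro hproj_norm_diff dL hol cnj_Hinf_mult_L2 h pL)+
      then have "(L2_norm (hproj (\<lambda>z. cnj (H1 (of_real (rad n) * z)) * poly P z)))\<^sup>2 + (L2_norm (hproj (\<lambda>z. cnj (H2 (of_real (rad n) * z)) * poly P z)))\<^sup>2
         \<le> (?a + d1 n)\<^sup>2 + (?b + d2 n)\<^sup>2"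
        by (intro add_mono power_mono) auto
      then show ?thesis using step[of P n] C0 by (meson mult_left_mono order_trans)
    qed
    moreover have "(\<lambda>n. corona_const \<epsilon> M * ((?a + d1 n)\<^sup>2 + (?b + d2 n)\<^sup>2)) \<longlonglongrightarrow> corona_const \<epsilon> M * ((?a + 0)\<^sup>2 + (?b + 0)\<^sup>2)"
      by (intro tendsto_intros lim)
    ultimately have "(L2_norm (poly P))\<^sup>2 \<le> corona_const \<epsilon> M * ((?a + 0)\<^sup>2 + (?b + 0)\<^sup>2)"
      by (intro LIMSEQ_le_const[of _ "corona_const \<epsilon> M * ((?a + 0)\<^sup>2 + (?b + 0)\<^sup>2)"]) auto
    then show ?thesis by simp
  qed
  then show ?thesis using C0 by blast
qed


text \<open>Approximation by polynomials. The bound is first put into terms of norms instead of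
  squares, so that errors simply add.\<close>

lemma corona_lower_bound_HP:
  assumes cp: "(h1, h2) \<in> CP_plus"
  shows "\<exists>c\<ge>0. \<forall>p\<in>HP. L2_norm p \<le> c * (L2_norm (hproj (\<lambda>z. cnj (h1 z) * p z))
     + L2_norm (hproj (\<lambda>z. cnj (h2 z) * p z)))"
proof -
  note h = CP_plus_Hinf[OF cp]
  obtain C where C0: "0 \<le> C" and C: "\<And>P. (L2_norm (poly P))\<^sup>2 \<le> C * ((L2_norm (hproj (\<lambda>z. cnj (h1 z) * poly P z)))\<^sup>2
     + (L2_norm (hproj (\<lambda>z. cnj (h2 z) * poly P z)))\<^sup>2)"
    using corona_lower_bound_poly[OF cp] by blast
  define c where "c = sqrt C"
  have c0: "0 \<le> c" using C0 by (simp add: c_def)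
  define T where "T p = L2_norm (hproj (\<lambda>z. cnj (h1 z) * p z)) + L2_norm (hproj (\<lambda>z. cnj (h2 z) * p z))" for p
  have poly: "L2_norm (poly P) \<le> c * T (poly P)" for P
  proof -
    let ?a = "L2_norm (hproj (\<lambda>z. cnj (h1 z) * poly P z))" and ?b = "L2_norm (hproj (\<lambda>z. cnj (h2 z) * poly P z))"
    have "?a\<^sup>2 + ?b\<^sup>2 \<le> (?a + ?b)\<^sup>2" by (simp add: power2_sum)
    then have "(L2_norm (poly P))\<^sup>2 \<le> C * (?a + ?b)\<^sup>2"
      using C[of P] C0 by (meson mult_left_mono order_trans)
    also have "\<dots> = (c * T (poly P))\<^sup>2" using C0 by (simp add: c_def T_def power_mult_distrib)
    finally show ?thesis by (rule power2_le_imp_le) (use c0 in \<open>simp add: T_def\<close>)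
  qed
  obtain M1 where M1: "0 < M1" "AE z in circ. cmod (h1 z) \<le> M1" using HinfE[OF h(1)] by metis
  obtain M2 where M2: "0 < M2" "AE z in circ. cmod (h2 z) \<le> M2" using HinfE[OF h(2)] by metis
  have hT: "L2_norm (hproj (\<lambda>z. cnj (g z) * p z)) \<le> L2_norm (hproj (\<lambda>z. cnj (g z) * q z)) + B * L2_norm (\<lambda>z. q z - p z)"
    if g: "g \<in> Hinf" and B: "0 < B" "AE z in circ. cmod (g z) \<le> B" and p: "p \<in> L2" and q: "q \<in> L2" for g p q B
  proof -
    have "L2_norm (hproj (\<lambda>z. cnj (g z) * p z)) \<le> L2_norm (hproj (\<lambda>z. cnj (g z) * q z)) + L2_norm (\<lambda>z. cnj (g z) * p z - cnj (g z) * q z)"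
      by (intro hproj_norm_diff cnj_Hinf_mult_L2 g p q)
    also have "(\<lambda>z. cnj (g z) * p z - cnj (g z) * q z) = (\<lambda>z. cnj (g z) * ((-1) * (q z - p z)))"
      by (simp add: algebra_simps)
    also have "L2_norm \<dots> \<le> B * L2_norm (\<lambda>z. (-1) * (q z - p z))"
      using B Hinf_measurable[OF g] by (intro L2_norm_mult_bounded L2_scale L2_diff p q) auto
    also have "L2_norm (\<lambda>z. (-1) * (q z - p z)) = L2_norm (\<lambda>z. q z - p z)"
      using L2_norm_scale[OF L2_diff[OF q p], of "-1"] by simp
    finally show ?thesis by simp
  qed
  have "L2_norm p \<le> c * T p" if p: "p \<in> HP" for p
  proof (rule field_le_epsilon)
    fix e :: real assume e: "0 < e"
    \<comment> \<open>The total effect of an approximation error: once for the norm of p, and c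
      times the multiplier bounds for the two projections.\<close>
    define K where "K = 1 + c * (M1 + M2)"
    have K: "0 < K" using c0 M1 M2 by (simp add: K_def add_pos_nonneg)
    obtain P where P: "L2_norm (\<lambda>z. p z - poly P z) < e / K" using poly_dense_HP[OF p, of "e / K"] e K by auto
    let ?d = "L2_norm (\<lambda>z. p z - poly P z)"
    have pL: "p \<in> L2" "poly P \<in> L2" using HP_L2 p poly_HP by blast+
    have "L2_norm (\<lambda>z. (p z - poly P z) + poly P z) \<le> ?d + L2_norm (poly P)"
      by (intro L2_norm_triangle L2_diff pL)
    then have "L2_norm p \<le> ?d + L2_norm (poly P)" by simp
    also have "L2_norm (poly P) \<le> c * T (poly P)" by (rule poly)
    also have "T (poly P) \<le> T p + (M1 + M2) * ?d"
      using hT[OF h(1) M1 pL(2) pL(1)] hT[OF h(2) M2 pL(2) pL(1)] by (simp add: T_def algebra_simps)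
    finally have "L2_norm p \<le> ?d + c * (T p + (M1 + M2) * ?d)" using c0 by (simp add: mult_left_mono)
    also have "\<dots> = c * T p + K * ?d" by (simp add: K_def algebra_simps)
    also have "K * ?d \<le> e" using P K by (simp add: pos_less_divide_eq mult.commute)
    finally show "L2_norm p \<le> c * T p + e" by simp
  qed
  then show ?thesis using c0 unfolding T_def by blast
qed

text \<open>The adjoint of \<open>(x, y) \<mapsto> h1 x + h2 y\<close> is
  \<open>p \<mapsto> (T h1 p, T h2 p)\<close>, and the lower bound makes its norm equivalent to that
  of p. Hence \<open>HP\<close> is complete for the form b, the inner product of the adjoint values.
  Representing \<open>\<lambda>q. L2_inner q R\<close> by some p in this form solves the equation
  with x and y the two components of the adjoint at p.\<close>

theorem corona_solvable:
  assumes cp: "(h1, h2) \<in> CP_plus"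
  shows "\<exists>C\<ge>0. \<forall>R\<in>HP. \<exists>x\<in>HP. \<exists>y\<in>HP. (\<lambda>z. h1 z * x z + h2 z * y z) \<doteq> R \<and>
    L2_norm x \<le> C * L2_norm R \<and> L2_norm y \<le> C * L2_norm R"
proof -
  note h = CP_plus_Hinf[OF cp]
  obtain c where c0: "0 \<le> c" and c: "\<And>p. p \<in> HP \<Longrightarrow> L2_norm p \<le> c * (L2_norm (hproj (\<lambda>z. cnj (h1 z) * p z))
     + L2_norm (hproj (\<lambda>z. cnj (h2 z) * p z)))"
    using corona_lower_bound_HP[OF cp] by blast
  define T where "T h p = hproj (\<lambda>z. cnj (h z) * p z)" for h p :: "complex \<Rightarrow> complex"
  define b where "b p q = L2_inner (T h1 p) (T h1 q) + L2_inner (T h2 p) (T h2 q)" for p q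
  have mL: "(\<lambda>z. cnj (g z) * p z) \<in> L2" if "g \<in> Hinf" "p \<in> HP" for g p
    using that HP_L2 cnj_Hinf_mult_L2 by blast
  have THP: "T g p \<in> HP" if "g \<in> Hinf" "p \<in> HP" for g p
    unfolding T_def by (rule hproj_props(1)[OF mL[OF that]])
  note TL = HP_L2[OF THP]
  have T_add: "T g (\<lambda>z. p z + q z) \<doteq> (\<lambda>z. T g p z + T g q z)" if "g \<in> Hinf" "p \<in> HP" "q \<in> HP" for g p q
    using hproj_add[OF mL[OF that(1,2)] mL[OF that(1,3)]] unfolding T_def by (simp add: distrib_left)
  have T_scale: "T g (\<lambda>z. a * p z) \<doteq> (\<lambda>z. a * T g p z)" if "g \<in> Hinf" "p \<in> HP" for g p a
    using hproj_scale[OF mL[OF that], of a] unfolding T_def by (simp add: mult.left_commute)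
  have in_add: "L2_inner (T g (\<lambda>z. p z + q z)) (T g r) = L2_inner (T g p) (T g r) + L2_inner (T g q) (T g r)"
    if g: "g \<in> Hinf" and "p \<in> HP" "q \<in> HP" "r \<in> HP" for g p q r
  proof -
    have "L2_inner (T g (\<lambda>z. p z + q z)) (T g r) = L2_inner (\<lambda>z. T g p z + T g q z) (T g r)"
      by (intro L2_inner_cong TL L2_add_closed HP_closed that T_add) simp
    then show ?thesis using Lsp.form_add TL that by simp
  qed
  have in_scale: "L2_inner (T g (\<lambda>z. a * p z)) (T g r) = a * L2_inner (T g p) (T g r)"
    if g: "g \<in> Hinf" and "p \<in> HP" "r \<in> HP" for g p r a
  proof -
    have "L2_inner (T g (\<lambda>z. a * p z)) (T g r) = L2_inner (\<lambda>z. a * T g p z) (T g r)"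
      by (intro L2_inner_cong TL L2_scale HP_closed that T_scale) simp
    then show ?thesis using Lsp.form_scale TL that by simp
  qed
  interpret V: semi_inner HP b
  proof
    fix f g r :: "complex \<Rightarrow> complex" and a :: complex
    show "(\<lambda>z. 0) \<in> HP" by (rule HP_closed)
    show "f \<in> HP \<Longrightarrow> g \<in> HP \<Longrightarrow> (\<lambda>z. f z + g z) \<in> HP" by (rule HP_closed)
    show "f \<in> HP \<Longrightarrow> (\<lambda>z. a * f z) \<in> HP" by (rule HP_closed)
    show "f \<in> HP \<Longrightarrow> g \<in> HP \<Longrightarrow> r \<in> HP \<Longrightarrow> b (\<lambda>z. f z + g z) r = b f r + b g r"
      by (simp add: b_def in_add h)
    show "f \<in> HP \<Longrightarrow> g \<in> HP \<Longrightarrow> b (\<lambda>z. a * f z) g = a * b f g"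
      by (simp add: b_def in_scale h distrib_left)
    show "f \<in> HP \<Longrightarrow> g \<in> HP \<Longrightarrow> b g f = cnj (b f g)"
      using L2_inner_cnj[of "T h1 g" "T h1 f"] L2_inner_cnj[of "T h2 g" "T h2 f"] by (simp add: b_def)
    show "f \<in> HP \<Longrightarrow> 0 \<le> Re (b f f)"
      using Lsp.form_nonneg[OF TL[OF h(1)]] Lsp.form_nonneg[OF TL[OF h(2)]] by (simp add: b_def)
  qed
  have nrm2: "(V.nrm p)\<^sup>2 = (L2_norm (T h1 p))\<^sup>2 + (L2_norm (T h2 p))\<^sup>2" if "p \<in> HP" for p
    using V.nrm_square[OF that] Lsp.nrm_square[OF TL[OF h(1) that]] Lsp.nrm_square[OF TL[OF h(2) that]]
    by (simp add: b_def L2_norm_eq)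
  have comp: "L2_norm (T h1 p) \<le> V.nrm p" "L2_norm (T h2 p) \<le> V.nrm p" if "p \<in> HP" for p
  proof -
    have "(L2_norm (T h1 p))\<^sup>2 \<le> (V.nrm p)\<^sup>2" "(L2_norm (T h2 p))\<^sup>2 \<le> (V.nrm p)\<^sup>2"
      unfolding nrm2[OF that] by simp_all
    then show "L2_norm (T h1 p) \<le> V.nrm p" "L2_norm (T h2 p) \<le> V.nrm p"
      using power2_le_imp_le V.nrm_nonneg[OF that] by blast+
  qed
  have lower: "L2_norm p \<le> 2 * c * V.nrm p" if "p \<in> HP" for p
  proof -
    have "L2_norm p \<le> c * (L2_norm (T h1 p) + L2_norm (T h2 p))" using c[OF that] by (simp add: T_def)
    also have "\<dots> \<le> c * (V.nrm p + V.nrm p)" using comp[OF that] c0 by (intro mult_left_mono add_mono)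
    finally show ?thesis by simp
  qed
  obtain M1 where M1: "0 < M1" "AE z in circ. cmod (h1 z) \<le> M1" using HinfE[OF h(1)] by metis
  obtain M2 where M2: "0 < M2" "AE z in circ. cmod (h2 z) \<le> M2" using HinfE[OF h(2)] by metis
  have Tb: "L2_norm (T g p) \<le> B * L2_norm p" if "g \<in> Hinf" "0 < B" "AE z in circ. cmod (g z) \<le> B" "p \<in> HP" for g p B
    unfolding T_def using that Hinf_measurable[OF that(1)]
    by (intro order_trans[OF hproj_norm[OF mL]] L2_norm_mult_bounded) (auto intro: HP_L2)
  have upper: "V.nrm p \<le> (M1 + M2) * L2_norm p" if p: "p \<in> HP" for p
  proof -
    have "(V.nrm p)\<^sup>2 \<le> (M1 * L2_norm p)\<^sup>2 + (M2 * L2_norm p)\<^sup>2"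
      unfolding nrm2[OF p] using Tb[OF h(1) M1 p] Tb[OF h(2) M2 p] by (intro add_mono power_mono) auto
    also have "\<dots> \<le> ((M1 + M2) * L2_norm p)\<^sup>2"
      using M1 M2 by (simp add: power2_sum distrib_right)
    finally show ?thesis by (rule power2_le_imp_le) (use M1 M2 in simp)
  qed
  have solve: "\<exists>x\<in>HP. \<exists>y\<in>HP. (\<lambda>z. h1 z * x z + h2 z * y z) \<doteq> R \<and>
    L2_norm x \<le> 2 * c * L2_norm R \<and> L2_norm y \<le> 2 * c * L2_norm R" if R: "R \<in> HP" for R
  proof -
    have RL: "R \<in> L2" using R by (rule HP_L2)
    have "\<exists>p\<in>HP. \<forall>q\<in>HP. L2_inner q R = b q p"
    proof (rule V.riesz_representation)
      fix X :: "nat \<Rightarrow> complex \<Rightarrow> complex"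
      assume X: "\<And>n. X n \<in> HP" and C: "\<And>e. 0 < e \<Longrightarrow> \<exists>N. \<forall>m\<ge>N. \<forall>n\<ge>N. V.nrm (\<lambda>z. X m z - X n z) < e"
      have "\<exists>N. \<forall>m\<ge>N. \<forall>n\<ge>N. L2_norm (\<lambda>z. X m z - X n z) < e" if e: "0 < e" for e
      proof -
        have "0 < e / (2 * c + 1)" using e c0 by (simp add: add_nonneg_pos)
        then obtain N where N: "\<And>m n. N \<le> m \<Longrightarrow> N \<le> n \<Longrightarrow> V.nrm (\<lambda>z. X m z - X n z) < e / (2 * c + 1)"
          using C by meson
        have "L2_norm (\<lambda>z. X m z - X n z) < e" if "N \<le> m" "N \<le> n" for m n
        proof -
          have d: "(\<lambda>z. X m z - X n z) \<in> HP" by (intro HP_closed X)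
          have "L2_norm (\<lambda>z. X m z - X n z) \<le> 2 * c * V.nrm (\<lambda>z. X m z - X n z)" by (rule lower[OF d])
          also have "\<dots> \<le> (2 * c + 1) * V.nrm (\<lambda>z. X m z - X n z)"
            using V.nrm_nonneg[OF d] by (intro mult_right_mono) auto
          also have "\<dots> < e" using N[OF that] c0 by (simp add: pos_less_divide_eq add_nonneg_pos mult.commute)
          finally show ?thesis .
        qed
        then show ?thesis by blast
      qed
      then obtain l where l: "l \<in> HP" and lim: "(\<lambda>n. L2_norm (\<lambda>z. X n z - l z)) \<longlonglongrightarrow> 0"
        using orth_complete[OF chars_L2(2), of X] X unfolding HP_def[symmetric] by blast
      have "(\<lambda>n. V.nrm (\<lambda>z. X n z - l z)) \<longlonglongrightarrow> 0"
      proof (rule tendsto_sandwich[where f = "\<lambda>n. 0" and h = "\<lambda>n. (M1 + M2) * L2_norm (\<lambda>z. X n z - l z)"])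
        have d: "(\<lambda>z. X n z - l z) \<in> HP" for n by (intro HP_closed X l)
        show "\<forall>\<^sub>F n in sequentially. 0 \<le> V.nrm (\<lambda>z. X n z - l z)"
          using V.nrm_nonneg[OF d] by simp
        show "\<forall>\<^sub>F n in sequentially. V.nrm (\<lambda>z. X n z - l z) \<le> (M1 + M2) * L2_norm (\<lambda>z. X n z - l z)"
          using upper[OF d] by simp
        show "(\<lambda>n. (M1 + M2) * L2_norm (\<lambda>z. X n z - l z)) \<longlonglongrightarrow> 0"
          using tendsto_mult_left[OF lim, of "M1 + M2"] by simp
      qed simp
      then show "\<exists>l\<in>HP. (\<lambda>n. V.nrm (\<lambda>z. X n z - l z)) \<longlonglongrightarrow> 0" using l by blast
    next
      fix q assume q: "q \<in> HP"
      have "cmod (L2_inner q R) \<le> L2_norm q * L2_norm R" by (intro L2_Cauchy_Schwarz HP_L2 q R)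
      also have "\<dots> \<le> (2 * c * V.nrm q) * L2_norm R" by (intro mult_right_mono lower q) simp
      finally show "cmod (L2_inner q R) \<le> (2 * c * L2_norm R) * V.nrm q" by (simp add: mult_ac)
    qed (use RL in \<open>auto simp: Lsp.form_add Lsp.form_scale HP_L2\<close>)
    then obtain p where p: "p \<in> HP" and pR: "\<And>q. q \<in> HP \<Longrightarrow> L2_inner q R = b q p" by blast
    define x where "x = T h1 p"
    define y where "y = T h2 p"
    have x: "x \<in> HP" and y: "y \<in> HP" unfolding x_def y_def using THP h p by blast+
    have hx: "(\<lambda>z. h1 z * x z) \<in> HP" and hy: "(\<lambda>z. h2 z * y z) \<in> HP"
      by (intro Hinf_mult_HP h x y)+
    have mv: "L2_inner (T g q) u = L2_inner q (\<lambda>z. g z * u z)" if "g \<in> Hinf" "q \<in> HP" "u \<in> HP" for g q u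
    proof -
      have "L2_inner (T g q) u = L2_inner (\<lambda>z. cnj (g z) * q z) u"
        unfolding T_def by (rule hproj_inner[OF mL[OF that(1,2)] that(3)])
      then show ?thesis by (simp add: L2_inner_def mult_ac)
    qed
    have s: "(\<lambda>z. h1 z * x z + h2 z * y z) \<in> HP" by (intro HP_closed hx hy)
    define d where "d z = R z - (h1 z * x z + h2 z * y z)" for z
    have d: "d \<in> HP" unfolding d_def by (intro HP_closed R hx hy)
    \<comment> \<open>The error d is tested against itself: by the choice of p and the adjoint
      relation, R and \<open>h1 x + h2 y\<close> have the same inner product with it.\<close>
    have "L2_inner d R = L2_inner d (\<lambda>z. h1 z * x z) + L2_inner d (\<lambda>z. h2 z * y z)"
      using pR[OF d] mv[OF h(1) d x] mv[OF h(2) d y] by (simp add: b_def x_def y_def)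
    also have "\<dots> = L2_inner d (\<lambda>z. h1 z * x z + h2 z * y z)"
      using Lsp.form_add_right[OF HP_L2[OF hx] HP_L2[OF hy] HP_L2[OF d]] by simp
    finally have "L2_inner d d = 0"
      using Lsp.form_diff_right[OF RL HP_L2[OF s] HP_L2[OF d]] by (simp add: d_def[abs_def])
    then have "L2_norm d = 0" by (simp add: L2_norm_eq Lsp.nrm_def)
    then have "d \<doteq> (\<lambda>z. 0)" using L2_norm_eq_0_iff[OF HP_L2[OF d]] by simp
    then have eq: "(\<lambda>z. h1 z * x z + h2 z * y z) \<doteq> R" by eventually_elim (simp add: d_def)
    \<comment> \<open>Taking \<open>q = p\<close> bounds the square of \<open>V.nrm p\<close> by a
      multiple of itself; one factor is then divided out, unless it is 0.\<close>
    have "(V.nrm p)\<^sup>2 = Re (L2_inner p R)" using V.nrm_square[OF p] pR[OF p] by simp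
    also have "\<dots> \<le> cmod (L2_inner p R)" by (rule complex_Re_le_cmod)
    also have "\<dots> \<le> L2_norm p * L2_norm R" by (intro L2_Cauchy_Schwarz HP_L2 p R)
    also have "\<dots> \<le> (2 * c * V.nrm p) * L2_norm R" by (intro mult_right_mono lower p) simp
    finally have "V.nrm p * V.nrm p \<le> V.nrm p * (2 * c * L2_norm R)" by (simp add: power2_eq_square mult_ac)
    then have "V.nrm p \<le> 2 * c * L2_norm R"
    proof (cases "V.nrm p = 0")
      case False
      then have "0 < V.nrm p" using V.nrm_nonneg[OF p] by simp
      then show ?thesis using \<open>V.nrm p * V.nrm p \<le> V.nrm p * (2 * c * L2_norm R)\<close> by simp
    qed (use c0 in simp)
    then show ?thesis using x y eq comp[OF p] unfolding x_def[symmetric] y_def[symmetric]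
      by (meson order_trans)
  qed
  show ?thesis by (intro exI[of _ "2 * c"] conjI ballI solve) (use c0 in auto)
qed

section \<open>Corona pairs in the exterior\<close>

text \<open>The point at infinity becomes a removable singularity at 0.\<close>

lemma exterior_reflection:
  assumes H: "cnj_Hinf_extension H h"
  shows "\<exists>G. Hinf_extension G (\<lambda>z. cnj (h z)) \<and> (\<forall>z\<in>ball 0 1 - {0}. G z = cnj (H (inverse (cnj z))))"
proof -
  have hol: "H holomorphic_on - cball 0 1" and bnd: "bounded (H ` (- cball 0 1))" and bd: "bdry_ext H h"
    using H by (auto simp: cnj_Hinf_extension_def)
  obtain B where "\<forall>x\<in>H ` (- cball 0 1). cmod x \<le> B" using bnd unfolding bounded_iff ..
  then have B: "\<And>z. z \<in> - cball 0 1 \<Longrightarrow> cmod (H z) \<le> B" by blast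
  have inv: "inverse (cnj z) \<in> - cball 0 1" if "z \<in> ball 0 1 - {0}" for z :: complex
    using that one_less_inverse[of "cmod z"] by (auto simp: norm_inverse)
  have img: "cnj ` (ball 0 1 - {0}) = ball 0 1 - {0}"
  proof (intro equalityI subsetI)
    fix x :: complex assume "x \<in> ball 0 1 - {0}"
    then show "x \<in> cnj ` (ball 0 1 - {0})" by (intro image_eqI[of x cnj "cnj x"]) auto
  qed auto
  have "(H \<circ> inverse) holomorphic_on (ball 0 1 - {0})"
  proof (rule holomorphic_on_compose_gen[OF _ hol])
    show "inverse holomorphic_on ball 0 1 - {0}" by (intro holomorphic_intros) auto
    show "inverse ` (ball 0 1 - {0}) \<subseteq> - cball (0::complex) 1"
    proof safe
      fix z :: complex assume z: "z \<in> ball 0 1" "z \<notin> {}" "z \<noteq> 0" "inverse z \<in> cball 0 1"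
      then show False using inv[of "cnj z"] by simp
    qed
  qed
  then have "cnj \<circ> (H \<circ> inverse) \<circ> cnj holomorphic_on (ball 0 1 - {0})"
    by (intro holomorphic_on_compose_cnj_cnj) (auto simp: img)
  then have hol': "(\<lambda>z. cnj (H (inverse (cnj z)))) holomorphic_on (ball 0 1 - {0})"
    by (simp add: o_def)
  have "\<exists>B. \<forall>\<^sub>F z in at 0. norm (cnj (H (inverse (cnj z)))) \<le> B"
  proof (intro exI)
    have "\<forall>\<^sub>F z::complex in at 0. z \<in> ball 0 1 - {0}"
      using eventually_at_in_open[of "ball 0 1" "0::complex"] by simp
    then show "\<forall>\<^sub>F z in at 0. norm (cnj (H (inverse (cnj z)))) \<le> B"
      by eventually_elim (use B[OF inv] in simp)
  qed
  then obtain G where G: "G holomorphic_on ball 0 1" "\<And>z. z \<in> ball 0 1 - {0} \<Longrightarrow> G z = cnj (H (inverse (cnj z)))"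
    using holomorphic_on_extend_bounded[OF hol'] by (auto simp: interior_open)
  have "bounded (G ` ball 0 1)"
    unfolding bounded_iff
  proof (intro exI[of _ "max B (cmod (G 0))"] ballI)
    fix x assume "x \<in> G ` ball 0 1"
    then obtain z where z: "z \<in> ball 0 1" "x = G z" by blast
    show "norm x \<le> max B (cmod (G 0))"
    proof (cases "z = 0")
      case False
      then have "z \<in> ball 0 1 - {0}" using z by simp
      then show ?thesis using G(2)[of z] B[OF inv[of z]] z by (simp add: le_max_iff_disj)
    qed (use z in simp)
  qed
  moreover have "bdry_int G (\<lambda>z. cnj (h z))"
    using bd AE_space unfolding bdry_int_def bdry_ext_def
  proof eventually_elim
    fix z assume lim: "((\<lambda>r::real. H (of_real r * z)) \<longlongrightarrow> h z) (at_right 1)" and z: "z \<in> space circ"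
    have "filterlim (\<lambda>r::real. inverse r) (at_right 1) (at_left 1)"
    proof -
      have "((\<lambda>r::real. inverse r) \<longlongrightarrow> inverse 1) (at_left 1)" by (intro tendsto_intros) simp
      moreover have "\<forall>\<^sub>F r::real in at_left 1. inverse r \<in> {1<..} \<and> inverse r \<noteq> 1"
        by (rule eventually_mono[OF eventually_at_left_real[of 0 1]]) (auto simp: one_less_inverse_iff)
      ultimately show ?thesis by (simp add: filterlim_at)
    qed
    from filterlim_compose[OF lim this]
    have "((\<lambda>r::real. cnj (H (of_real (inverse r) * z))) \<longlongrightarrow> cnj (h z)) (at_left 1)" by (intro tendsto_intros)
    moreover have "\<forall>\<^sub>F r::real in at_left 1. cnj (H (of_real (inverse r) * z)) = G (of_real r * z)"
    proof (rule eventually_mono[OF eventually_at_left_real[of 0 1]])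
      fix r :: real assume r: "r \<in> {0<..<1}"
      have "inverse (cnj z) = z" using z circ_cnj_cancel[OF z] by (intro inverse_unique) (simp add: mult.commute)
      then show "cnj (H (of_real (inverse r) * z)) = G (of_real r * z)"
        using r z by (subst G(2)) (auto simp: norm_mult)
    qed simp
    ultimately show "((\<lambda>r::real. G (of_real r * z)) \<longlongrightarrow> cnj (h z)) (at_left 1)"
      by (simp only: tendsto_cong)
  qed
  ultimately have "Hinf_extension G (\<lambda>z. cnj (h z))" using G(1) by (simp add: Hinf_extension_def)
  then show ?thesis using G(2) by blast
qed

text \<open>Reflection in the circle transports the lower bound to the punctured disk, and
  continuity supplies the origin, the image of infinity.\<close>

lemma CP_minus_cnj:
  assumes "(h1, h2) \<in> CP_minus"
  shows "(\<lambda>z. cnj (h1 z), \<lambda>z. cnj (h2 z)) \<in> CP_plus"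
proof -
  obtain H1 H2 where mem: "h1 \<in> cnj_Hinf" "h2 \<in> cnj_Hinf"
    and H: "cnj_Hinf_extension H1 h1" "cnj_Hinf_extension H2 h2"
    and pos: "0 < (INF z\<in>- cball 0 1. cmod (H1 z) + cmod (H2 z))"
    using assms by (auto simp: CP_minus_def)
  define \<delta> where "\<delta> = (INF z\<in>- cball 0 1. cmod (H1 z) + cmod (H2 z))"
  have low: "\<delta> \<le> cmod (H1 z) + cmod (H2 z)" if "z \<in> - cball 0 1" for z
    unfolding \<delta>_def by (rule cINF_lower[OF _ that]) (auto intro!: bdd_belowI2[of _ 0])
  obtain G1 where G1: "Hinf_extension G1 (\<lambda>z. cnj (h1 z))" "\<And>z. z \<in> ball 0 1 - {0} \<Longrightarrow> G1 z = cnj (H1 (inverse (cnj z)))"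
    using exterior_reflection[OF H(1)] by blast
  obtain G2 where G2: "Hinf_extension G2 (\<lambda>z. cnj (h2 z))" "\<And>z. z \<in> ball 0 1 - {0} \<Longrightarrow> G2 z = cnj (H2 (inverse (cnj z)))"
    using exterior_reflection[OF H(2)] by blast
  have g: "\<delta> \<le> cmod (G1 z) + cmod (G2 z)" if "z \<in> ball 0 1 - {0}" for z
  proof -
    have "inverse (cnj z) \<in> - cball 0 1" using that one_less_inverse[of "cmod z"] by (auto simp: norm_inverse)
    from low[OF this] show ?thesis using G1(2)[OF that] G2(2)[OF that] by simp
  qed
  have g0: "\<delta> \<le> cmod (G1 0) + cmod (G2 0)"
  proof -
    have "isCont G 0" if "G holomorphic_on ball 0 1" for G
      using continuous_on_interior[OF holomorphic_on_imp_continuous_on[OF that], of 0] by simp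
    then have "isCont G1 0" "isCont G2 0" using G1(1) G2(1) by (auto simp: Hinf_extension_def)
    then have "((\<lambda>z. cmod (G1 z) + cmod (G2 z)) \<longlongrightarrow> cmod (G1 0) + cmod (G2 0)) (at 0)"
      by (intro tendsto_intros) (auto simp: isCont_def)
    moreover have "\<forall>\<^sub>F z::complex in at 0. z \<in> ball 0 1 - {0}"
      using eventually_at_in_open[of "ball 0 1" "0::complex"] by simp
    then have "\<forall>\<^sub>F z in at 0. \<delta> \<le> cmod (G1 z) + cmod (G2 z)" by eventually_elim (rule g)
    ultimately show ?thesis by (rule tendsto_lowerbound) simp
  qed
  have "\<delta> \<le> cmod (G1 z) + cmod (G2 z)" if "z \<in> ball 0 1" for z
    using g[of z] g0 that by (cases "z = 0") auto
  then have "\<delta> \<le> (INF z\<in>ball 0 1. cmod (G1 z) + cmod (G2 z))" by (intro cINF_greatest) auto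
  then have "0 < (INF z\<in>ball 0 1. cmod (G1 z) + cmod (G2 z))" using pos by (simp add: \<delta>_def)
  then show ?thesis using mem G1(1) G2(1) by (auto simp: CP_plus_def cnj_Hinf_def)
qed

section \<open>Division by corona pairs\<close>

lemma cnj_Hinf_mult_HM': "(\<lambda>z. cnj (h z)) \<in> Hinf \<Longrightarrow> f \<in> HM \<Longrightarrow> (\<lambda>z. h z * f z) \<in> HM"
  using cnj_Hinf_mult_HM[of "\<lambda>z. cnj (h z)" f] by simp

text \<open>Solving with right side 1 gives \<open>h1 x + h2 y = 1\<close>, so the common factor has
  to be \<open>u = x a + y b\<close>. As a sum of products of square integrable functions it is only
  integrable, but \<open>h1 u = a\<close> and \<open>h2 u = b\<close> together with the lower bound
  on the circle give square integrability.\<close>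

lemma corona_division:
  assumes cp: "(h1, h2) \<in> CP_plus" and a: "a \<in> HP" and b: "b \<in> HP"
    and eq: "(\<lambda>z. h2 z * a z) \<doteq> (\<lambda>z. h1 z * b z)"
  shows "\<exists>u\<in>HP. a \<doteq> (\<lambda>z. h1 z * u z) \<and> b \<doteq> (\<lambda>z. h2 z * u z)"
proof -
  note h = CP_plus_Hinf[OF cp]
  obtain C where "\<forall>R\<in>HP. \<exists>x\<in>HP. \<exists>y\<in>HP. (\<lambda>z. h1 z * x z + h2 z * y z) \<doteq> R \<and>
      L2_norm x \<le> C * L2_norm R \<and> L2_norm y \<le> C * L2_norm R"
    using corona_solvable[OF cp] by blast
  from bspec[OF this char_HP[of 0]] obtain x y
    where x: "x \<in> HP" and y: "y \<in> HP" and xy: "(\<lambda>z. h1 z * x z + h2 z * y z) \<doteq> (\<lambda>z. z ^ 0)"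
    by blast
  define u where "u z = x z * a z + y z * b z" for z
  have [measurable]: "x \<in> borel_measurable circ" "y \<in> borel_measurable circ" "a \<in> borel_measurable circ" "b \<in> borel_measurable circ"
    using x y a b by (auto intro!: L2_measurable HP_L2)
  have um: "u \<in> borel_measurable circ" unfolding u_def[abs_def] by measurable
  have ua: "a \<doteq> (\<lambda>z. h1 z * u z)" using eq xy
  proof eventually_elim
    case (elim z)
    have "h1 z * u z = (h1 z * x z) * a z + y z * (h1 z * b z)" by (simp add: u_def algebra_simps)
    also have "\<dots> = (h1 z * x z + h2 z * y z) * a z" unfolding elim(1)[symmetric] by (simp add: algebra_simps)
    finally show ?case using elim(2) by simp
  qed
  have ub: "b \<doteq> (\<lambda>z. h2 z * u z)" using eq xy
  proof eventually_elim
    case (elim z)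
    have "h2 z * u z = x z * (h2 z * a z) + (h2 z * y z) * b z" by (simp add: u_def algebra_simps)
    also have "\<dots> = (h1 z * x z + h2 z * y z) * b z" unfolding elim(1) by (simp add: algebra_simps)
    finally show ?case using elim(2) by simp
  qed
  obtain \<epsilon> where \<epsilon>: "0 < \<epsilon>" and low: "AE z in circ. \<epsilon> \<le> (cmod (h1 z))\<^sup>2 + (cmod (h2 z))\<^sup>2"
    using CP_plus_boundary[OF cp] by blast
  have uL: "u \<in> L2"
  proof (rule L2_I_bound[OF um])
    show "integrable circ (\<lambda>z. ((cmod (a z))\<^sup>2 + (cmod (b z))\<^sup>2) / \<epsilon>)"
      using L2_square_integrable[OF HP_L2[OF a]] L2_square_integrable[OF HP_L2[OF b]] by simp
    show "AE z in circ. (cmod (u z))\<^sup>2 \<le> ((cmod (a z))\<^sup>2 + (cmod (b z))\<^sup>2) / \<epsilon>"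
      using ua ub low
    proof eventually_elim
      case (elim z)
      have "\<epsilon> * (cmod (u z))\<^sup>2 \<le> ((cmod (h1 z))\<^sup>2 + (cmod (h2 z))\<^sup>2) * (cmod (u z))\<^sup>2"
        using elim(3) by (intro mult_right_mono) auto
      also have "\<dots> = (cmod (a z))\<^sup>2 + (cmod (b z))\<^sup>2"
        unfolding elim(1,2) norm_mult power_mult_distrib by (simp add: algebra_simps)
      finally show ?case using \<epsilon> by (simp add: pos_le_divide_eq mult.commute)
    qed
  qed
  \<comment> \<open>The coefficients of a product of two Hardy space functions are inner products of
    one factor with the conjugate of the shifted other factor, which lies in
    \<open>HM\<close>.\<close>
  have prod0: "(LINT z|circ. s z * t z * z ^ Suc n) = 0" "integrable circ (\<lambda>z. s z * t z * z ^ Suc n)"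
    if s: "s \<in> HP" and t: "t \<in> HP" for s t n
  proof -
    have tz: "(\<lambda>z. z ^ Suc n * t z) \<in> HP" by (rule Hinf_mult_HP[OF Hinf_char t])
    have "(\<lambda>z. cnj (z ^ Suc n * t z)) \<in> HM"
    proof -
      have "(\<lambda>z. cnj (z ^ n) * flip t z) \<in> HM" by (intro cnj_Hinf_mult_HM Hinf_char flip_HP t)
      then show ?thesis by (simp add: flip_def mult_ac)
    qed
    from HP_orth_HM[OF s this] show "(LINT z|circ. s z * t z * z ^ Suc n) = 0"
      by (simp add: L2_inner_def mult_ac)
    show "integrable circ (\<lambda>z. s z * t z * z ^ Suc n)"
      using L2_mult_integrable[OF HP_L2[OF s] HP_L2[OF tz]] by (simp add: mult_ac)
  qed
  have "(LINT z|circ. u z * z ^ Suc n) = 0" for n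
  proof -
    have "(LINT z|circ. u z * z ^ Suc n) = (LINT z|circ. x z * a z * z ^ Suc n + y z * b z * z ^ Suc n)"
      by (simp add: u_def distrib_right)
    also have "\<dots> = 0"
      unfolding Bochner_Integration.integral_add[OF prod0(2)[OF x a] prod0(2)[OF y b]] prod0(1)[OF x a] prod0(1)[OF y b]
      by simp
    finally show ?thesis .
  qed
  then have "u \<in> HP" using uL by (simp add: HP_iff)
  then show ?thesis using ua ub by blast
qed

lemma flip_mult_cnj: "flip (\<lambda>z. cnj (h z) * f z) = (\<lambda>z. h z * flip f z)"
  by (simp add: flip_def fun_eq_iff)

lemma flip_cong: "f \<doteq> g \<Longrightarrow> flip f \<doteq> flip g"
  by (auto simp: flip_def elim: eventually_mono)

lemma flip_flip_eq:
  assumes "f \<doteq> flip g"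
  shows "flip f \<doteq> g"
  using flip_cong[OF assms] flip_flip[of g] by eventually_elim simp

text \<open>\<open>flip\<close> exchanges \<open>HM\<close> with \<open>HP\<close> and turns
  multiplication by h into multiplication by \<open>cnj h\<close>. This reduces the exterior to the
  disk, here and in \<open>corona_solvable_minus\<close>.\<close>

lemma corona_division_minus:
  assumes cp: "(h1, h2) \<in> CP_minus" and a: "a \<in> HM" and b: "b \<in> HM"
    and eq: "(\<lambda>z. h2 z * a z) \<doteq> (\<lambda>z. h1 z * b z)"
  shows "\<exists>u\<in>HM. a \<doteq> (\<lambda>z. h1 z * u z) \<and> b \<doteq> (\<lambda>z. h2 z * u z)"
proof -
  have "(\<lambda>z. cnj (h2 z) * flip a z) \<doteq> (\<lambda>z. cnj (h1 z) * flip b z)"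
    using flip_cong[OF eq] flip_mult_cnj[of "\<lambda>z. cnj (h2 z)" a] flip_mult_cnj[of "\<lambda>z. cnj (h1 z)" b] by simp
  from corona_division[OF CP_minus_cnj[OF cp] flip_HM[OF a] flip_HM[OF b] this]
  obtain u where u: "u \<in> HP" "flip a \<doteq> (\<lambda>z. cnj (h1 z) * u z)" "flip b \<doteq> (\<lambda>z. cnj (h2 z) * u z)" by blast
  have "a \<doteq> (\<lambda>z. h1 z * flip u z)" "b \<doteq> (\<lambda>z. h2 z * flip u z)"
    using flip_cong[OF u(2)] flip_flip[of a] flip_cong[OF u(3)] flip_flip[of b] unfolding flip_mult_cnj
    by (eventually_elim, simp)+
  then show ?thesis using flip_HP[OF u(1)] by blast
qed

lemma corona_solvable_minus:
  assumes cp: "(h1, h2) \<in> CP_minus"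
  shows "\<exists>C\<ge>0. \<forall>R\<in>HM. \<exists>x\<in>HM. \<exists>y\<in>HM. (\<lambda>z. h1 z * x z + h2 z * y z) \<doteq> R \<and>
    L2_norm x \<le> C * L2_norm R \<and> L2_norm y \<le> C * L2_norm R"
proof -
  obtain C where C0: "0 \<le> C" and C: "\<And>R. R \<in> HP \<Longrightarrow> \<exists>x\<in>HP. \<exists>y\<in>HP. (\<lambda>z. cnj (h1 z) * x z + cnj (h2 z) * y z) \<doteq> R \<and>
    L2_norm x \<le> C * L2_norm R \<and> L2_norm y \<le> C * L2_norm R"
    using corona_solvable[OF CP_minus_cnj[OF cp]] by blast
  have "\<exists>x\<in>HM. \<exists>y\<in>HM. (\<lambda>z. h1 z * x z + h2 z * y z) \<doteq> R \<and>
    L2_norm x \<le> C * L2_norm R \<and> L2_norm y \<le> C * L2_norm R" if R: "R \<in> HM" for R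
  proof -
    obtain x y where xy: "x \<in> HP" "y \<in> HP" "(\<lambda>z. cnj (h1 z) * x z + cnj (h2 z) * y z) \<doteq> flip R"
      "L2_norm x \<le> C * L2_norm (flip R)" "L2_norm y \<le> C * L2_norm (flip R)"
      using C[OF flip_HM[OF R]] by blast
    have "flip (\<lambda>z. cnj (h1 z) * x z + cnj (h2 z) * y z) = (\<lambda>z. h1 z * flip x z + h2 z * flip y z)"
      by (simp add: flip_def fun_eq_iff algebra_simps)
    then have "(\<lambda>z. h1 z * flip x z + h2 z * flip y z) \<doteq> R"
      using flip_flip_eq[OF xy(3)] by simp
    then show ?thesis
      using xy(4,5) L2_norm_flip[OF HP_L2[OF xy(1)]] L2_norm_flip[OF HP_L2[OF xy(2)]] L2_norm_flip[OF HM_L2[OF R]]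
      by (intro bexI[of _ "flip x"] bexI[of _ "flip y"] flip_HP xy) simp
  qed
  then show ?thesis using C0 by blast
qed

section \<open>Finite Blaschke products as bounded analytic functions\<close>

lemma disc_algebra_Hinf:
  assumes c: "continuous_on (cball 0 1) F" and hol: "F holomorphic_on ball 0 1"
  shows "F \<in> Hinf"
proof -
  have "bounded (F ` cball 0 1)" by (intro compact_imp_bounded compact_continuous_image c) simp
  then obtain B where "\<forall>x\<in>F ` cball 0 1. cmod x \<le> B" unfolding bounded_iff ..
  then have B: "\<And>z. z \<in> cball 0 1 \<Longrightarrow> cmod (F z) \<le> B" by blast
  have "continuous_on (sphere 0 1) F" by (rule continuous_on_subset[OF c]) auto
  then have "F \<in> borel_measurable circ" by (rule circ_measurable_continuous)
  moreover have "AE z in circ. cmod (F z) \<le> B" by (rule AE_I2) (use B in simp)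
  moreover have "bounded (F ` ball 0 1)" unfolding bounded_iff using B by (intro exI[of _ B]) auto
  moreover have "bdry_int F F"
    unfolding bdry_int_def
  proof (rule AE_I2)
    fix z assume z: "z \<in> space circ"
    have "continuous_on {0..1} (\<lambda>r::real. F (of_real r * z))"
      by (rule continuous_on_compose2[OF c]) (use z in \<open>auto intro!: continuous_intros simp: dist_norm norm_mult\<close>)
    then have "((\<lambda>r::real. F (of_real r * z)) \<longlongrightarrow> F (of_real 1 * z)) (at 1 within {0..1})"
      unfolding continuous_on_def by (rule bspec) simp
    then show "((\<lambda>r::real. F (of_real r * z)) \<longlongrightarrow> F z) (at_left 1)"
      using at_within_Icc_at_left[of "0::real" 1] by simp
  qed
  ultimately show ?thesis using hol unfolding Hinf_def Hinf_extension_def Linf_def by blast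
qed

lemma one_minus_cnj_mult_nonzero:
  assumes "cmod a < 1" "cmod z \<le> 1"
  shows "1 - cnj a * z \<noteq> 0"
proof
  assume "1 - cnj a * z = 0"
  then have "cmod (cnj a * z) = 1" by (simp add: eq_iff_diff_eq_0[symmetric])
  moreover have "cmod (cnj a * z) \<le> cmod a * 1"
    unfolding norm_mult complex_mod_cnj using assms by (intro mult_left_mono) auto
  ultimately show False using assms by simp
qed

lemma blaschke_Hinf:
  assumes "finite J" "\<And>j. j \<in> J \<Longrightarrow> a j \<in> ball 0 1"
  shows "(\<lambda>z. c * (\<Prod>j\<in>J. (z - a j) / (1 - cnj (a j) * z))) \<in> Hinf"
proof (rule disc_algebra_Hinf)
  have nz: "1 - cnj (a j) * z \<noteq> 0" if "j \<in> J" "z \<in> cball 0 1" for j z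
    using one_minus_cnj_mult_nonzero[of "a j" z] assms(2)[OF that(1)] that(2) by simp
  show "continuous_on (cball 0 1) (\<lambda>z. c * (\<Prod>j\<in>J. (z - a j) / (1 - cnj (a j) * z)))"
    by (intro continuous_intros) (use nz in auto)
  show "(\<lambda>z. c * (\<Prod>j\<in>J. (z - a j) / (1 - cnj (a j) * z))) holomorphic_on ball 0 1"
    by (intro holomorphic_intros) (use nz in auto)
qed

section \<open>Injectivity and invertibility\<close>

lemma op_kernel_trivial_imp_injective:
  assumes T: "bounded_op T X Y" and X: "\<And>f g. f \<in> X \<Longrightarrow> g \<in> X \<Longrightarrow> (\<lambda>z. f z - g z) \<in> X"
    and ker: "\<And>f. f \<in> X \<Longrightarrow> T f \<doteq> (\<lambda>z. 0) \<Longrightarrow> f \<doteq> (\<lambda>z. 0)"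
  shows "op_injective T X"
  unfolding op_injective_def
proof (intro ballI impI)
  fix f g assume f: "f \<in> X" and g: "g \<in> X" and eq: "T f \<doteq> T g"
  have "T (\<lambda>z. (f z - g z) + g z) \<doteq> (\<lambda>z. T (\<lambda>z. f z - g z) z + T g z)"
  proof -
    have "\<forall>f\<in>X. \<forall>g\<in>X. T (\<lambda>z. f z + g z) \<doteq> (\<lambda>z. T f z + T g z)"
      using T unfolding bounded_op_def by blast
    from bspec[OF bspec[OF this X[OF f g]] g] show ?thesis .
  qed
  then have "T f \<doteq> (\<lambda>z. T (\<lambda>z. f z - g z) z + T g z)" by simp
  then have "T (\<lambda>z. f z - g z) \<doteq> (\<lambda>z. 0)" using eq by eventually_elim simp
  from ker[OF X[OF f g] this] show "f \<doteq> g" by eventually_elim simp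
qed

lemma model_perp_const_mult:
  assumes \<theta>: "inner_fun \<theta>" and \<alpha>: "inner_fun \<alpha>" and c: "cmod c = 1" and eq: "\<alpha> \<doteq> (\<lambda>z. c * \<theta> z)"
  shows "model_perp \<alpha> = model_perp \<theta>"
proof -
  have sub: "model_perp \<alpha> \<subseteq> model_perp \<theta>" if t: "inner_fun \<theta>" "inner_fun \<alpha>" "\<alpha> \<doteq> (\<lambda>z. c * \<theta> z)" for \<theta> \<alpha> c
  proof
    fix f assume "f \<in> model_perp \<alpha>"
    then obtain m g where f: "f \<in> L2" "m \<in> HM" "g \<in> HP" "f \<doteq> (\<lambda>z. m z + \<alpha> z * g z)"
      using model_perp_iff[OF t(2)] by blast
    have "f \<doteq> (\<lambda>z. m z + \<theta> z * (c * g z))"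
      using f(4) t(3) by eventually_elim (simp add: mult_ac)
    then show "f \<in> model_perp \<theta>"
      unfolding model_perp_iff[OF t(1)]
      by (intro conjI f(1) bexI[OF _ f(2)] bexI[OF _ HP_closed(4)[OF f(3)]])
  qed
  have "\<theta> \<doteq> (\<lambda>z. cnj c * \<alpha> z)"
    using eq
  proof eventually_elim
    case (elim z)
    have "cnj c * c = 1" using c by (simp add: complex_norm_square[symmetric] mult.commute)
    then show ?case unfolding elim by (simp add: mult.assoc[symmetric])
  qed
  then show ?thesis using sub[OF \<theta> \<alpha> eq] sub[OF \<alpha> \<theta>] by blast
qed

text \<open>The functions built on the way to a preimage are combinations of this shape; the
  explicit form keeps the constants independent of the function to be reached.\<close>

lemma L2_combination_bound:
  assumes "x \<in> L2" "y \<in> L2" "p \<in> borel_measurable circ" "q \<in> borel_measurable circ"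
    and "AE z in circ. cmod (p z) \<le> A" "AE z in circ. cmod (q z) \<le> B" "0 \<le> A" "0 \<le> B"
    and "L2_norm x \<le> X" "L2_norm y \<le> Y"
  shows "(\<lambda>z. p z * x z + q z * y z) \<in> L2" "L2_norm (\<lambda>z. p z * x z + q z * y z) \<le> A * X + B * Y"
proof -
  have L: "(\<lambda>z. p z * x z) \<in> L2" "(\<lambda>z. q z * y z) \<in> L2"
    using assms by (auto intro: L2_mult_bounded)
  then show "(\<lambda>z. p z * x z + q z * y z) \<in> L2" by (rule L2_add_closed)
  have "L2_norm (\<lambda>z. p z * x z + q z * y z) \<le> L2_norm (\<lambda>z. p z * x z) + L2_norm (\<lambda>z. q z * y z)"
    by (rule L2_norm_triangle[OF L])
  also have "\<dots> \<le> A * L2_norm x + B * L2_norm y"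
    using assms by (intro add_mono L2_norm_mult_bounded)
  also have "\<dots> \<le> A * X + B * Y" using assms by (intro add_mono mult_left_mono)
  finally show "L2_norm (\<lambda>z. p z * x z + q z * y z) \<le> A * X + B * Y" .
qed

section \<open>Kernel, range and inverse under the corona hypotheses\<close>

context
  fixes \<theta> \<alpha> \<phi> \<psi> h1 h2 hm :: "complex \<Rightarrow> complex"
  assumes \<theta>: "inner_fun \<theta>" and \<alpha>: "inner_fun \<alpha>" and div: "inner_divides \<alpha> \<theta>"
    and \<phi>: "\<phi> \<in> Linf" and \<psi>: "\<psi> \<in> Linf" and \<phi>\<psi>: "(\<lambda>z. \<phi> z * \<psi> z) \<doteq> (\<lambda>z. 1)"
    and cp: "(h1, h2) \<in> CP_plus" and cm: "(\<lambda>z. cnj (\<alpha> z) * h1 z, hm) \<in> CP_minus"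
    and sym: "(\<lambda>z. \<phi> z * (hm z + \<theta> z * h2 z)) \<doteq> h1"
begin

lemma h_Hinf: "h1 \<in> Hinf" "h2 \<in> Hinf"
  using CP_plus_Hinf[OF cp] by auto

lemma hm_Hinf: "(\<lambda>z. cnj (cnj (\<alpha> z) * h1 z)) \<in> Hinf" "(\<lambda>z. cnj (hm z)) \<in> Hinf"
  using CP_plus_Hinf[OF CP_minus_cnj[OF cm]] by auto

lemma quotient_Hinf: "(\<lambda>z. \<theta> z * cnj (\<alpha> z)) \<in> Hinf"
  using div by (simp add: inner_divides_def)

lemma symbol_inverse: "(\<lambda>z. \<psi> z * h1 z) \<doteq> (\<lambda>z. hm z + \<theta> z * h2 z)"
  using sym \<phi>\<psi>
proof eventually_elim
  case (elim z)
  have "\<psi> z * h1 z = (\<phi> z * \<psi> z) * (hm z + \<theta> z * h2 z)" unfolding elim(1)[symmetric] by (simp add: mult_ac)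
  then show ?case using elim(2) by simp
qed

text \<open>Multiplying by \<open>\<psi> h1\<close> removes \<phi> from the left, and
  \<open>symbol_inverse\<close> rewrites the factor of k as \<open>hm + \<theta> h2\<close>; a
  further factor \<open>cnj \<alpha>\<close> sorts the terms. The case \<open>g = 0\<close> serves
  the kernel, the general case the range.\<close>

lemma splitting:
  assumes f: "f \<doteq> (\<lambda>z. m z + \<theta> z * u z)" and k: "(\<lambda>z. \<phi> z * f z) \<doteq> (\<lambda>z. g z + k z)"
  shows "AE z in circ. ((cnj (\<alpha> z) * h1 z) * m z - hm z * (cnj (\<alpha> z) * k z))
      + (\<theta> z * cnj (\<alpha> z)) * (h1 z * u z - h2 z * k z) = cnj (\<alpha> z) * (\<psi> z * h1 z) * g z"
  using f k symbol_inverse \<phi>\<psi>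
proof eventually_elim
  case (elim z)
  have "h1 z * f z = (\<phi> z * \<psi> z) * (h1 z * f z)" using elim(4) by simp
  also have "\<dots> = (\<psi> z * h1 z) * (\<phi> z * f z)" by (simp add: mult_ac)
  also have "\<dots> = (\<psi> z * h1 z) * g z + (hm z + \<theta> z * h2 z) * k z"
    unfolding elim(2) distrib_left by (simp only: elim(3))
  finally have "h1 z * (m z + \<theta> z * u z) = (\<psi> z * h1 z) * g z + (hm z + \<theta> z * h2 z) * k z"
    unfolding elim(1) .
  then have "cnj (\<alpha> z) * (h1 z * (m z + \<theta> z * u z)) = cnj (\<alpha> z) * ((\<psi> z * h1 z) * g z + (hm z + \<theta> z * h2 z) * k z)"
    by simp
  then show ?case by (simp add: algebra_simps)
qed

theorem dual_toeplitz_kernel: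
  assumes f: "f \<in> model_perp \<theta>" and D: "dual_toeplitz \<theta> \<alpha> \<phi> f \<doteq> (\<lambda>z. 0)"
  shows "f \<doteq> (\<lambda>z. 0)"
proof -
  have fL: "f \<in> L2" using f by (rule model_perp_L2)
  define k where "k z = \<phi> z * f z" for z
  have kL: "k \<in> L2" unfolding k_def by (rule Linf_mult_L2[OF \<phi> fL])
  have subL: "model_perp \<alpha> \<subseteq> L2" using model_perp_L2 by blast
  have "k \<in> orth (model_perp \<alpha>)"
  proof (rule orth_cong[OF subL dual_toeplitz_props(2)[OF \<phi> fL] L2_measurable[OF kL]])
    show "(\<lambda>z. \<phi> z * f z - dual_toeplitz \<theta> \<alpha> \<phi> f z) \<doteq> k"
      using D by eventually_elim (simp add: k_def)
  qed
  then have kP: "k \<in> HP" and kM: "(\<lambda>z. cnj (\<alpha> z) * k z) \<in> HM"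
    unfolding orth_model_perp_iff[OF \<alpha>] by blast+
  obtain m u where m: "m \<in> HM" and u: "u \<in> HP" and fmu: "f \<doteq> (\<lambda>z. m z + \<theta> z * u z)"
    using f model_perp_iff[OF \<theta>] by blast
  define l where "l z = (cnj (\<alpha> z) * h1 z) * m z - hm z * (cnj (\<alpha> z) * k z)" for z
  define r where "r z = h1 z * u z - h2 z * k z" for z
  have lM: "l \<in> HM"
    unfolding l_def[abs_def]
    using cnj_Hinf_mult_HM'[OF hm_Hinf(1) m] cnj_Hinf_mult_HM'[OF hm_Hinf(2) kM] by (rule HM_closed)
  have rP: "r \<in> HP" unfolding r_def[abs_def] by (intro HP_closed Hinf_mult_HP h_Hinf u kP)
  \<comment> \<open>Divisibility of \<theta> by \<alpha> keeps the second bracket in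
    \<open>HP\<close>. Since the first lies in \<open>HM\<close> and they add up to 0, both are
    null.\<close>
  have brP: "(\<lambda>z. (\<theta> z * cnj (\<alpha> z)) * r z) \<in> HP" by (rule Hinf_mult_HP[OF quotient_Hinf rP])
  have lr: "(\<lambda>z. l z + (\<theta> z * cnj (\<alpha> z)) * r z) \<doteq> (\<lambda>z. 0)"
    using splitting[OF fmu, of "\<lambda>z. 0" k] unfolding l_def r_def k_def by simp
  have "(\<lambda>z. - 1 * ((\<theta> z * cnj (\<alpha> z)) * r z)) \<in> HP" by (rule HP_closed(4)[OF brP])
  then have "l \<in> HP"
  proof (rule HP_cong)
    show "(\<lambda>z. - 1 * ((\<theta> z * cnj (\<alpha> z)) * r z)) \<doteq> l"
      using lr
    proof eventually_elim
      case (elim z)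
      then have "l z = - ((\<theta> z * cnj (\<alpha> z)) * r z)" by (simp only: eq_neg_iff_add_eq_0)
      then show ?case by simp
    qed
  qed (rule L2_measurable[OF HM_L2[OF lM]])
  then have l0: "l \<doteq> (\<lambda>z. 0)" using lM by (rule HP_HM_trivial)
  have r0: "r \<doteq> (\<lambda>z. 0)"
    using lr l0 inner_fun_unimodular[OF \<theta>] inner_fun_unimodular[OF \<alpha>] by eventually_elim auto
  have "(\<lambda>z. h2 z * k z) \<doteq> (\<lambda>z. h1 z * u z)" using r0 by eventually_elim (simp add: r_def)
  from corona_division[OF cp kP u this]
  obtain p where p: "p \<in> HP" "k \<doteq> (\<lambda>z. h1 z * p z)" "u \<doteq> (\<lambda>z. h2 z * p z)" by blast
  have "(\<lambda>z. hm z * (cnj (\<alpha> z) * k z)) \<doteq> (\<lambda>z. (cnj (\<alpha> z) * h1 z) * m z)"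
    using l0 by eventually_elim (simp only: l_def right_minus_eq)
  from corona_division_minus[OF cm kM m this]
  obtain n where n: "n \<in> HM" "(\<lambda>z. cnj (\<alpha> z) * k z) \<doteq> (\<lambda>z. cnj (\<alpha> z) * h1 z * n z)" "m \<doteq> (\<lambda>z. hm z * n z)" by blast
  have fk: "f \<doteq> (\<lambda>z. \<psi> z * k z)"
    using \<phi>\<psi> by eventually_elim (simp add: k_def mult.assoc[symmetric] mult.commute[of "\<psi> _"])
  obtain \<epsilon> where \<epsilon>: "0 < \<epsilon>" and low: "AE z in circ. \<epsilon> \<le> (cmod (h1 z))\<^sup>2 + (cmod (h2 z))\<^sup>2"
    using CP_plus_boundary[OF cp] by blast
  \<comment> \<open>Where \<open>h1\<close> is nonzero the two expressions for k give equality; the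
    two expressions for f give \<open>h2 (p - n) = 0\<close>, and common zeros of the pair are
    excluded. The common function lies in \<open>HP\<close> and in \<open>HM\<close>.\<close>
  have "p \<doteq> n"
    using p(2,3) n(2,3) fk fmu low symbol_inverse inner_fun_unimodular[OF \<theta>] inner_fun_unimodular[OF \<alpha>]
  proof eventually_elim
    case (elim z)
    have a0: "cnj (\<alpha> z) \<noteq> 0" and t0: "\<theta> z \<noteq> 0" using elim(9,10) by auto
    have k1: "k z = h1 z * p z" by (rule elim(1))
    have k2: "k z = h1 z * n z" using elim(3) a0 by simp
    have f1: "f z = hm z * n z + \<theta> z * (h2 z * p z)" using elim by simp
    have f2: "f z = (hm z + \<theta> z * h2 z) * n z" unfolding elim(5) k2 elim(8)[symmetric] by (simp add: mult.assoc)
    have "h1 z * (p z - n z) = 0" by (simp only: right_diff_distrib k1[symmetric] k2[symmetric] diff_self)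
    moreover have "\<theta> z * (h2 z * (p z - n z)) = f z - f z" by (subst (1) f1, subst f2) (simp add: algebra_simps)
    moreover have "h1 z \<noteq> 0 \<or> h2 z \<noteq> 0" using elim(7) \<epsilon> by auto
    ultimately show ?case using t0 by auto
  qed
  then have "n \<in> HP" by (intro HP_cong[OF p(1)] L2_measurable HM_L2 n)
  then have "n \<doteq> (\<lambda>z. 0)" using n(1) by (rule HP_HM_trivial)
  then show ?thesis using \<open>p \<doteq> n\<close> p(2) fk by eventually_elim simp
qed

text \<open>The function annihilating the range is \<open>\<alpha> cnj (\<psi> h1) \<kappa>\<close>, where \<open>\<kappa>\<close> is the reproducing kernel at a zero
  of the Blaschke product.\<close>

theorem dual_toeplitz_not_surjective:
  assumes B: "finite_blaschke n (\<lambda>z. \<theta> z * cnj (\<alpha> z))" and n: "0 < n"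
    and surj: "\<And>g. g \<in> model_perp \<alpha> \<Longrightarrow> \<exists>f\<in>model_perp \<theta>. dual_toeplitz \<theta> \<alpha> \<phi> f \<doteq> g"
  shows False
proof -
  obtain c a where c: "cmod c = 1" and a: "\<And>j. j < n \<Longrightarrow> a j \<in> ball 0 1"
    and beta: "(\<lambda>z. \<theta> z * cnj (\<alpha> z)) \<doteq> (\<lambda>z. c * (\<Prod>j<n. (z - a j) / (1 - cnj (a j) * z)))"
    using B unfolding finite_blaschke_def by blast
  define \<beta> where "\<beta> z = \<theta> z * cnj (\<alpha> z)" for z
  define \<kappa> where "\<kappa> z = 1 / (1 - cnj (a 0) * z)" for z
  \<comment> \<open>The Blaschke product with the factor of the zero \<open>a 0\<close>
    removed.\<close>
  define B1 where "B1 z = c * (\<Prod>j\<in>{..<n} - {0}. (z - a j) / (1 - cnj (a j) * z))" for z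
  have a0: "cmod (a 0) < 1" using a[OF n] by simp
  have nz: "1 - cnj (a 0) * z \<noteq> 0" if "z \<in> cball 0 1" for z
    using one_minus_cnj_mult_nonzero[OF a0, of z] that by simp
  have \<kappa>H: "\<kappa> \<in> Hinf"
  proof (rule disc_algebra_Hinf)
    show "continuous_on (cball 0 1) \<kappa>" unfolding \<kappa>_def by (intro continuous_intros) (use nz in auto)
    show "\<kappa> holomorphic_on ball 0 1" unfolding \<kappa>_def by (intro holomorphic_intros) (use nz in auto)
  qed
  have \<kappa>nz: "\<kappa> z \<noteq> 0" if "z \<in> space circ" for z using nz[of z] that by (simp add: \<kappa>_def)
  have \<beta>H: "\<beta> \<in> Hinf" using quotient_Hinf by (simp add: \<beta>_def[abs_def])
  have B1H: "B1 \<in> Hinf" unfolding B1_def[abs_def] by (rule blaschke_Hinf) (use a in auto)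
  \<comment> \<open>On the circle the conjugate of the removed factor times \<kappa> equals
    \<open>cnj z * cnj \<kappa>\<close>, that is \<open>flip \<kappa>\<close>. This is where a zero
    inside the disk is used.\<close>
  have \<beta>\<kappa>: "(\<lambda>z. cnj (\<beta> z) * \<kappa> z) \<in> HM"
  proof (rule HM_cong)
    show "(\<lambda>z. cnj (B1 z) * flip \<kappa> z) \<in> HM" by (intro cnj_Hinf_mult_HM B1H flip_HP Hinf_HP \<kappa>H)
    show "(\<lambda>z. cnj (\<beta> z) * \<kappa> z) \<in> borel_measurable circ"
      using \<beta>H \<kappa>H by (intro L2_measurable cnj_Hinf_mult_L2 Hinf_L2)
    show "(\<lambda>z. cnj (B1 z) * flip \<kappa> z) \<doteq> (\<lambda>z. cnj (\<beta> z) * \<kappa> z)"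
      using beta AE_space
    proof eventually_elim
      case (elim z)
      have zz: "z * cnj z = 1" using elim(2) by (rule circ_cnj_cancel)
      have w: "1 - cnj (a 0) * z \<noteq> 0" using nz[of z] elim(2) by simp
      then have "cnj (1 - cnj (a 0) * z) \<noteq> 0" by (simp only: complex_cnj_zero_iff not_False_eq_True)
      then have w': "1 - a 0 * cnj z \<noteq> 0" by simp
      have "\<beta> z = B1 z * ((z - a 0) / (1 - cnj (a 0) * z))"
        using elim(1) n by (simp add: \<beta>_def B1_def prod.remove[of "{..<n}" 0] mult_ac)
      then have "cnj (\<beta> z) * \<kappa> z = cnj (B1 z) * ((cnj z - cnj (a 0)) / (1 - a 0 * cnj z) * \<kappa> z)"
        by simp
      also have "cnj z - cnj (a 0) = cnj z * (1 - cnj (a 0) * z)"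
        using zz by (simp add: right_diff_distrib mult.left_commute mult.commute)
      also have "cnj z * (1 - cnj (a 0) * z) / (1 - a 0 * cnj z) * \<kappa> z = flip \<kappa> z"
        using w w' by (simp add: \<kappa>_def flip_def)
      finally show ?case by simp
    qed
  qed
  define q where "q z = \<alpha> z * (cnj (\<psi> z * h1 z) * \<kappa> z)" for z
  note \<alpha>H = inner_fun_Hinf[OF \<alpha>]
  have "(\<lambda>z. \<psi> z * h1 z) \<in> L2" by (intro Linf_mult_L2 \<psi> Hinf_L2 h_Hinf)
  from Hinf_mult_L2[OF \<kappa>H L2_cnj[OF this]] have "(\<lambda>z. cnj (\<psi> z * h1 z) * \<kappa> z) \<in> L2"
    by (simp add: mult_ac)
  then have qL: "q \<in> L2" unfolding q_def[abs_def] by (rule Hinf_mult_L2[OF \<alpha>H])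
  have "q \<in> orth (model_perp \<alpha>)"
  proof (rule orthI[OF qL])
    fix g assume g: "g \<in> model_perp \<alpha>"
    obtain f where f: "f \<in> model_perp \<theta>" and Df: "dual_toeplitz \<theta> \<alpha> \<phi> f \<doteq> g" using surj[OF g] by blast
    define k where "k z = \<phi> z * f z - dual_toeplitz \<theta> \<alpha> \<phi> f z" for z
    have "k \<in> orth (model_perp \<alpha>)" unfolding k_def by (rule dual_toeplitz_props(2)[OF \<phi> model_perp_L2[OF f]])
    then have kP: "k \<in> HP" and kM: "(\<lambda>z. cnj (\<alpha> z) * k z) \<in> HM"
      unfolding orth_model_perp_iff[OF \<alpha>] by blast+
    obtain m u where m: "m \<in> HM" and u: "u \<in> HP" and fmu: "f \<doteq> (\<lambda>z. m z + \<theta> z * u z)"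
      using f model_perp_iff[OF \<theta>] by blast
    have "(\<lambda>z. \<phi> z * f z) \<doteq> (\<lambda>z. g z + k z)" using Df by eventually_elim (simp add: k_def)
    note eq = splitting[OF fmu this]
    define l where "l z = (cnj (\<alpha> z) * h1 z) * m z - hm z * (cnj (\<alpha> z) * k z)" for z
    define r where "r z = h1 z * u z - h2 z * k z" for z
    have lM: "l \<in> HM"
      unfolding l_def[abs_def]
      using cnj_Hinf_mult_HM'[OF hm_Hinf(1) m] cnj_Hinf_mult_HM'[OF hm_Hinf(2) kM] by (rule HM_closed)
    have rP: "r \<in> HP" unfolding r_def[abs_def] by (intro HP_closed Hinf_mult_HP h_Hinf u kP)
    have brP: "(\<lambda>z. \<beta> z * r z) \<in> HP" by (rule Hinf_mult_HP[OF \<beta>H rP])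
    have gL: "g \<in> L2" using g by (rule model_perp_L2)
    \<comment> \<open>Pairing g with q amounts to pairing the two brackets of
      \<open>splitting\<close> with \<kappa>: the first is orthogonal to \<kappa>, and the second,
      with \<beta> moved across, pairs r with \<open>cnj \<beta> \<kappa>\<close>.\<close>
    have "L2_inner g q = (LINT z|circ. (l z + \<beta> z * r z) * cnj (\<kappa> z))"
      unfolding L2_inner_def
    proof (rule integral_cong_AE)
      show "AE z in circ. g z * cnj (q z) = (l z + \<beta> z * r z) * cnj (\<kappa> z)"
        using eq
      proof eventually_elim
        case (elim z)
        have "l z + \<beta> z * r z = cnj (\<alpha> z) * (\<psi> z * h1 z) * g z" using elim by (simp add: l_def \<beta>_def r_def)
        then show ?case by (simp add: q_def mult_ac)
      qed
      show "(\<lambda>z. g z * cnj (q z)) \<in> borel_measurable circ"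
        by (intro borel_measurable_integrable L2_inner_integrable gL qL)
      show "(\<lambda>z. (l z + \<beta> z * r z) * cnj (\<kappa> z)) \<in> borel_measurable circ"
        by (intro borel_measurable_integrable L2_inner_integrable L2_add_closed HM_L2 lM HP_L2[OF brP] Hinf_L2 \<kappa>H)
    qed
    also have "\<dots> = L2_inner l \<kappa> + L2_inner (\<lambda>z. \<beta> z * r z) \<kappa>"
      using Lsp.form_add[OF HM_L2[OF lM] HP_L2[OF brP] Hinf_L2[OF \<kappa>H]] by (simp add: L2_inner_def)
    also have "L2_inner l \<kappa> = 0" by (rule HM_orth_HP[OF lM Hinf_HP[OF \<kappa>H]])
    also have "L2_inner (\<lambda>z. \<beta> z * r z) \<kappa> = L2_inner r (\<lambda>z. cnj (\<beta> z) * \<kappa> z)"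
      by (simp add: L2_inner_def mult_ac)
    also have "\<dots> = 0" by (rule HP_orth_HM[OF rP \<beta>\<kappa>])
    finally show "L2_inner q g = 0" using L2_inner_cnj[of q g] by simp
  qed
  then have qP: "q \<in> HP" and qM: "(\<lambda>z. cnj (\<alpha> z) * q z) \<in> HM"
    unfolding orth_model_perp_iff[OF \<alpha>] by blast+
  \<comment> \<open>The first summand lies in \<open>HP\<close> and the second in \<open>HM\<close>.
    Membership of q in \<open>HP\<close> annihilates the second, hence \<open>h2\<close>; then
    membership of \<open>cnj \<alpha> q\<close> in \<open>HM\<close> annihilates
    \<open>cnj hm * \<kappa>\<close>, hence \<open>hm\<close>. The symbol relation now makes
    \<open>h1\<close> null too, against the lower bound.\<close>
  have qeq: "q \<doteq> (\<lambda>z. \<alpha> z * (cnj (hm z) * \<kappa> z) + cnj (h2 z) * (cnj (\<beta> z) * \<kappa> z))"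
    using symbol_inverse
  proof eventually_elim
    case (elim z)
    show ?case unfolding q_def elim \<beta>_def by (simp add: algebra_simps)
  qed
  have first: "(\<lambda>z. cnj (hm z) * \<kappa> z) \<in> HP" by (intro Hinf_mult_HP hm_Hinf Hinf_HP \<kappa>H)
  define s where "s z = cnj (h2 z) * (cnj (\<beta> z) * \<kappa> z)" for z
  have sM: "s \<in> HM" unfolding s_def[abs_def] by (intro cnj_Hinf_mult_HM h_Hinf \<beta>\<kappa>)
  have "(\<lambda>z. q z - \<alpha> z * (cnj (hm z) * \<kappa> z)) \<in> HP"
    by (intro HP_closed qP Hinf_mult_HP[OF \<alpha>H first])
  then have "s \<in> HP"
  proof (rule HP_cong)
    show "(\<lambda>z. q z - \<alpha> z * (cnj (hm z) * \<kappa> z)) \<doteq> s" using qeq by eventually_elim (simp add: s_def)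
  qed (intro L2_measurable HM_L2 sM)
  then have s0: "s \<doteq> (\<lambda>z. 0)" using sM by (rule HP_HM_trivial)
  have h20: "h2 \<doteq> (\<lambda>z. 0)"
    using s0 AE_space inner_fun_unimodular[OF \<theta>] inner_fun_unimodular[OF \<alpha>]
  proof eventually_elim
    case (elim z)
    have "\<beta> z \<noteq> 0" using elim(3,4) by (auto simp: \<beta>_def)
    then show ?case using elim(1) \<kappa>nz[OF elim(2)] by (simp add: s_def)
  qed
  have "(\<lambda>z. cnj (hm z) * \<kappa> z) \<in> HM"
  proof (rule HM_cong[OF qM])
    show "(\<lambda>z. cnj (\<alpha> z) * q z) \<doteq> (\<lambda>z. cnj (hm z) * \<kappa> z)"
      using qeq h20 inner_fun_cnj_cancel[OF \<alpha>]
    proof eventually_elim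
      case (elim z)
      have "cnj (\<alpha> z) * q z = (\<alpha> z * cnj (\<alpha> z)) * (cnj (hm z) * \<kappa> z)" using elim(1,2) by (simp add: mult_ac)
      then show ?case using elim(3) by simp
    qed
  qed (intro L2_measurable HP_L2 first)
  with first have "(\<lambda>z. cnj (hm z) * \<kappa> z) \<doteq> (\<lambda>z. 0)" by (rule HP_HM_trivial)
  then have hm0: "hm \<doteq> (\<lambda>z. 0)" using AE_space by eventually_elim (use \<kappa>nz in force)
  obtain \<epsilon> where \<epsilon>: "0 < \<epsilon>" and low: "AE z in circ. \<epsilon> \<le> (cmod (h1 z))\<^sup>2 + (cmod (h2 z))\<^sup>2"
    using CP_plus_boundary[OF cp] by blast
  have "AE z in circ. (1::real) = 0"
    using sym hm0 h20 low
  proof eventually_elim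
    case (elim z)
    have "h1 z = 0" using elim(1,2,3) by simp
    then show ?case using elim(3,4) \<epsilon> by simp
  qed
  then have "(LINT z|circ. (1::real)) = (LINT z|circ. 0)" by (intro integral_cong_AE) auto
  then show False by simp
qed

text \<open>For \<open>\<alpha> = c \<theta>\<close> the quotient
  \<open>\<theta> cnj \<alpha>\<close> is the constant \<open>cnj c\<close>, so the equation of
  \<open>splitting\<close> is a decomposition of its right side R into an \<open>HM\<close> part and
  an \<open>HP\<close> part. Each part is a corona equation with bounded solutions; the remaining
  freedom is used to obtain one and the same k from both.\<close>

theorem dual_toeplitz_surjective:
  assumes c: "cmod c = 1" and \<alpha>\<theta>: "\<alpha> \<doteq> (\<lambda>z. c * \<theta> z)"
  shows "\<exists>C. \<forall>g\<in>model_perp \<alpha>. \<exists>f\<in>model_perp \<theta>. dual_toeplitz \<theta> \<alpha> \<phi> f \<doteq> g \<and> L2_norm f \<le> C * L2_norm g"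
proof -
  obtain C1 where C1: "0 \<le> C1" "\<And>R. R \<in> HP \<Longrightarrow> \<exists>x\<in>HP. \<exists>y\<in>HP. (\<lambda>z. h1 z * x z + h2 z * y z) \<doteq> R \<and>
    L2_norm x \<le> C1 * L2_norm R \<and> L2_norm y \<le> C1 * L2_norm R"
    using corona_solvable[OF cp] by blast
  obtain C2 where C2: "0 \<le> C2" "\<And>R. R \<in> HM \<Longrightarrow> \<exists>x\<in>HM. \<exists>y\<in>HM. (\<lambda>z. cnj (\<alpha> z) * h1 z * x z + hm z * y z) \<doteq> R \<and>
    L2_norm x \<le> C2 * L2_norm R \<and> L2_norm y \<le> C2 * L2_norm R"
    using corona_solvable_minus[OF cm] by blast
  obtain M where M: "0 < M" "AE z in circ. cmod (h1 z) \<le> M" "AE z in circ. cmod (h2 z) \<le> M" "AE z in circ. cmod (hm z) \<le> M"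
  proof -
    obtain A where A: "AE z in circ. cmod (h1 z) \<le> A" "0 < A" using HinfE[OF h_Hinf(1)] by metis
    obtain B where B: "AE z in circ. cmod (h2 z) \<le> B" using HinfE[OF h_Hinf(2)] by metis
    obtain D where D: "AE z in circ. cmod (cnj (hm z)) \<le> D" using HinfE[OF hm_Hinf(2)] by metis
    let ?M = "max A (max B D)"
    have "AE z in circ. cmod (h1 z) \<le> ?M" using A(1) by eventually_elim simp
    moreover have "AE z in circ. cmod (h2 z) \<le> ?M" using B by eventually_elim simp
    moreover have "AE z in circ. cmod (hm z) \<le> ?M" using D by eventually_elim simp
    ultimately show ?thesis using that[of ?M] A(2) by simp
  qed
  obtain P where P: "0 < P" "AE z in circ. cmod (\<psi> z) \<le> P" using Linf_bound[OF \<psi>] by blast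
  obtain \<epsilon> where \<epsilon>: "0 < \<epsilon>" and low: "AE z in circ. \<epsilon> \<le> (cmod (h1 z))\<^sup>2 + (cmod (h2 z))\<^sup>2"
    using CP_plus_boundary[OF cp] by blast
  note \<theta>H = inner_fun_Hinf[OF \<theta>] and \<alpha>H = inner_fun_Hinf[OF \<alpha>]
  have hmm: "hm \<in> borel_measurable circ"
    using circ_measurable_cnj[OF Hinf_measurable[OF hm_Hinf(2)]] by simp
  have [measurable]: "h1 \<in> borel_measurable circ" "h2 \<in> borel_measurable circ" "hm \<in> borel_measurable circ"
    "\<theta> \<in> borel_measurable circ" "\<alpha> \<in> borel_measurable circ" "\<psi> \<in> borel_measurable circ"
    using Hinf_measurable h_Hinf \<theta>H \<alpha>H hmm Linf_measurable[OF \<psi>] by auto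
  have \<theta>1: "AE z in circ. cmod (\<theta> z) \<le> 1" using inner_fun_unimodular[OF \<theta>] by eventually_elim simp
  have \<alpha>1: "AE z in circ. cmod (\<alpha> z) \<le> 1" using inner_fun_unimodular[OF \<alpha>] by eventually_elim simp
  \<comment> \<open>The constants are fixed before g and multiply its norm: K bounds the four
    partial solutions, \<open>E0\<close> the function E, W the function w, and C the preimage
    f.\<close>
  define K where "K = max C1 C2 * (M * P)"
  have K: "0 \<le> K" using C1 C2 M P by (auto simp: K_def)
  define E0 where "E0 = P + K + (P * K + K)"
  define W where "W = (M / \<epsilon>) * (K + K) + (M / \<epsilon>) * E0"
  define C where "C = (K + M * W) + (K + M * W)"
  have "\<exists>f\<in>model_perp \<theta>. dual_toeplitz \<theta> \<alpha> \<phi> f \<doteq> g \<and> L2_norm f \<le> C * L2_norm g" if g: "g \<in> model_perp \<alpha>" for g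
  proof -
    have gL: "g \<in> L2" using g by (rule model_perp_L2)
    define N where "N = L2_norm g"
    have N0: "0 \<le> N" by (simp add: N_def)
    define R where "R z = (cnj (\<alpha> z) * h1 z) * (\<psi> z * g z)" for z
    have \<psi>g: "(\<lambda>z. \<psi> z * g z) \<in> L2" "L2_norm (\<lambda>z. \<psi> z * g z) \<le> P * N"
      unfolding N_def using P by (auto intro!: L2_norm_mult_bounded Linf_mult_L2 \<psi> gL)
    have ab: "AE z in circ. cmod (cnj (\<alpha> z) * h1 z) \<le> M"
      using inner_fun_unimodular[OF \<alpha>] M(2) by eventually_elim (simp add: norm_mult)
    have RL: "R \<in> L2" unfolding R_def[abs_def] by (rule L2_mult_bounded[OF \<psi>g(1) _ ab]) measurable
    have RN: "L2_norm R \<le> M * (P * N)"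
    proof -
      have "L2_norm R \<le> M * L2_norm (\<lambda>z. \<psi> z * g z)"
        unfolding R_def[abs_def] by (rule L2_norm_mult_bounded[OF \<psi>g(1) _ ab]) (measurable, use M(1) in simp)
      also have "\<dots> \<le> M * (P * N)" using M(1) \<psi>g(2) by simp
      finally show ?thesis .
    qed
    obtain Rp Rm where Rpm: "Rp \<in> HP" "Rm \<in> HM" "\<And>z. R z = Rp z + Rm z" "L2_norm Rp \<le> L2_norm R" "L2_norm Rm \<le> L2_norm R"
      using L2_decompose[OF RL] by metis
    obtain a1 b1 where a1: "a1 \<in> HP" and b1: "b1 \<in> HP" and e1: "(\<lambda>z. h1 z * a1 z + h2 z * b1 z) \<doteq> Rp"
      and n1: "L2_norm a1 \<le> C1 * L2_norm Rp" "L2_norm b1 \<le> C1 * L2_norm Rp"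
      using C1(2)[OF Rpm(1)] by blast
    obtain a2 b2 where a2: "a2 \<in> HM" and b2: "b2 \<in> HM" and e2: "(\<lambda>z. cnj (\<alpha> z) * h1 z * a2 z + hm z * b2 z) \<doteq> Rm"
      and n2: "L2_norm a2 \<le> C2 * L2_norm Rm" "L2_norm b2 \<le> C2 * L2_norm Rm"
      using C2(2)[OF Rpm(2)] by blast
    have "C1 * L2_norm Rp \<le> max C1 C2 * (M * (P * N))" "C2 * L2_norm Rm \<le> max C1 C2 * (M * (P * N))"
      using C1(1) C2(1) Rpm(4,5) RN by (intro mult_mono; simp)+
    then have KN: "L2_norm a1 \<le> K * N" "L2_norm b1 \<le> K * N" "L2_norm a2 \<le> K * N" "L2_norm b2 \<le> K * N"
      using n1 n2 by (auto simp: K_def mult.assoc)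
    note L = HP_L2[OF a1] HP_L2[OF b1] HM_L2[OF a2] HM_L2[OF b2]
    \<comment> \<open>The solutions of the two halves can be changed by \<open>h1 u\<close>, \<open>h2 u\<close> and \<open>cnj \<alpha> h1 n\<close>, \<open>hm n\<close>. They fit together
      iff \<open>w = u + n\<close> satisfies \<open>h1 w = \<rho>\<close>, and \<open>h2 \<rho> = h1 E\<close> makes this solvable on the circle.\<close>
    define \<rho> where "\<rho> z = 1 * b1 z + (- \<theta> z) * b2 z" for z
    have \<rho>: "\<rho> \<in> L2" "L2_norm \<rho> \<le> 1 * (K * N) + 1 * (K * N)"
      unfolding \<rho>_def[abs_def] using L2_combination_bound[OF L(2) L(4), of "\<lambda>z. 1" "\<lambda>z. - \<theta> z" 1 1 "K * N" "K * N"] KN \<theta>1 by auto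
    define G1 where "G1 z = cnj (\<alpha> z) * (\<psi> z * g z) + (-1) * a1 z" for z
    have G1: "G1 \<in> L2" "L2_norm G1 \<le> 1 * (P * N) + 1 * (K * N)"
      unfolding G1_def[abs_def] using L2_combination_bound[OF \<psi>g(1) L(1), of "\<lambda>z. cnj (\<alpha> z)" "\<lambda>z. -1" 1 1 "P * N" "K * N"] \<psi>g(2) KN \<alpha>1 by auto
    define G2 where "G2 z = (- \<psi> z) * b2 z + (- cnj (\<alpha> z)) * a2 z" for z
    have G2: "G2 \<in> L2" "L2_norm G2 \<le> P * (K * N) + 1 * (K * N)"
      unfolding G2_def[abs_def] using L2_combination_bound[OF L(4) L(3), of "\<lambda>z. - \<psi> z" "\<lambda>z. - cnj (\<alpha> z)" P 1 "K * N" "K * N"] P KN \<alpha>1 by auto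
    define E where "E z = G1 z + G2 z" for z
    have E: "E \<in> L2" "L2_norm E \<le> E0 * N"
    proof -
      show "E \<in> L2" unfolding E_def by (intro L2_add_closed G1 G2)
      have "L2_norm E \<le> L2_norm G1 + L2_norm G2" unfolding E_def by (rule L2_norm_triangle[OF G1(1) G2(1)])
      also have "\<dots> \<le> E0 * N" using G1(2) G2(2) by (simp add: E0_def algebra_simps)
      finally show "L2_norm E \<le> E0 * N" .
    qed
    define D where "D z = h1 z * cnj (h1 z) + h2 z * cnj (h2 z)" for z
    have Dre: "D z = of_real ((cmod (h1 z))\<^sup>2 + (cmod (h2 z))\<^sup>2)" for z
      by (simp only: D_def complex_norm_square of_real_add)
    have Dlow: "AE z in circ. \<epsilon> \<le> cmod (D z)"
      using low by eventually_elim (simp only: Dre norm_of_real abs_of_nonneg sum_power2_ge_zero)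
    have [measurable]: "D \<in> borel_measurable circ" unfolding D_def[abs_def] by measurable
    have quot: "AE z in circ. cmod (cnj (h z) / D z) \<le> M / \<epsilon>" if "AE z in circ. cmod (h z) \<le> M" for h
      using that Dlow by eventually_elim (use \<epsilon> M in \<open>auto simp: norm_divide intro!: frac_le\<close>)
    \<comment> \<open>The least squares formula for the two equations \<open>h1 w = \<rho>\<close>
      and \<open>h2 w = E\<close>. It is an exact solution because they are compatible, and its
      coefficients are bounded since D is bounded below.\<close>
    define w where "w z = cnj (h1 z) / D z * \<rho> z + cnj (h2 z) / D z * E z" for z
    have w: "w \<in> L2" "L2_norm w \<le> M / \<epsilon> * (1 * (K * N) + 1 * (K * N)) + M / \<epsilon> * (E0 * N)"
    proof -
      have m: "(\<lambda>z. cnj (h1 z) / D z) \<in> borel_measurable circ" "(\<lambda>z. cnj (h2 z) / D z) \<in> borel_measurable circ"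
        by measurable
      have "0 \<le> M / \<epsilon>" using M(1) \<epsilon> by simp
      then show "w \<in> L2" "L2_norm w \<le> M / \<epsilon> * (1 * (K * N) + 1 * (K * N)) + M / \<epsilon> * (E0 * N)"
        unfolding w_def[abs_def]
        using L2_combination_bound[OF \<rho>(1) E(1) m quot[OF M(2)] quot[OF M(3)] _ _ \<rho>(2) E(2)] by blast+
    qed
    have wN: "L2_norm w \<le> W * N" using w(2) by (simp add: W_def algebra_simps)
    obtain u n where un: "u \<in> HP" "n \<in> HM" "\<And>z. w z = u z + n z" "L2_norm u \<le> L2_norm w" "L2_norm n \<le> L2_norm w"
      using L2_decompose[OF w(1)] by metis
    \<comment> \<open>Particular solutions plus homogeneous ones with parameters u and n. The
      factors c compensate \<open>\<theta> cnj \<alpha> = cnj c\<close> in the \<open>HP\<close>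
      half.\<close>
    define k where "k z = c * (h1 z * u z - b1 z)" for z
    define x where "x z = 1 * a2 z + (- c * hm z) * n z" for z
    define y where "y z = 1 * a1 z + h2 z * u z" for z
    define f where "f z = 1 * x z + (c * \<theta> z) * y z" for z
    have cM: "AE z in circ. cmod (- c * hm z) \<le> M" using M(4) by eventually_elim (simp add: norm_mult c)
    have x: "x \<in> L2" "L2_norm x \<le> 1 * (K * N) + M * (W * N)"
      unfolding x_def[abs_def] using L2_combination_bound[OF L(3) HM_L2[OF un(2)], of "\<lambda>z. 1" "\<lambda>z. - c * hm z" 1 M "K * N" "W * N"] cM M(1) KN un(5) wN by auto
    have y: "y \<in> L2" "L2_norm y \<le> 1 * (K * N) + M * (W * N)"
      unfolding y_def[abs_def] using L2_combination_bound[OF L(1) HP_L2[OF un(1)], of "\<lambda>z. 1" h2 1 M "K * N" "W * N"] M(1,3) KN un(4) wN by auto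
    have ct: "AE z in circ. cmod (c * \<theta> z) \<le> 1" using \<theta>1 by eventually_elim (simp add: norm_mult c)
    have fL: "f \<in> L2" "L2_norm f \<le> 1 * (1 * (K * N) + M * (W * N)) + 1 * (1 * (K * N) + M * (W * N))"
      unfolding f_def[abs_def] using L2_combination_bound[OF x(1) y(1), of "\<lambda>z. 1" "\<lambda>z. c * \<theta> z" 1 1, OF _ _ _ ct _ _ x(2) y(2)] by simp_all
    have xM: "x \<in> HM"
    proof -
      have "(\<lambda>z. a2 z + (- c) * (hm z * n z)) \<in> HM" by (intro HM_closed a2 cnj_Hinf_mult_HM' hm_Hinf un)
      then show ?thesis by (simp add: x_def[abs_def] mult.assoc)
    qed
    have yP: "(\<lambda>z. c * y z) \<in> HP"
      unfolding y_def mult_1 by (intro HP_closed a1 Hinf_mult_HP h_Hinf un)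
    have fX: "f \<in> model_perp \<theta>"
    proof -
      have "f \<doteq> (\<lambda>z. x z + \<theta> z * (c * y z))" by (simp add: f_def mult_ac)
      then show ?thesis unfolding model_perp_iff[OF \<theta>]
        by (intro conjI fL(1) bexI[OF _ xM] bexI[OF _ yP])
    qed
    have kP: "k \<in> HP" unfolding k_def by (intro HP_closed b1 Hinf_mult_HP h_Hinf un)
    have cc: "c * cnj c = 1" using c by (simp add: complex_norm_square[symmetric])
    have sol: "AE z in circ. h1 z * w z = \<rho> z \<and> h2 z * w z = E z"
      using e1 e2 symbol_inverse Dlow
    proof eventually_elim
      case (elim z)
      have D0: "D z \<noteq> 0" using elim(4) \<epsilon> by auto
      have "h2 z * \<rho> z = h2 z * b1 z - (\<psi> z * h1 z - hm z) * b2 z"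
        unfolding elim(3) by (simp add: \<rho>_def algebra_simps)
      also have "\<dots> = (h1 z * a1 z + h2 z * b1 z) + (cnj (\<alpha> z) * h1 z * a2 z + hm z * b2 z)
          - h1 z * a1 z - cnj (\<alpha> z) * h1 z * a2 z - \<psi> z * h1 z * b2 z"
        by (simp add: algebra_simps)
      also have "\<dots> = R z - h1 z * a1 z - cnj (\<alpha> z) * h1 z * a2 z - \<psi> z * h1 z * b2 z"
        unfolding elim(1,2) Rpm(3) ..
      also have "\<dots> = h1 z * E z" by (simp add: R_def E_def G1_def G2_def algebra_simps)
      finally have swap: "h2 z * \<rho> z = h1 z * E z" .
      have wD: "w z = (cnj (h1 z) * \<rho> z + cnj (h2 z) * E z) / D z" by (simp add: w_def add_divide_distrib)
      have "h1 z * (cnj (h1 z) * \<rho> z + cnj (h2 z) * E z) = h1 z * cnj (h1 z) * \<rho> z + cnj (h2 z) * (h1 z * E z)"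
        by (simp add: algebra_simps)
      also have "\<dots> = \<rho> z * D z" unfolding swap[symmetric] by (simp add: D_def algebra_simps)
      finally have 1: "h1 z * w z = \<rho> z" using D0 by (simp add: wD)
      have "h2 z * (cnj (h1 z) * \<rho> z + cnj (h2 z) * E z) = cnj (h1 z) * (h2 z * \<rho> z) + h2 z * cnj (h2 z) * E z"
        by (simp add: algebra_simps)
      also have "\<dots> = E z * D z" unfolding swap by (simp add: D_def algebra_simps)
      finally have 2: "h2 z * w z = E z" using D0 by (simp add: wD)
      show ?case using 1 2 by blast
    qed
    \<comment> \<open>The description of k by the \<open>HM\<close> half; that it agrees with the
      one by the \<open>HP\<close> half is the equation \<open>h1 w = \<rho>\<close>.\<close>
    have kM: "(\<lambda>z. cnj (\<alpha> z) * k z) \<in> HM"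
    proof (rule HM_cong)
      show "(\<lambda>z. (- c) * ((cnj (\<alpha> z) * h1 z) * n z) - b2 z) \<in> HM"
        by (intro HM_closed b2 cnj_Hinf_mult_HM' hm_Hinf un)
      show "(\<lambda>z. cnj (\<alpha> z) * k z) \<in> borel_measurable circ"
        by (intro L2_measurable cnj_Hinf_mult_L2 \<alpha>H HP_L2 kP)
      show "(\<lambda>z. (- c) * ((cnj (\<alpha> z) * h1 z) * n z) - b2 z) \<doteq> (\<lambda>z. cnj (\<alpha> z) * k z)"
        using sol \<alpha>\<theta> inner_fun_cnj_cancel[OF \<theta>]
      proof eventually_elim
        case (elim z)
        have ca: "c * cnj (\<alpha> z) = cnj (\<theta> z)" unfolding elim(2) using cc by (simp add: mult.assoc[symmetric])
        have "h1 z * u z + h1 z * n z = b1 z - \<theta> z * b2 z"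
          using elim(1) un(3)[of z] by (simp add: \<rho>_def distrib_left)
        then have hu: "h1 z * u z - b1 z = - (\<theta> z * b2 z) - h1 z * n z"
          by (simp add: algebra_simps eq_diff_eq diff_eq_eq)
        have "cnj (\<alpha> z) * k z = (c * cnj (\<alpha> z)) * (h1 z * u z - b1 z)" by (simp add: k_def mult_ac)
        also have "\<dots> = - ((\<theta> z * cnj (\<theta> z)) * b2 z) - (c * cnj (\<alpha> z)) * h1 z * n z"
          unfolding hu ca by (simp add: algebra_simps)
        finally have "cnj (\<alpha> z) * k z = - b2 z - c * cnj (\<alpha> z) * h1 z * n z" unfolding elim(3) by simp
        then show ?case by (simp only:) (simp add: algebra_simps)
      qed
    qed
    have kX: "k \<in> orth (model_perp \<alpha>)" unfolding orth_model_perp_iff[OF \<alpha>] using kP kM by blast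
    have main: "(\<lambda>z. k z) \<doteq> (\<lambda>z. \<phi> z * f z - g z)"
      using sol \<alpha>\<theta> symbol_inverse inner_fun_cnj_cancel[OF \<theta>] \<phi>\<psi>
    proof eventually_elim
      case (elim z)
      have ta: "c * \<theta> z * cnj (\<alpha> z) = 1"
      proof -
        have "c * \<theta> z * cnj (\<alpha> z) = (c * cnj c) * (\<theta> z * cnj (\<theta> z))" unfolding elim(2) by (simp add: mult_ac)
        then show ?thesis using cc elim(4) by simp
      qed
      \<comment> \<open>Since \<open>hm = \<psi> h1 - \<theta> h2\<close>, both equations for w
        enter here, and with them the definition of E.\<close>
      have hw: "hm z * w z = \<psi> z * \<rho> z - \<theta> z * E z"
      proof -
        have "hm z * w z = (\<psi> z * h1 z - \<theta> z * h2 z) * w z" unfolding elim(3) by simp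
        also have "\<dots> = \<psi> z * (h1 z * w z) - \<theta> z * (h2 z * w z)" by (simp add: algebra_simps)
        finally show ?thesis using elim(1) by simp
      qed
      have "f z - \<psi> z * k z = a2 z - c * hm z * n z + c * \<theta> z * a1 z + c * \<theta> z * h2 z * u z - c * (\<psi> z * h1 z) * u z + c * \<psi> z * b1 z"
        by (simp add: f_def x_def y_def k_def algebra_simps)
      also have "\<dots> = a2 z + c * \<theta> z * a1 z + c * \<psi> z * b1 z - c * (hm z * w z)"
        unfolding elim(3) un(3) by (simp add: algebra_simps)
      also have "\<dots> = a2 z - (c * \<theta> z * cnj (\<alpha> z)) * a2 z + (c * \<theta> z * cnj (\<alpha> z)) * (\<psi> z * g z)"
        unfolding hw by (simp add: \<rho>_def E_def G1_def G2_def algebra_simps)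
      finally have "f z = \<psi> z * (g z + k z)" unfolding ta by (simp add: algebra_simps)
      then have "\<phi> z * f z = (\<phi> z * \<psi> z) * (g z + k z)" by (simp add: mult_ac)
      then show ?case using elim(5) by simp
    qed
    have "dual_toeplitz \<theta> \<alpha> \<phi> f \<doteq> g"
    proof (rule dual_toeplitz_unique[OF \<phi> fL(1) g])
      show "(\<lambda>z. \<phi> z * f z - g z) \<in> orth (model_perp \<alpha>)"
      proof (rule orth_cong[OF _ kX _ main])
        show "model_perp \<alpha> \<subseteq> L2" using model_perp_L2 by blast
        show "(\<lambda>z. \<phi> z * f z - g z) \<in> borel_measurable circ"
          by (intro L2_measurable L2_diff Linf_mult_L2 \<phi> fL gL)
      qed
    qed
    moreover have "L2_norm f \<le> C * L2_norm g"
      using fL(2) by (simp add: C_def N_def algebra_simps)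
    ultimately show ?thesis using fX by blast
  qed
  then show ?thesis by blast
qed

end


theorem theorem7p3:
  fixes \<theta> \<alpha> \<phi> h1p h2p h2m :: "complex \<Rightarrow> complex"
  assumes "inner_fun \<theta>" and "inner_fun \<alpha>" and "inner_divides \<alpha> \<theta>"
    and "invertible_Linf \<phi>"
    and "h1p \<in> Hinf" and "h2p \<in> Hinf" and "(\<lambda>z. cnj (h2m z)) \<in> Hinf"
    and "(h1p, h2p) \<in> CP_plus"
    and "(\<lambda>z. cnj (\<alpha> z) * h1p z, h2m) \<in> CP_minus"
    and "(\<lambda>z. \<phi> z * (h2m z + \<theta> z * h2p z)) \<doteq> h1p"
  shows "op_ker (dual_toeplitz \<theta> \<alpha> \<phi>) (model_perp \<theta>) = L2_zero \<and>
    (\<forall>k. finite_blaschke k (\<lambda>z. \<theta> z * cnj (\<alpha> z)) \<longrightarrow>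
       op_injective (dual_toeplitz \<theta> \<alpha> \<phi>) (model_perp \<theta>) \<and>
       (op_invertible (dual_toeplitz \<theta> \<alpha> \<phi>) (model_perp \<theta>) (model_perp \<alpha>) \<longleftrightarrow>
          (\<exists>c. cmod c = 1 \<and> \<alpha> \<doteq> (\<lambda>z. c * \<theta> z)))) \<and>
    (\<alpha> \<doteq> \<theta> \<longrightarrow>
       op_invertible (dual_toeplitz \<theta> \<theta> \<phi>) (model_perp \<theta>) (model_perp \<theta>))"
proof -
  let ?T = "dual_toeplitz \<theta> \<alpha> \<phi>"
  note \<theta> = assms(1) and \<alpha> = assms(2)
  obtain \<psi> where \<phi>: "\<phi> \<in> Linf" and \<psi>: "\<psi> \<in> Linf" "(\<lambda>z. \<phi> z * \<psi> z) \<doteq> (\<lambda>z. 1)"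
    using assms(4) by (auto simp: invertible_Linf_def)
  note hyps = \<theta> \<alpha> assms(3) \<phi> \<psi> assms(8,9,10)
  note ker = dual_toeplitz_kernel[OF hyps]
  note T = dual_toeplitz_bounded_op[OF \<phi>, of \<theta> \<alpha>]
  have inj: "op_injective ?T (model_perp \<theta>)"
    by (rule op_kernel_trivial_imp_injective[OF T model_perp_closed(3) ker])
  have inv: "op_invertible ?T (model_perp \<theta>) (model_perp \<alpha>)"
    if c: "cmod c = 1" "\<alpha> \<doteq> (\<lambda>z. c * \<theta> z)" for c
  proof -
    obtain C where C: "\<forall>g\<in>model_perp \<alpha>. \<exists>f\<in>model_perp \<theta>. ?T f \<doteq> g \<and> L2_norm f \<le> C * L2_norm g"
      using dual_toeplitz_surjective[OF hyps c] by blast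
    show ?thesis
      by (rule op_invertibleI[OF T inj model_perp_closed(2,4) _ model_perp_closed(2,4) bspec[OF C]])
         (auto intro: model_perp_L2)
  qed
  have "op_ker ?T (model_perp \<theta>) = L2_zero"
  proof (intro equalityI subsetI)
    fix f assume "f \<in> op_ker ?T (model_perp \<theta>)"
    then show "f \<in> L2_zero" using ker model_perp_L2[of f \<theta>] by (simp add: op_ker_def L2_zero_def)
  next
    fix f assume "f \<in> L2_zero"
    then have f: "f \<in> L2" "f \<doteq> (\<lambda>z. 0)" by (auto simp: L2_zero_def)
    have fX: "f \<in> model_perp \<theta>"
    proof (rule model_perp_cong[OF model_perp_closed(1) L2_measurable[OF f(1)]])
      show "(\<lambda>z. 0) \<doteq> f" using f(2) by eventually_elim simp
    qed
    have "?T f \<doteq> (\<lambda>z. 0)"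
    proof (rule dual_toeplitz_unique[OF \<phi> f(1) model_perp_closed(1)])
      show "(\<lambda>z. \<phi> z * f z - 0) \<in> orth (model_perp \<alpha>)"
      proof (rule orth_cong)
        show sub: "model_perp \<alpha> \<subseteq> L2" using model_perp_L2 by blast
        show "(\<lambda>z. 0) \<in> orth (model_perp \<alpha>)" by (rule orth_zero[OF sub])
        show "(\<lambda>z. \<phi> z * f z - 0) \<in> borel_measurable circ"
          using Linf_mult_L2[OF \<phi> f(1)] by (simp add: L2_measurable)
        show "(\<lambda>z. 0) \<doteq> (\<lambda>z. \<phi> z * f z - 0)" using f(2) by eventually_elim simp
      qed
    qed
    then show "f \<in> op_ker ?T (model_perp \<theta>)" using fX by (simp add: op_ker_def)
  qed
  moreover have "\<exists>c. cmod c = 1 \<and> \<alpha> \<doteq> (\<lambda>z. c * \<theta> z)"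
    if B: "finite_blaschke k (\<lambda>z. \<theta> z * cnj (\<alpha> z))" and I: "op_invertible ?T (model_perp \<theta>) (model_perp \<alpha>)" for k
  \<comment> \<open>In degree 0 the quotient is a unimodular constant, which gives the relation
    directly; in positive degree an invertible operator would be surjective.\<close>
  proof (cases "k = 0")
    case True
    then obtain c where c: "cmod c = 1" "(\<lambda>z. \<theta> z * cnj (\<alpha> z)) \<doteq> (\<lambda>z. c)"
      using B unfolding finite_blaschke_def by auto
    have "\<alpha> \<doteq> (\<lambda>z. cnj c * \<theta> z)"
      using c(2) inner_fun_cnj_cancel[OF \<theta>]
    proof eventually_elim
      case (elim z)
      have "cnj c * \<theta> z = cnj (\<theta> z * cnj (\<alpha> z)) * \<theta> z" unfolding elim(1) ..
      also have "\<dots> = (\<theta> z * cnj (\<theta> z)) * \<alpha> z" by (simp add: mult_ac)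
      finally show ?case using elim(2) by simp
    qed
    then show ?thesis using c(1) by (intro exI[of _ "cnj c"]) simp
  next
    case False
    obtain S where S: "bounded_op S (model_perp \<alpha>) (model_perp \<theta>)" "\<forall>g\<in>model_perp \<alpha>. ?T (S g) \<doteq> g"
      using I unfolding op_invertible_def by blast
    have "\<exists>f\<in>model_perp \<theta>. ?T f \<doteq> g" if g: "g \<in> model_perp \<alpha>" for g
      using bspec[OF S(2) g] S(1) g unfolding bounded_op_def by (intro bexI[of _ "S g"]) auto
    from dual_toeplitz_not_surjective[OF hyps B _ this] False show ?thesis by simp
  qed
  moreover have "op_invertible (dual_toeplitz \<theta> \<theta> \<phi>) (model_perp \<theta>) (model_perp \<theta>)" if eq: "\<alpha> \<doteq> \<theta>"
  proof -
    have eq1: "\<alpha> \<doteq> (\<lambda>z. 1 * \<theta> z)" using eq by simp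
    \<comment> \<open>The operator depends on \<alpha> only through this space, so equality of
      \<alpha> and \<theta> almost everywhere yields the same operator.\<close>
    have "model_perp \<alpha> = model_perp \<theta>" by (rule model_perp_const_mult[OF \<theta> \<alpha> _ eq1]) simp
    then show ?thesis using inv[OF _ eq1] by (simp add: dual_toeplitz_def[abs_def])
  qed
  ultimately show ?thesis using inj inv by blast
qed

end
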